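(* Let $L$ be a geometric lattice and $\mathcal H$ a partial building set for $L$. The algebra $\hat B(L,\mathcal H)$ has an additive ($\mathbb Q$-)basis given by the monomials $e_Sx_T^b=e_S\prod_{g\in T}x_g^{b(g)}$ for which $S\cup T\in N(L,\mathcal H)$, $S\in\mathbf{nbc}(\mathcal L(L,\mathcal H))$, and for each $g\in T$ we have $$0<b(g)<\operatorname{rank}\Big[\bigvee (S\cup T)_{<g},\,g\Big],$$ where $(S\cup T)_{<g}=\{f\in S\cup T: f<g\}$ and the order, join and interval are taken in $L$. If $\hat 1\in\mathcal H$, then the subset of monomials of this form which do not contain $e_{\hat 1}$ is an additive basis for the algebra $B(L,\mathcal H)$.
   Context: All posets are finite. For a meet-semilattice $P$ with least element $\hat 0$, write $P_+=P\setminus\{\hat 0\}$, $\mathrm{a}(P)$ for its set of atoms. $P$ is locally geometric if every interval $[\hat 0,x]$ is a geometric lattice; $M(P_{\le x})$ is the simple matroid on the atoms below $x$ whose lattice of flats is $[\hat 0,x]$. Blowups. For $p\in P_+$, let $P_{(p)}=\{x\in P: x\not\ge p,\ p\vee x \text{ exists}\}$ and $\mathrm{Bl}_p(P)=\{x\in P:x\not\ge p\}\cup\{(p,x):x\in P_{(p)}\}$, ordered by: $y>x$ if $y>x$ in $P$; $(p,y)>(p,x)$ if $y>x$ in $P$; $(p,y)>x$ if $y\ge x$ in $P$. Building sets. $\mathcal G\subseteq L_+$ is a building set if for every $x\in L_+$ with $\max \mathcal G_{\le x}=\{x_1,\dots,x_k\}$ there is a poset isomorphism $\prod_j[\hat 0,x_j]\to[\hat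 0,x]$ sending $(\hat 0,\dots,x_j,\dots,\hat 0)$ to $x_j$; always $\hat 1\in\mathcal G$. A partial building set is $\mathcal H\subseteq\mathcal G$ (for some building set $\mathcal G$) with $\mathrm{a}(L)\subseteq\mathcal H$ and $\mathcal H^\circ:=\mathcal H\setminus \mathrm{a}(L)$ upward closed in $\mathcal G$. Fix a linear order $\prec$ on $\mathcal H$ such that $p\ge q\Rightarrow p\prec q$. Writing $\mathcal H^\circ=\{p_1\prec\dots\prec p_m\}$, set $\mathcal L(L,\mathcal H)=\mathrm{Bl}_{p_m}\circ\cdots\circ\mathrm{Bl}_{p_1}(L)$, a locally geometric semilattice whose atoms are identified with $\mathcal H$. $S\subseteq\mathcal H$ is $\mathcal H$-nested if the join in $L$ of any two or more pairwise incomparable elements of $S$ is not in $\mathcal H$; $N(L,\mathcal H)$ is the complex of nested sets (equivalently, sets of atoms of $\mathcal L(L,\mathcal H)$ with an upper bound). $S\in N(L,\mathcal H)$ is a circuit if it is a circuit of $M(\mathcal L(L,\mathcal H)_{\le\bigvee S})$, join in $\mathcal L(L,\mathcal H)$. No-broken-circuit sets. A simplex $S\in N(L,\mathcal H)$ is a broken circuit if there is $g\prec\min_\prec S$ such that $\{g\}\cup S$ is a circuit in $M(\mathcal L(L,\mathcal H)_{\le x})$ for some $x\ge g\vee\bigvee S$ in $\mathcal L(L,\mathcal H)$. $\mathbf{nbc}(\mathcal L(L,\mathcal H))$ is the set of simplices of $N(L,\mathcal H)$ containing no broken circuit. Algebra. $R(\mathcal H)=\mathbb Q[e_g,x_g:g\in\mathcal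 H]$ is the free graded-commutative algebra with $e_g$ in bidegree $(0,1)$ and $x_g$ in bidegree $(2,0)$. Put $e_S=e_{g_1}\cdots e_{g_k}$ for $S=\{g_1\prec\dots\prec g_k\}$, $x_T=\prod_{g\in T}x_g$, $\partial e_S=\sum_j(-1)^{j-1}e_{g_1}\cdots\widehat{e_{g_j}}\cdots e_{g_k}$, $c_g=\sum_{h\in\mathcal H,\,h\ge g}x_h$. $\hat B(L,\mathcal H)$ is the quotient of $R(\mathcal H)$ by the ideal generated by (i) $e_Sx_T$ whenever $S\cup T\notin N(L,\mathcal H)$; (ii) $\partial e_S$ whenever $S\in N(L,\mathcal H)$ is a circuit; (iii) $c_g$ for $g\in\mathrm{a}(L)$. If $\hat 1\in\mathcal H$, $B(L,\mathcal H)=\hat B(L,\mathcal H)/(e_{\hat 1})$. *)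

theory Defs
  imports
    Complex_Main
    "HOL-Algebra.Lattice"
    "HOL-Algebra.QuotRing"
    "HOL-Library.Poly_Mapping"
    "Jordan_Normal_Form.VS_Connect"
begin

section \<open>Geometric lattices\<close>

definition atoms :: "'a gorder \<Rightarrow> 'a set" where
  "atoms P = {a \<in> carrier P. a \<noteq> \<bottom>\<^bsub>P\<^esub> \<and>
     (\<forall>x\<in>carrier P. x \<sqsubseteq>\<^bsub>P\<^esub> a \<longrightarrow> x = \<bottom>\<^bsub>P\<^esub> \<or> x = a)}"

definition covers :: "'a gorder \<Rightarrow> 'a \<Rightarrow> 'a \<Rightarrow> bool" where
  "covers P x y \<longleftrightarrow> x \<in> carrier P \<and> y \<in> carrier P \<and> x \<sqsubset>\<^bsub>P\<^esub> y \<and>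
     \<not> (\<exists>z\<in>carrier P. x \<sqsubset>\<^bsub>P\<^esub> z \<and> z \<sqsubset>\<^bsub>P\<^esub> y)"

definition geometric_lattice :: "'a gorder \<Rightarrow> bool" where
  "geometric_lattice L \<longleftrightarrow> bounded_lattice L \<and> finite (carrier L) \<and>
     (\<forall>x\<in>carrier L. x = \<Squnion>\<^bsub>L\<^esub> {a \<in> atoms L. a \<sqsubseteq>\<^bsub>L\<^esub> x}) \<and>
     (\<forall>x\<in>carrier L. \<forall>y\<in>carrier L.
        covers L (x \<sqinter>\<^bsub>L\<^esub> y) x \<longrightarrow> covers L y (x \<squnion>\<^bsub>L\<^esub> y))"

text \<open>The rank of an interval is the length of a longest chain in it.\<close>

definition interval_rank :: "'a gorder \<Rightarrow> 'a \<Rightarrow> 'a \<Rightarrow> nat" where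
  "interval_rank P x y = Max {card C - 1 | C. C \<subseteq> \<lbrace>x..y\<rbrace>\<^bsub>P\<^esub> \<and>
     (\<forall>a\<in>C. \<forall>b\<in>C. a \<sqsubseteq>\<^bsub>P\<^esub> b \<or> b \<sqsubseteq>\<^bsub>P\<^esub> a)}"


section \<open>Circuits of the matroid of an interval\<close>

text \<open>
  A matroid is given here by its family of flats \<open>F\<close>; its ground set is \<open>\<Union>F\<close>, since the
  ground set is itself a flat.
\<close>

definition flat_closure :: "'b set set \<Rightarrow> 'b set \<Rightarrow> 'b set" where
  "flat_closure F A = \<Inter>{X \<in> F. A \<subseteq> X}"

definition flat_indep :: "'b set set \<Rightarrow> 'b set \<Rightarrow> bool" where
  "flat_indep F A \<longleftrightarrow> A \<subseteq> \<Union>F \<and> (\<forall>a\<in>A. a \<notin> flat_closure F (A - {a}))"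

definition flat_circuit :: "'b set set \<Rightarrow> 'b set \<Rightarrow> bool" where
  "flat_circuit F C \<longleftrightarrow> C \<subseteq> \<Union>F \<and> \<not> flat_indep F C \<and> (\<forall>D. D \<subset> C \<longrightarrow> flat_indep F D)"

text \<open>
  The flats of the simple matroid $M(P_{\le x})$ on the atoms below \<open>x\<close> whose lattice of
  flats is the interval from the least element to \<open>x\<close>: a lattice element corresponds to the
  set of atoms below it.
\<close>

definition interval_flats :: "'a gorder \<Rightarrow> 'a \<Rightarrow> 'a set set" where
  "interval_flats P x =
     (\<lambda>y. {a \<in> atoms P. a \<sqsubseteq>\<^bsub>P\<^esub> y}) ` {y \<in> carrier P. y \<sqsubseteq>\<^bsub>P\<^esub> x}"

definition interval_circuit :: "'a gorder \<Rightarrow> 'a \<Rightarrow> 'a set \<Rightarrow> bool" where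
  "interval_circuit P x C \<longleftrightarrow> flat_circuit (interval_flats P x) C"


section \<open>Partial building sets and nested sets\<close>

definition max_below :: "'a gorder \<Rightarrow> 'a set \<Rightarrow> 'a \<Rightarrow> 'a set" where
  "max_below L G x = {y \<in> G. y \<sqsubseteq>\<^bsub>L\<^esub> x \<and> (\<forall>z\<in>G. z \<sqsubseteq>\<^bsub>L\<^esub> x \<and> y \<sqsubseteq>\<^bsub>L\<^esub> z \<longrightarrow> z = y)}"

text \<open>
  The product of the intervals below the elements \<open>y\<close> of \<open>max_below L G x\<close> is indexed by
  these elements themselves and ordered componentwise.
\<close>

definition building_set :: "'a gorder \<Rightarrow> 'a set \<Rightarrow> bool" where
  "building_set L G \<longleftrightarrow> G \<subseteq> carrier L - {\<bottom>\<^bsub>L\<^esub>} \<and> \<top>\<^bsub>L\<^esub> \<in> G \<and>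
     (\<forall>x \<in> carrier L - {\<bottom>\<^bsub>L\<^esub>}.
        let F = max_below L G x; X = (\<Pi>\<^sub>E y\<in>F. \<lbrace>\<bottom>\<^bsub>L\<^esub>..y\<rbrace>\<^bsub>L\<^esub>) in
        \<exists>\<phi>. bij_betw \<phi> X \<lbrace>\<bottom>\<^bsub>L\<^esub>..x\<rbrace>\<^bsub>L\<^esub> \<and>
            (\<forall>u\<in>X. \<forall>v\<in>X. \<phi> u \<sqsubseteq>\<^bsub>L\<^esub> \<phi> v \<longleftrightarrow> (\<forall>y\<in>F. u y \<sqsubseteq>\<^bsub>L\<^esub> v y)) \<and>
            (\<forall>y\<in>F. \<phi> (\<lambda>z\<in>F. if z = y then y else \<bottom>\<^bsub>L\<^esub>) = y))"

definition partial_building_set :: "'a gorder \<Rightarrow> 'a set \<Rightarrow> bool" where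
  "partial_building_set L H \<longleftrightarrow> (\<exists>G. building_set L G \<and> H \<subseteq> G \<and> atoms L \<subseteq> H \<and>
     (\<forall>p \<in> H - atoms L. \<forall>q \<in> G. p \<sqsubseteq>\<^bsub>L\<^esub> q \<longrightarrow> q \<in> H - atoms L))"

definition nested_sets :: "'a gorder \<Rightarrow> 'a set \<Rightarrow> 'a set set" where
  "nested_sets L H = {S. S \<subseteq> H \<and>
     (\<forall>A \<subseteq> S. 2 \<le> card A \<and> pairwise (\<lambda>p q. \<not> p \<sqsubseteq>\<^bsub>L\<^esub> q \<and> \<not> q \<sqsubseteq>\<^bsub>L\<^esub> p) A \<longrightarrow> \<Squnion>\<^bsub>L\<^esub> A \<notin> H)}"

text \<open>
  Linear orders are given by their reflexive relation: \<open>(p, q) \<in> r\<close> means that \<open>p\<close> precedes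
  or equals \<open>q\<close>. Larger elements of the lattice come first.
\<close>

definition compatible_order :: "'a gorder \<Rightarrow> 'a set \<Rightarrow> 'a rel \<Rightarrow> bool" where
  "compatible_order L H r \<longleftrightarrow> linear_order_on H r \<and>
     (\<forall>p\<in>H. \<forall>q\<in>H. q \<sqsubseteq>\<^bsub>L\<^esub> p \<longrightarrow> (p, q) \<in> r)"


section \<open>Iterated blowups\<close>

text \<open>
  Blowing up adds pairs of elements to a poset. All iterated blowups of a poset on \<open>'a\<close> live
  in the following type, where \<open>Base\<close> embeds the original poset and \<open>Exc p x\<close> is the pair
  \<open>(p, x)\<close>.
\<close>

datatype 'a blowup_elt = Base 'a | Exc "'a blowup_elt" "'a blowup_elt"

definition base_poset :: "'a gorder \<Rightarrow> 'a blowup_elt gorder" where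
  "base_poset L = \<lparr>carrier = Base ` carrier L, eq = (=),
     le = (\<lambda>u v. \<exists>x y. u = Base x \<and> v = Base y \<and> x \<sqsubseteq>\<^bsub>L\<^esub> y)\<rparr>"

text \<open>
  This is meaningful only as long as \<open>P\<close> contains no pair \<open>Exc p x\<close> yet, which is the case
  below because the blown-up elements are distinct elements of the original poset.
\<close>

definition blowup :: "'a blowup_elt \<Rightarrow> 'a blowup_elt gorder \<Rightarrow> 'a blowup_elt gorder" where
  "blowup p P = \<lparr>
     carrier = {x \<in> carrier P. \<not> p \<sqsubseteq>\<^bsub>P\<^esub> x} \<union>
       Exc p ` {x \<in> carrier P. \<not> p \<sqsubseteq>\<^bsub>P\<^esub> x \<and> (\<exists>j. least P j (Upper P {p, x}))},
     eq = (=),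
     le = (\<lambda>u v. u \<in> carrier P \<and> v \<in> carrier P \<and> u \<sqsubseteq>\<^bsub>P\<^esub> v \<or>
       (\<exists>x y. u = Exc p x \<and> v = Exc p y \<and> x \<sqsubseteq>\<^bsub>P\<^esub> y) \<or>
       (\<exists>y. u \<in> carrier P \<and> v = Exc p y \<and> u \<sqsubseteq>\<^bsub>P\<^esub> y))\<rparr>"

definition blowup_seq :: "'a gorder \<Rightarrow> 'a set \<Rightarrow> 'a rel \<Rightarrow> 'a list" where
  "blowup_seq L H r = (THE ps. set ps = H - atoms L \<and> distinct ps \<and>
     sorted_wrt (\<lambda>p q. (p, q) \<in> r) ps)"

definition iterated_blowup :: "'a gorder \<Rightarrow> 'a set \<Rightarrow> 'a rel \<Rightarrow> 'a blowup_elt gorder" where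
  "iterated_blowup L H r = fold blowup (map Base (blowup_seq L H r)) (base_poset L)"

text \<open>
  The identification of \<open>H\<close> with the atoms of \<open>iterated_blowup L H r\<close>: atoms of \<open>L\<close> persist,
  and a blown-up element \<open>p\<close> is identified with the exceptional atom \<open>(p, \<bottom>)\<close>.
\<close>

definition blowup_atom :: "'a gorder \<Rightarrow> 'a \<Rightarrow> 'a blowup_elt" where
  "blowup_atom L g = (if g \<in> atoms L then Base g else Exc (Base g) (Base \<bottom>\<^bsub>L\<^esub>))"

definition nested_circuit :: "'a gorder \<Rightarrow> 'a set \<Rightarrow> 'a rel \<Rightarrow> 'a set \<Rightarrow> bool" where
  "nested_circuit L H r S \<longleftrightarrow> S \<in> nested_sets L H \<and>
     (let P = iterated_blowup L H r; C = blowup_atom L ` S in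
      \<exists>j. least P j (Upper P C) \<and> interval_circuit P j C)"

definition broken_circuit :: "'a gorder \<Rightarrow> 'a set \<Rightarrow> 'a rel \<Rightarrow> 'a set \<Rightarrow> bool" where
  "broken_circuit L H r S \<longleftrightarrow> S \<in> nested_sets L H \<and> S \<noteq> {} \<and>
     (\<exists>g\<in>H. (\<forall>s\<in>S. (g, s) \<in> r \<and> g \<noteq> s) \<and>
       (let P = iterated_blowup L H r; C = blowup_atom L ` insert g S in
        \<exists>j x. least P j (Upper P C) \<and> x \<in> carrier P \<and> j \<sqsubseteq>\<^bsub>P\<^esub> x \<and> interval_circuit P x C))"

definition nbc_sets :: "'a gorder \<Rightarrow> 'a set \<Rightarrow> 'a rel \<Rightarrow> 'a set set" where
  "nbc_sets L H r = {S \<in> nested_sets L H. \<not> (\<exists>B \<subseteq> S. broken_circuit L H r B)}"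


section \<open>The free graded-commutative algebra\<close>

text \<open>
  The free graded-commutative algebra over the rationals on odd generators $e_g$ and even
  generators $x_g$, for \<open>g \<in> H\<close>, is the tensor product of an exterior and a polynomial algebra.
  Its elements are the finite linear combinations of the monomials $e_S x^b$, encoded as pairs
  \<open>(S, b)\<close>, where $e_S$ is the product of the $e_g$ for \<open>g \<in> S\<close> in increasing order. Bringing
  $e_S e_{S'}$ into this form takes one transposition for each pair in \<open>S \<times> S'\<close> that is in the
  wrong order.
\<close>

type_synonym 'a gc_elt = "('a set \<times> ('a \<Rightarrow>\<^sub>0 nat)) \<Rightarrow>\<^sub>0 rat"

definition inversions :: "'a rel \<Rightarrow> 'a set \<Rightarrow> 'a set \<Rightarrow> nat" where
  "inversions r S S' = card {(s, t) \<in> S \<times> S'. s \<noteq> t \<and> (t, s) \<in> r}"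

definition gc_scale :: "rat \<Rightarrow> 'a gc_elt \<Rightarrow> 'a gc_elt" where
  "gc_scale c f = Poly_Mapping.map ((*) c) f"

definition gc_monom :: "'a set \<Rightarrow> ('a \<Rightarrow>\<^sub>0 nat) \<Rightarrow> 'a gc_elt" where
  "gc_monom S b = Poly_Mapping.single (S, b) 1"

definition gc_monom_mult ::
    "'a rel \<Rightarrow> ('a set \<times> ('a \<Rightarrow>\<^sub>0 nat)) \<Rightarrow> ('a set \<times> ('a \<Rightarrow>\<^sub>0 nat)) \<Rightarrow> 'a gc_elt" where
  "gc_monom_mult r m n = (if fst m \<inter> fst n = {}
     then gc_scale ((-1) ^ inversions r (fst m) (fst n))
            (gc_monom (fst m \<union> fst n) (snd m + snd n))
     else 0)"

definition gc_mult :: "'a rel \<Rightarrow> 'a gc_elt \<Rightarrow> 'a gc_elt \<Rightarrow> 'a gc_elt" where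
  "gc_mult r f h = (\<Sum>m\<in>Poly_Mapping.keys f. \<Sum>n\<in>Poly_Mapping.keys h.
     gc_scale (Poly_Mapping.lookup f m * Poly_Mapping.lookup h n) (gc_monom_mult r m n))"

definition gc_algebra :: "'a set \<Rightarrow> 'a rel \<Rightarrow> (rat, 'a gc_elt) module" where
  "gc_algebra H r = \<lparr>
     carrier = {f. \<forall>(S, b) \<in> Poly_Mapping.keys f.
                     finite S \<and> S \<subseteq> H \<and> Poly_Mapping.keys b \<subseteq> H},
     mult = gc_mult r, one = gc_monom {} 0, zero = 0, add = (+), smult = gc_scale\<rparr>"

subsection \<open>Ring structure\<close>

text \<open>
  The ideals used below are only meaningful because \<open>gc_algebra\<close> is a ring.
\<close>

lemma lookup_gc_scale [simp]: "Poly_Mapping.lookup (gc_scale c f) k = c * Poly_Mapping.lookup f k"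
  unfolding gc_scale_def by transfer (simp add: when_def)

lemma gc_scale_simps [simp]:
  "gc_scale c 0 = 0" "gc_scale 0 f = 0" "gc_scale 1 f = f"
  "gc_scale c (gc_scale d f) = gc_scale (c * d) f"
  by (simp_all add: poly_mapping_eq_iff fun_eq_iff lookup_add mult.assoc)

lemma gc_scale_add: "gc_scale c (f + h) = gc_scale c f + gc_scale c h"
  and gc_scale_add_left: "gc_scale (c + d) f = gc_scale c f + gc_scale d f"
  by (simp_all add: poly_mapping_eq_iff fun_eq_iff lookup_add algebra_simps)

lemma gc_scale_sum: "gc_scale c (sum u A) = (\<Sum>a\<in>A. gc_scale c (u a))"
  by (induction A rule: infinite_finite_induct) (simp_all add: gc_scale_add)

lemma gc_mult_superset:
  assumes "finite A" "Poly_Mapping.keys f \<subseteq> A" "finite A'" "Poly_Mapping.keys h \<subseteq> A'"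
  shows "gc_mult r f h = (\<Sum>m\<in>A. \<Sum>n\<in>A'.
    gc_scale (Poly_Mapping.lookup f m * Poly_Mapping.lookup h n) (gc_monom_mult r m n))"
proof -
  have "gc_mult r f h = (\<Sum>m\<in>Poly_Mapping.keys f. \<Sum>n\<in>A'.
      gc_scale (Poly_Mapping.lookup f m * Poly_Mapping.lookup h n) (gc_monom_mult r m n))"
    unfolding gc_mult_def using assms
    by (intro sum.cong refl sum.mono_neutral_left) (auto simp: in_keys_iff)
  also have "\<dots> = (\<Sum>m\<in>A. \<Sum>n\<in>A'.
      gc_scale (Poly_Mapping.lookup f m * Poly_Mapping.lookup h n) (gc_monom_mult r m n))"
    using assms by (intro sum.mono_neutral_left) (auto simp: in_keys_iff)
  finally show ?thesis .
qed

lemma gc_mult_add_left: "gc_mult r (f + g) h = gc_mult r f h + gc_mult r g h"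
proof -
  let ?A = "Poly_Mapping.keys f \<union> Poly_Mapping.keys g \<union> Poly_Mapping.keys (f + g)"
  have "finite ?A" by simp
  then show ?thesis
    by (simp add: gc_mult_superset[where A = ?A and A' = "Poly_Mapping.keys h"] Un_assoc subset_iff
        lookup_add algebra_simps gc_scale_add_left sum.distrib)
qed

lemma gc_mult_add_right: "gc_mult r h (f + g) = gc_mult r h f + gc_mult r h g"
proof -
  let ?A = "Poly_Mapping.keys f \<union> Poly_Mapping.keys g \<union> Poly_Mapping.keys (f + g)"
  have "finite ?A" by simp
  then show ?thesis
    by (simp add: gc_mult_superset[where A' = ?A and A = "Poly_Mapping.keys h"] Un_assoc subset_iff
        lookup_add algebra_simps gc_scale_add_left sum.distrib)
qed

lemma gc_mult_zero [simp]: "gc_mult r 0 h = 0" "gc_mult r h 0 = 0"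
  by (simp_all add: gc_mult_def)

lemma gc_mult_scale:
  "gc_mult r (gc_scale c f) h = gc_scale c (gc_mult r f h)"
  "gc_mult r f (gc_scale c h) = gc_scale c (gc_mult r f h)"
proof -
  have k: "Poly_Mapping.keys (gc_scale c f) \<subseteq> Poly_Mapping.keys f" for f :: "'a gc_elt"
    by (auto simp: in_keys_iff)
  show "gc_mult r (gc_scale c f) h = gc_scale c (gc_mult r f h)"
    by (subst gc_mult_superset[OF _ k _ subset_refl])
      (simp_all add: gc_mult_def gc_scale_sum mult.assoc)
  show "gc_mult r f (gc_scale c h) = gc_scale c (gc_mult r f h)"
    by (subst gc_mult_superset[OF _ subset_refl _ k])
      (simp_all add: gc_mult_def gc_scale_sum mult.assoc mult.left_commute)
qed

lemma gc_mult_monom: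
  "gc_mult r (gc_monom S b) (gc_monom S' b') = gc_monom_mult r (S, b) (S', b')"
  by (simp add: gc_mult_def gc_monom_def)

lemma inversions_Un_left:
  assumes "finite S" "finite S'" "finite T" "S \<inter> S' = {}"
  shows "inversions r (S \<union> S') T = inversions r S T + inversions r S' T"
proof -
  have "{(s, t) \<in> (S \<union> S') \<times> T. s \<noteq> t \<and> (t, s) \<in> r} =
        {(s, t) \<in> S \<times> T. s \<noteq> t \<and> (t, s) \<in> r} \<union> {(s, t) \<in> S' \<times> T. s \<noteq> t \<and> (t, s) \<in> r}"
    by auto
  moreover have "finite {(s, t) \<in> X \<times> T. s \<noteq> t \<and> (t, s) \<in> r}" if "finite X" for X
    by (rule finite_subset[of _ "X \<times> T"]) (use that assms in auto)
  ultimately show ?thesis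
    using assms unfolding inversions_def by (simp only:) (subst card_Un_disjoint, auto)
qed

lemma inversions_Un_right:
  assumes "finite S" "finite S'" "finite T" "S \<inter> S' = {}"
  shows "inversions r T (S \<union> S') = inversions r T S + inversions r T S'"
proof -
  have "{(s, t) \<in> T \<times> (S \<union> S'). s \<noteq> t \<and> (t, s) \<in> r} =
        {(s, t) \<in> T \<times> S. s \<noteq> t \<and> (t, s) \<in> r} \<union> {(s, t) \<in> T \<times> S'. s \<noteq> t \<and> (t, s) \<in> r}"
    by auto
  moreover have "finite {(s, t) \<in> T \<times> X. s \<noteq> t \<and> (t, s) \<in> r}" if "finite X" for X
    by (rule finite_subset[of _ "T \<times> X"]) (use that assms in auto)
  ultimately show ?thesis
    using assms unfolding inversions_def by (simp only:) (subst card_Un_disjoint, auto)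
qed

lemma gc_monom_mult_assoc:
  assumes "finite S" "finite S'" "finite S''"
  shows "gc_mult r (gc_mult r (gc_monom S b) (gc_monom S' b')) (gc_monom S'' b'') =
         gc_mult r (gc_monom S b) (gc_mult r (gc_monom S' b') (gc_monom S'' b''))"
proof (cases "S \<inter> S' = {} \<and> S \<inter> S'' = {} \<and> S' \<inter> S'' = {}")
  case True
  with assms show ?thesis
    by (simp add: gc_mult_monom gc_monom_mult_def gc_mult_scale inversions_Un_left
        inversions_Un_right Int_Un_distrib Int_Un_distrib2 Un_assoc add.assoc flip: power_add)
      (simp add: ac_simps)
next
  case False
  then show ?thesis
    by (auto simp: gc_mult_monom gc_monom_mult_def gc_mult_scale Int_Un_distrib Int_Un_distrib2)
qed

lemma gc_sum_single:
  "(\<Sum>m\<in>Poly_Mapping.keys f. Poly_Mapping.single m (Poly_Mapping.lookup f m)) = f"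
  by (simp add: poly_mapping_eq_iff fun_eq_iff lookup_sum lookup_single when_def in_keys_iff)

lemma gc_elt_induct [consumes 1, case_names zero add]:
  assumes "f \<in> carrier (gc_algebra H r)"
    and "P 0"
    and "\<And>c S b g. finite S \<Longrightarrow> S \<subseteq> H \<Longrightarrow> Poly_Mapping.keys b \<subseteq> H \<Longrightarrow> P g \<Longrightarrow>
           P (gc_scale c (gc_monom S b) + g)"
  shows "P f"
proof -
  have single: "gc_scale (Poly_Mapping.lookup f m) (gc_monom (fst m) (snd m)) =
      Poly_Mapping.single m (Poly_Mapping.lookup f m)" for m
    by (simp add: poly_mapping_eq_iff fun_eq_iff gc_monom_def lookup_single when_def)
  have "P (\<Sum>m\<in>M. gc_scale (Poly_Mapping.lookup f m) (gc_monom (fst m) (snd m)))"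
    if "finite M" "M \<subseteq> Poly_Mapping.keys f" for M
    using that assms by (induction M) (auto simp: gc_algebra_def)
  from this[of "Poly_Mapping.keys f"] show ?thesis
    by (simp add: single gc_sum_single)
qed

lemma gc_mult_assoc:
  assumes "f \<in> carrier (gc_algebra H r)" "g \<in> carrier (gc_algebra H r)" "h \<in> carrier (gc_algebra H r)"
  shows "gc_mult r (gc_mult r f g) h = gc_mult r f (gc_mult r g h)"
  using assms(1)
proof (induction rule: gc_elt_induct)
  case f: (add c S b f')
  have "gc_mult r (gc_mult r (gc_monom S b) g) h = gc_mult r (gc_monom S b) (gc_mult r g h)"
    using assms(2)
  proof (induction rule: gc_elt_induct)
    case g: (add c' S' b' g')
    have "gc_mult r (gc_mult r (gc_monom S b) (gc_monom S' b')) h =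
          gc_mult r (gc_monom S b) (gc_mult r (gc_monom S' b') h)"
      using assms(3)
      by (induction rule: gc_elt_induct)
        (simp_all add: gc_mult_add_right gc_mult_scale gc_monom_mult_assoc f.hyps g.hyps)
    with g show ?case by (simp add: gc_mult_add_left gc_mult_add_right gc_mult_scale)
  qed simp
  with f show ?case by (simp add: gc_mult_add_left gc_mult_scale)
qed simp

lemma gc_algebra_simps:
  "mult (gc_algebra H r) = gc_mult r" "add (gc_algebra H r) = (+)"
  "zero (gc_algebra H r) = 0" "one (gc_algebra H r) = gc_monom {} 0"
  "smult (gc_algebra H r) = gc_scale"
  by (simp_all add: gc_algebra_def)

lemma gc_carrier_closed:
  "0 \<in> carrier (gc_algebra H r)"
  "f \<in> carrier (gc_algebra H r) \<Longrightarrow> gc_scale c f \<in> carrier (gc_algebra H r)"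
  "f \<in> carrier (gc_algebra H r) \<Longrightarrow> h \<in> carrier (gc_algebra H r) \<Longrightarrow> f + h \<in> carrier (gc_algebra H r)"
  "finite S \<Longrightarrow> S \<subseteq> H \<Longrightarrow> Poly_Mapping.keys b \<subseteq> H \<Longrightarrow> gc_monom S b \<in> carrier (gc_algebra H r)"
proof -
  show "0 \<in> carrier (gc_algebra H r)"
    by (simp add: gc_algebra_def)
  show "f \<in> carrier (gc_algebra H r) \<Longrightarrow> gc_scale c f \<in> carrier (gc_algebra H r)"
    by (auto simp: gc_algebra_def in_keys_iff)
  show "f \<in> carrier (gc_algebra H r) \<Longrightarrow> h \<in> carrier (gc_algebra H r) \<Longrightarrow>
      f + h \<in> carrier (gc_algebra H r)"
    using keys_add[of f h] unfolding gc_algebra_def mem_Collect_eq partial_object.simps by blast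
  show "finite S \<Longrightarrow> S \<subseteq> H \<Longrightarrow> Poly_Mapping.keys b \<subseteq> H \<Longrightarrow>
      gc_monom S b \<in> carrier (gc_algebra H r)"
    by (simp add: gc_algebra_def gc_monom_def)
qed

lemma gc_mult_closed:
  assumes "f \<in> carrier (gc_algebra H r)" "h \<in> carrier (gc_algebra H r)"
  shows "gc_mult r f h \<in> carrier (gc_algebra H r)"
  using assms(1)
proof (induction rule: gc_elt_induct)
  case f: (add c S b f')
  have "gc_mult r (gc_monom S b) h \<in> carrier (gc_algebra H r)"
    using assms(2)
  proof (induction rule: gc_elt_induct)
    case h: (add c' S' b' h')
    have "Poly_Mapping.keys (b + b') \<subseteq> H" using keys_add[of b b'] f.hyps h.hyps by blast
    then show ?case using f.hyps h
      by (auto simp: gc_mult_add_right gc_mult_scale gc_mult_monom gc_monom_mult_def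
          intro!: gc_carrier_closed)
  qed (simp add: gc_carrier_closed)
  with f.IH show ?case by (simp add: gc_mult_add_left gc_mult_scale gc_carrier_closed)
qed (simp add: gc_carrier_closed)

lemma gc_mult_one:
  assumes "f \<in> carrier (gc_algebra H r)"
  shows "gc_mult r (gc_monom {} 0) f = f" "gc_mult r f (gc_monom {} 0) = f"
  using assms
  by (induction rule: gc_elt_induct)
    (simp_all add: gc_mult_add_left gc_mult_add_right gc_mult_scale gc_mult_monom
      gc_monom_mult_def inversions_def)

theorem gc_algebra_ring: "ring (gc_algebra H r)"
proof (rule ringI)
  show "abelian_group (gc_algebra H r)"
  proof (rule abelian_groupI)
    fix f assume f: "f \<in> carrier (gc_algebra H r)"
    have "gc_scale (-1) f + f = 0" by (simp add: poly_mapping_eq_iff fun_eq_iff lookup_add)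
    with f show "\<exists>y\<in>carrier (gc_algebra H r). y \<oplus>\<^bsub>gc_algebra H r\<^esub> f = \<zero>\<^bsub>gc_algebra H r\<^esub>"
      using gc_carrier_closed(2)[OF f, of "-1"] by (auto simp: gc_algebra_simps)
  qed (simp_all add: gc_algebra_simps gc_carrier_closed ac_simps)
  show "Group.monoid (gc_algebra H r)"
    by (rule monoidI)
      (simp_all add: gc_algebra_simps gc_mult_closed gc_mult_one gc_mult_assoc gc_carrier_closed)
qed (simp_all add: gc_algebra_simps gc_mult_add_left gc_mult_add_right)

text \<open>
  The odd generators anticommute, the even ones are central, and \<open>gc_monom\<close> is the
  product of generators that it encodes.
\<close>

lemma e_anticommute:
  assumes "linear_order_on H r" "g \<in> H" "h \<in> H"
  shows "gc_mult r (gc_monom {g} 0) (gc_monom {h} 0) =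
         gc_scale (-1) (gc_mult r (gc_monom {h} 0) (gc_monom {g} 0))"
proof (cases "g = h")
  case False
  have *: "{(s, t). s = a \<and> t = b \<and> s \<noteq> t \<and> (t, s) \<in> r} =
    (if a \<noteq> b \<and> (b, a) \<in> r then {(a, b)} else {})" for a b by auto
  from False assms have "(g, h) \<in> r \<longleftrightarrow> (h, g) \<notin> r"
    by (auto simp: order_on_defs total_on_def antisym_def)
  with False show ?thesis
    by (auto simp: gc_mult_monom gc_monom_mult_def inversions_def * insert_commute)
qed (simp add: gc_mult_monom gc_monom_mult_def)

lemma x_central:
  "gc_mult r (gc_monom {} b) (gc_monom S b') = gc_mult r (gc_monom S b') (gc_monom {} b)"
  by (simp add: gc_mult_monom gc_monom_mult_def inversions_def add.commute)

lemma e_x_mult: "gc_mult r (gc_monom S 0) (gc_monom {} b) = gc_monom S b"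
  by (simp add: gc_mult_monom gc_monom_mult_def inversions_def)

lemma e_increasing_mult:
  assumes "linear_order_on H r" "g \<in> H" "S \<subseteq> H" "\<forall>s\<in>S. g \<noteq> s \<and> (g, s) \<in> r"
  shows "gc_mult r (gc_monom {g} 0) (gc_monom S b) = gc_monom (insert g S) b"
proof -
  have "{(s, t) \<in> {g} \<times> S. s \<noteq> t \<and> (t, s) \<in> r} = {}"
    using assms by (auto simp: order_on_defs antisym_def)
  then have "inversions r {g} S = 0" by (simp only: inversions_def card.empty)
  with assms show ?thesis by (auto simp: gc_mult_monom gc_monom_mult_def)
qed

lemma x_mult: "gc_mult r (gc_monom {} b) (gc_monom {} b') = gc_monom {} (b + b')"
  by (simp add: gc_mult_monom gc_monom_mult_def inversions_def)


section \<open>The quotient algebras\<close>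

definition x_exponent :: "'a set \<Rightarrow> ('a \<Rightarrow>\<^sub>0 nat)" where
  "x_exponent T = (\<Sum>g\<in>T. Poly_Mapping.single g 1)"

text \<open>
  The sign $(-1)^{j-1}$ of the \<open>j\<close>-th element \<open>g\<close> of \<open>S\<close> is expressed by the number \<open>j - 1\<close>
  of elements of \<open>S\<close> preceding \<open>g\<close>.
\<close>

definition e_boundary :: "'a rel \<Rightarrow> 'a set \<Rightarrow> 'a gc_elt" where
  "e_boundary r S = (\<Sum>g\<in>S.
     gc_scale ((-1) ^ card {h \<in> S. h \<noteq> g \<and> (h, g) \<in> r}) (gc_monom (S - {g}) 0))"

definition x_sum_above :: "'a gorder \<Rightarrow> 'a set \<Rightarrow> 'a \<Rightarrow> 'a gc_elt" where
  "x_sum_above L H g = (\<Sum>h \<in> {h \<in> H. g \<sqsubseteq>\<^bsub>L\<^esub> h}. gc_monom {} (x_exponent {h}))"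

definition quot_algebra :: "('k, 'b) module \<Rightarrow> 'b set \<Rightarrow> ('k, 'b set) module" where
  "quot_algebra A I = \<lparr>
     carrier = carrier (A Quot I), mult = mult (A Quot I), one = one (A Quot I),
     zero = zero (A Quot I), add = add (A Quot I),
     smult = (\<lambda>c X. \<Union>a\<in>X. I +>\<^bsub>A\<^esub> (c \<odot>\<^bsub>A\<^esub> a))\<rparr>"

definition Bhat_relations :: "'a gorder \<Rightarrow> 'a set \<Rightarrow> 'a rel \<Rightarrow> 'a gc_elt set" where
  "Bhat_relations L H r =
     {gc_monom S (x_exponent T) | S T. S \<subseteq> H \<and> T \<subseteq> H \<and> S \<union> T \<notin> nested_sets L H} \<union>
     {e_boundary r S | S. nested_circuit L H r S} \<union>
     x_sum_above L H ` atoms L"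

definition Bhat_ideal :: "'a gorder \<Rightarrow> 'a set \<Rightarrow> 'a rel \<Rightarrow> 'a gc_elt set" where
  "Bhat_ideal L H r = Idl\<^bsub>gc_algebra H r\<^esub> (Bhat_relations L H r)"

definition Bhat_algebra :: "'a gorder \<Rightarrow> 'a set \<Rightarrow> 'a rel \<Rightarrow> (rat, 'a gc_elt set) module" where
  "Bhat_algebra L H r = quot_algebra (gc_algebra H r) (Bhat_ideal L H r)"

definition Bhat_monom ::
    "'a gorder \<Rightarrow> 'a set \<Rightarrow> 'a rel \<Rightarrow> 'a set \<times> ('a \<Rightarrow>\<^sub>0 nat) \<Rightarrow> 'a gc_elt set" where
  "Bhat_monom L H r = (\<lambda>(S, b). Bhat_ideal L H r +>\<^bsub>gc_algebra H r\<^esub> gc_monom S b)"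

definition B_ideal :: "'a gorder \<Rightarrow> 'a set \<Rightarrow> 'a rel \<Rightarrow> 'a gc_elt set set" where
  "B_ideal L H r = Idl\<^bsub>Bhat_algebra L H r\<^esub> {Bhat_monom L H r ({\<top>\<^bsub>L\<^esub>}, 0)}"

definition B_algebra :: "'a gorder \<Rightarrow> 'a set \<Rightarrow> 'a rel \<Rightarrow> (rat, 'a gc_elt set set) module" where
  "B_algebra L H r = quot_algebra (Bhat_algebra L H r) (B_ideal L H r)"

definition B_monom ::
    "'a gorder \<Rightarrow> 'a set \<Rightarrow> 'a rel \<Rightarrow> 'a set \<times> ('a \<Rightarrow>\<^sub>0 nat) \<Rightarrow> 'a gc_elt set set" where
  "B_monom L H r m = B_ideal L H r +>\<^bsub>Bhat_algebra L H r\<^esub> Bhat_monom L H r m"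


section \<open>Monomial bases\<close>

text \<open>
  A monomial $e_S x_T^b$ is encoded as \<open>(S, b)\<close>, with \<open>b\<close> extended by zero outside of \<open>T\<close>;
  then \<open>T\<close> is the support of \<open>b\<close>.
\<close>

definition basis_monomials ::
    "'a gorder \<Rightarrow> 'a set \<Rightarrow> 'a rel \<Rightarrow> ('a set \<times> ('a \<Rightarrow>\<^sub>0 nat)) set" where
  "basis_monomials L H r = {(S, b). let T = Poly_Mapping.keys b in
     S \<union> T \<in> nested_sets L H \<and> S \<in> nbc_sets L H r \<and>
     (\<forall>g\<in>T. 0 < Poly_Mapping.lookup b g \<and>
        Poly_Mapping.lookup b g < interval_rank L (\<Squnion>\<^bsub>L\<^esub> {f \<in> S \<union> T. f \<sqsubset>\<^bsub>L\<^esub> g}) g)}"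

text \<open>A family is a basis if it is injective and its image is a basis.\<close>

definition rat_basis :: "(rat, 'b) module \<Rightarrow> ('i \<Rightarrow> 'b) \<Rightarrow> 'i set \<Rightarrow> bool" where
  "rat_basis V v I \<longleftrightarrow> inj_on v I \<and> vectorspace.basis class_ring V (v ` I)"

end

theory Submission
  imports Defs
begin

text \<open>
  An element of the iterated blowup is a pair of a set \<open>U\<close> of blown-up elements and an element of \<open>L\<close>,
  ordered componentwise; hence the circuits and broken circuits among nested sets are those of \<open>L\<close>.

  Spanning: if the elements of \<open>S \<union> T\<close> below \<open>g\<close> together with \<open>d\<close> atoms have join \<open>g\<close>, then
  \<open>e\<^sub>S x\<^sub>T c\<^sub>g\<^sup>d = 0\<close>, with \<open>c\<^sub>g\<close> the sum of the \<open>x\<^sub>h\<close> for \<open>h \<ge> g\<close>. This rewrites \<open>x\<^sub>T x\<^sub>g\<^sup>d\<close> in terms of variables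
  higher up, while the circuit relations make the exterior part broken-circuit free.

  Independence: a functional is built as a product. On the exterior part one takes the iterated residue
  along the flag spanned by a given no-broken-circuit set. On the commutative part, functionals are
  obtained by induction on the number of blown-up elements: adding a minimal \<open>p\<close> adjoins powers of \<open>x\<^sub>p\<close>
  subject to \<open>c\<^sub>p\<^sup>d = 0\<close>, so that a functional is a sequence of functionals satisfying a linear recurrence.
\<close>

text \<open>The obstacle is that the relations \<open>e_S x_T = 0\<close> couple the two parts, so a
  product of functionals need not respect them. It does because nestedness of
  \<open>S \<union> T\<close> sees the atoms of \<open>S\<close> only through their join: a flag
  functional is supported on sets \<open>S\<close> with one fixed non-atomic part and one fixed join
  of atoms, and all of these put the same condition on \<open>T\<close>. The polynomial factor can
  therefore be chosen in a single quotient, that of the sets nested together with a fixed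
  \<open>A\<close>. The induction must allow arbitrary \<open>A\<close>, since the coefficients of
  positive powers of \<open>x_p\<close> live in the quotient for \<open>A\<close> enlarged by all
  atoms below \<open>p\<close>. If \<open>p\<close> is not in \<open>A\<close>, the term of index
  zero respects only the smaller ideal for \<open>A\<close>, and the recurrence has to lead from it
  into functionals for the larger one. This works because the length \<open>d\<close> of the
  recurrence is a rank: \<open>d\<close> atoms suffice to complete those of \<open>A\<close> below
  \<open>p\<close> to a spanning set of \<open>p\<close>. The same rank is the exponent at which
  rewriting starts, so the two bounds agree.\<close>

locale geom_lattice =
  fixes L :: "'a gorder" (structure)
  assumes geometric: "geometric_lattice L"
begin

section \<open>Joins and atoms in a geometric lattice\<close>

abbreviation "E \<equiv> carrier L"
abbreviation "At \<equiv> atoms L"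
abbreviation J :: "'a set \<Rightarrow> 'a" where "J A \<equiv> \<Squnion>\<^bsub>L\<^esub> A"

definition below :: "'a \<Rightarrow> 'a set" where
  "below x = {a \<in> At. a \<sqsubseteq> x}"

lemma bounded: "bounded_lattice L" and finite_E: "finite E"
  using geometric by (auto simp: geometric_lattice_def)

lemma po: "partial_order L"
  using bounded by (simp add: bounded_lattice_def lattice_def upper_semilattice_def)

lemma le_refl: "x \<in> E \<Longrightarrow> x \<sqsubseteq> x"
  and le_trans: "\<lbrakk>x \<sqsubseteq> y; y \<sqsubseteq> z; x \<in> E; y \<in> E; z \<in> E\<rbrakk> \<Longrightarrow> x \<sqsubseteq> z"
  and le_antisym: "\<lbrakk>x \<sqsubseteq> y; y \<sqsubseteq> x; x \<in> E; y \<in> E\<rbrakk> \<Longrightarrow> x = y"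
proof -
  interpret partial_order L by (rule po)
  show "x \<in> E \<Longrightarrow> x \<sqsubseteq> x" by (rule le_refl)
  show "\<lbrakk>x \<sqsubseteq> y; y \<sqsubseteq> z; x \<in> E; y \<in> E; z \<in> E\<rbrakk> \<Longrightarrow> x \<sqsubseteq> z" by (rule le_trans)
  show "\<lbrakk>x \<sqsubseteq> y; y \<sqsubseteq> x; x \<in> E; y \<in> E\<rbrakk> \<Longrightarrow> x = y" by (rule le_antisym)
qed

lemma less_iff: "x \<sqsubset> y \<longleftrightarrow> x \<sqsubseteq> y \<and> x \<noteq> y"
proof -
  interpret partial_order L by (rule po)
  show ?thesis by (simp add: lless_def eq_is_equal)
qed

lemma bot_in: "\<bottom> \<in> E" and bot_le: "x \<in> E \<Longrightarrow> \<bottom> \<sqsubseteq> x"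
  and top_in: "\<top> \<in> E" and le_top: "x \<in> E \<Longrightarrow> x \<sqsubseteq> \<top>"
proof -
  interpret bounded_lattice L by (rule bounded)
  show "\<bottom> \<in> E" "x \<in> E \<Longrightarrow> \<bottom> \<sqsubseteq> x" "\<top> \<in> E" "x \<in> E \<Longrightarrow> x \<sqsubseteq> \<top>"
    by (simp_all add: bottom_lower top_higher)
qed

lemma J_least_upper: assumes "A \<subseteq> E" shows "least L (J A) (Upper L A)"
proof -
  interpret bounded_lattice L by (rule bounded)
  show ?thesis
  proof (cases "A = {}")
    case True
    have "least L \<bottom> (Upper L A)"
      using True by (auto simp: least_def Upper_def bot_in bot_le)
    then show ?thesis unfolding sup_def by (rule someI)
  next
    case False
    then show ?thesis using finite_sup_least[OF finite_subset[OF assms finite_E] assms] by simp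
  qed
qed

lemma J_closed: "A \<subseteq> E \<Longrightarrow> J A \<in> E"
  and J_upper: "A \<subseteq> E \<Longrightarrow> a \<in> A \<Longrightarrow> a \<sqsubseteq> J A"
  using J_least_upper[of A] by (auto simp: least_def Upper_def)

lemma J_le_iff:
  assumes "A \<subseteq> E" "z \<in> E" shows "J A \<sqsubseteq> z \<longleftrightarrow> (\<forall>a\<in>A. a \<sqsubseteq> z)"
proof
  show "J A \<sqsubseteq> z \<Longrightarrow> \<forall>a\<in>A. a \<sqsubseteq> z"
    using assms by (meson J_upper J_closed le_trans subsetD)
  show "\<forall>a\<in>A. a \<sqsubseteq> z \<Longrightarrow> J A \<sqsubseteq> z"
    using J_least_upper[OF assms(1)] assms by (auto simp: least_def Upper_def)
qed

lemma J_mono: "\<lbrakk>A \<subseteq> B; B \<subseteq> E\<rbrakk> \<Longrightarrow> J A \<sqsubseteq> J B"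
  by (subst J_le_iff) (auto intro: J_closed J_upper)

lemma J_cover: "\<lbrakk>A \<subseteq> E; B \<subseteq> E; \<And>a. a \<in> A \<Longrightarrow> a \<sqsubseteq> J B\<rbrakk> \<Longrightarrow> J A \<sqsubseteq> J B"
  by (subst J_le_iff) (auto intro: J_closed)

lemma J_eqI: "\<lbrakk>A \<subseteq> E; B \<subseteq> E; \<And>a. a \<in> A \<Longrightarrow> a \<sqsubseteq> J B; \<And>b. b \<in> B \<Longrightarrow> b \<sqsubseteq> J A\<rbrakk> \<Longrightarrow> J A = J B"
  by (rule le_antisym) (auto intro: J_cover J_closed)

lemma J_eq_elemI: "\<lbrakk>A \<subseteq> E; x \<in> E; \<And>a. a \<in> A \<Longrightarrow> a \<sqsubseteq> x; x \<sqsubseteq> J A\<rbrakk> \<Longrightarrow> J A = x"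
  by (rule le_antisym) (auto simp: J_le_iff intro: J_closed)

lemma J_singleton: "x \<in> E \<Longrightarrow> J {x} = x"
  by (rule J_eq_elemI) (auto intro: le_refl J_upper)

lemma J_empty: "J {} = \<bottom>"
  by (rule J_eq_elemI) (auto intro: bot_in bot_le J_closed)

lemma le_bot: "x \<in> E \<Longrightarrow> x \<sqsubseteq> \<bottom> \<Longrightarrow> x = \<bottom>"
  by (meson le_antisym bot_in bot_le)

lemma le_J: "\<lbrakk>x \<sqsubseteq> a; a \<in> A; A \<subseteq> E; x \<in> E\<rbrakk> \<Longrightarrow> x \<sqsubseteq> J A"
  by (meson J_closed J_upper le_trans subsetD)

lemma le_J_mono: "\<lbrakk>x \<sqsubseteq> J A; A \<subseteq> B; B \<subseteq> E; x \<in> E\<rbrakk> \<Longrightarrow> x \<sqsubseteq> J B"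
  by (meson J_closed J_mono le_trans order_trans)

lemma J_Un_cong:
  assumes "A \<subseteq> E" "B \<subseteq> E" "C \<subseteq> E" "J A = J B" shows "J (A \<union> C) = J (B \<union> C)"
proof (rule J_eqI)
  show "a \<sqsubseteq> J (B \<union> C)" if "a \<in> A \<union> C" for a
  proof (cases "a \<in> C")
    case False
    with that have "a \<in> A" by blast
    then have "a \<sqsubseteq> J B" using J_upper[OF assms(1)] assms(4) by simp
    then show ?thesis using \<open>a \<in> A\<close> assms by (auto intro: le_J_mono[of a B "B \<union> C"])
  qed (use assms in \<open>auto intro: J_upper\<close>)
  show "a \<sqsubseteq> J (A \<union> C)" if "a \<in> B \<union> C" for a
  proof (cases "a \<in> C")
    case False
    with that have "a \<in> B" by blast
    then have "a \<sqsubseteq> J A" using J_upper[OF assms(2)] assms(4) by simp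
    then show ?thesis using \<open>a \<in> B\<close> assms by (auto intro: le_J_mono[of a A "A \<union> C"])
  qed (use assms in \<open>auto intro: J_upper\<close>)
qed (use assms in auto)

lemma At_E: "At \<subseteq> E" and finite_At: "finite At"
  using finite_E by (auto simp: atoms_def)

lemma atom_in: "a \<in> At \<Longrightarrow> a \<in> E" and atom_not_bot: "a \<in> At \<Longrightarrow> a \<noteq> \<bottom>"
  and le_atom: "\<lbrakk>a \<in> At; x \<in> E; x \<sqsubseteq> a\<rbrakk> \<Longrightarrow> x = \<bottom> \<or> x = a"
  by (auto simp: atoms_def)

lemma below_subset: "below x \<subseteq> At" "below x \<subseteq> E" "finite (below x)"
  using At_E finite_At by (auto simp: below_def)

lemma J_below: "x \<in> E \<Longrightarrow> J (below x) = x"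
  using geometric by (auto simp: geometric_lattice_def below_def)

lemma le_iff_below: "\<lbrakk>x \<in> E; y \<in> E\<rbrakk> \<Longrightarrow> x \<sqsubseteq> y \<longleftrightarrow> below x \<subseteq> below y"
  unfolding below_def
  using J_mono[of "below x" "below y"] below_subset J_below[of x] J_below[of y]
  by (auto simp: below_def intro: le_trans atom_in)

lemma ex_atom_not_le:
  assumes "x \<in> E" "y \<in> E" "\<not> x \<sqsubseteq> y" shows "\<exists>a\<in>At. a \<sqsubseteq> x \<and> \<not> a \<sqsubseteq> y"
  using assms le_iff_below by (auto simp: below_def)

lemma ex_atom: "\<lbrakk>x \<in> E; x \<noteq> \<bottom>\<rbrakk> \<Longrightarrow> \<exists>a\<in>At. a \<sqsubseteq> x"
  using ex_atom_not_le[of x \<bottom>] bot_in le_bot by blast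

text \<open>With \<open>w = J X\<close>, the atom \<open>a\<close> covers
  \<open>a \<sqinter> w = \<bottom>\<close>, so by semimodularity \<open>J (insert a X)\<close>
  covers \<open>w\<close>. As \<open>J (insert b X)\<close> lies strictly above \<open>w\<close> and
  below this cover, it equals it.\<close>

lemma atom_exchange:
  assumes a: "a \<in> At" and b: "b \<in> At" and X: "X \<subseteq> E"
    and nb: "\<not> b \<sqsubseteq> J X" and le: "b \<sqsubseteq> J (insert a X)"
  shows "a \<sqsubseteq> J (insert b X)"
proof -
  interpret bounded_lattice L by (rule bounded)
  let ?w = "J X"
  have w: "?w \<in> E" and aE: "a \<in> E" and bE: "b \<in> E" using X a b by (auto intro: J_closed atom_in)
  have na: "\<not> a \<sqsubseteq> ?w"
  proof
    assume "a \<sqsubseteq> ?w"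
    then have "J (insert a X) \<sqsubseteq> ?w" using X aE w by (subst J_le_iff) (auto intro: J_upper)
    then show False using le nb bE w X aE le_trans[of b "J (insert a X)" ?w] by (auto intro: J_closed)
  qed
  have meet: "a \<sqinter> ?w = \<bottom>"
  proof -
    have "a \<sqinter> ?w \<sqsubseteq> a" "a \<sqinter> ?w \<sqsubseteq> ?w" "a \<sqinter> ?w \<in> E"
      using aE w by (auto intro: meet_left meet_right meet_closed)
    then show ?thesis using le_atom[OF a, of "a \<sqinter> ?w"] na by auto
  qed
  have "covers L (a \<sqinter> ?w) a"
    unfolding meet covers_def less_iff
    using bot_in bot_le[OF aE] aE le_atom[OF a] atom_not_bot[OF a] by auto
  then have cov: "covers L ?w (a \<squnion> ?w)"
    using geometric w aE by (auto simp: geometric_lattice_def)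
  have "a \<squnion> ?w = J {a, ?w}" by (simp add: join_def)
  also have "\<dots> = J (insert a X)"
  proof (rule J_eqI)
    show "x \<sqsubseteq> J (insert a X)" if "x \<in> {a, ?w}" for x
      using that X aE by (auto intro: J_upper J_mono)
    show "x \<sqsubseteq> J {a, ?w}" if "x \<in> insert a X" for x
      using that X aE w le_trans[OF J_upper[of X x] J_upper[of "{a, ?w}" ?w]]
      by (auto intro: J_upper J_closed)
  qed (use X aE w in auto)
  finally have j: "a \<squnion> ?w = J (insert a X)" .
  let ?z = "J (insert b X)"
  have z: "?z \<in> E" "?w \<sqsubseteq> ?z" "b \<sqsubseteq> ?z" using X bE by (auto intro: J_closed J_mono J_upper)
  then have "?w \<sqsubset> ?z" using nb by (auto simp: less_iff)
  moreover have "?z \<sqsubseteq> J (insert a X)"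
    using X aE bE le by (subst J_le_iff) (auto intro: J_closed J_upper)
  ultimately have "?z = J (insert a X)"
    using cov z(1) unfolding j covers_def less_iff by auto
  then show ?thesis using X aE by (auto intro: J_upper)
qed

subsection \<open>Rank\<close>

definition chain :: "'a set \<Rightarrow> bool" where
  "chain C \<longleftrightarrow> (\<forall>a\<in>C. \<forall>b\<in>C. a \<sqsubseteq> b \<or> b \<sqsubseteq> a)"

lemma interval_rank_ge:
  assumes "C \<subseteq> E" "\<And>c. c \<in> C \<Longrightarrow> x \<sqsubseteq> c \<and> c \<sqsubseteq> y" "chain C"
  shows "card C - 1 \<le> interval_rank L x y"
proof -
  let ?M = "{card C - 1 | C. C \<subseteq> \<lbrace>x..y\<rbrace>\<^bsub>L\<^esub> \<and> (\<forall>a\<in>C. \<forall>b\<in>C. a \<sqsubseteq>\<^bsub>L\<^esub> b \<or> b \<sqsubseteq>\<^bsub>L\<^esub> a)}"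
  have "?M \<subseteq> (\<lambda>C. card C - 1) ` Pow E"
    by (auto simp: at_least_at_most_def)
  then have "finite ?M" using finite_E by (meson finite_Pow_iff finite_imageI finite_subset)
  moreover have "card C - 1 \<in> ?M"
    using assms by (auto simp: at_least_at_most_def chain_def)
  ultimately show ?thesis unfolding interval_rank_def by (rule Max_ge)
qed

lemma interval_rank_chain:
  obtains C where "C \<subseteq> E" "\<And>c. c \<in> C \<Longrightarrow> x \<sqsubseteq> c \<and> c \<sqsubseteq> y" "chain C"
    "interval_rank L x y = card C - 1"
proof -
  let ?M = "{card C - 1 | C. C \<subseteq> \<lbrace>x..y\<rbrace>\<^bsub>L\<^esub> \<and> (\<forall>a\<in>C. \<forall>b\<in>C. a \<sqsubseteq>\<^bsub>L\<^esub> b \<or> b \<sqsubseteq>\<^bsub>L\<^esub> a)}"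
  have "?M \<subseteq> (\<lambda>C. card C - 1) ` Pow E"
    by (auto simp: at_least_at_most_def)
  then have "finite ?M" using finite_E by (meson finite_Pow_iff finite_imageI finite_subset)
  moreover have "?M \<noteq> {}" by (auto intro!: exI[of _ "{}"])
  ultimately have "Max ?M \<in> ?M" by (rule Max_in)
  then obtain C where C: "Max ?M = card C - 1" "C \<subseteq> \<lbrace>x..y\<rbrace>\<^bsub>L\<^esub>"
      "\<forall>a\<in>C. \<forall>b\<in>C. a \<sqsubseteq>\<^bsub>L\<^esub> b \<or> b \<sqsubseteq>\<^bsub>L\<^esub> a"
    by blast
  show thesis
  proof (rule that)
    show "interval_rank L x y = card C - 1" using C(1) by (simp only: interval_rank_def)
    show "C \<subseteq> E" "chain C" using C(2,3) by (auto simp: at_least_at_most_def chain_def)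
    show "x \<sqsubseteq> c \<and> c \<sqsubseteq> y" if "c \<in> C" for c
      using C(2) that by (auto simp: at_least_at_most_def)
  qed
qed

lemma chain_least:
  assumes "finite C" "C \<noteq> {}" "chain C" "C \<subseteq> E"
  shows "\<exists>m\<in>C. \<forall>c\<in>C. m \<sqsubseteq> c"
  using assms
proof (induction C rule: finite_ne_induct)
  case (insert x F)
  then obtain m where m: "m \<in> F" "\<forall>c\<in>F. m \<sqsubseteq> c" by (auto simp: chain_def)
  have "m \<sqsubseteq> x \<or> x \<sqsubseteq> m" using insert.prems m by (auto simp: chain_def)
  then show ?case
  proof
    assume "m \<sqsubseteq> x" then show ?thesis using m by blast
  next
    assume xm: "x \<sqsubseteq> m"
    then have "\<forall>c\<in>F. x \<sqsubseteq> c" using m insert.prems by (meson insert_subset le_trans subsetD)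
    then show ?thesis using insert.prems le_refl by blast
  qed
qed (auto simp: le_refl)

text \<open>Atoms are added greedily, each not yet below the current join. Together with
  \<open>interval_rank_le_card\<close> this makes the rank of an interval the least number of atoms
  that lift its bottom to its top, which is how rank enters everywhere below.\<close>

lemma spanning_atoms:
  assumes "x \<in> E" "y \<in> E" "x \<sqsubseteq> y"
  shows "\<exists>B \<subseteq> below y. card B \<le> interval_rank L x y \<and> J (insert x B) = y"
proof -
  \<comment> \<open>The successive joins form a chain \<open>C\<close>. Building it together with
    \<open>B\<close> bounds \<open>card B\<close> by the rank without comparing the lengths of
    different maximal chains.\<close>
  have "\<exists>B C. B \<subseteq> below y \<and> J (insert x B) = y \<and> C \<subseteq> E \<and> chain C \<and>
      (\<forall>c\<in>C. x \<sqsubseteq> c \<and> c \<sqsubseteq> y) \<and> Suc (card B) \<le> card C"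
    using assms
  proof (induction "card (below y - below x)" arbitrary: x rule: less_induct)
    case less
    show ?case
    proof (cases "x = y")
      case True
      then show ?thesis using less.prems
        by (intro exI[of _ "{}"] exI[of _ "{y}"]) (auto simp: J_singleton chain_def le_refl)
    next
      case False
      then have "\<not> y \<sqsubseteq> x" using less.prems le_antisym by blast
      then obtain a where a: "a \<in> At" "a \<sqsubseteq> y" "\<not> a \<sqsubseteq> x"
        using ex_atom_not_le less.prems by blast
      let ?x = "J {x, a}"
      have aE: "a \<in> E" using a by (simp add: atom_in)
      have xE: "?x \<in> E" "x \<sqsubseteq> ?x" "a \<sqsubseteq> ?x" "?x \<sqsubseteq> y"
        using less.prems a aE by (auto simp: J_le_iff intro: J_closed J_upper)
      have "below x \<subset> below ?x"
        using xE a le_iff_below[of x ?x] less.prems by (auto simp: below_def)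
      moreover have "a \<in> below y - below x" using a by (auto simp: below_def)
      moreover have "a \<notin> below y - below ?x" using a xE by (auto simp: below_def)
      ultimately have "below y - below ?x \<subset> below y - below x" by blast
      then have "card (below y - below ?x) < card (below y - below x)"
        by (intro psubset_card_mono finite_Diff below_subset)
      from less.hyps[OF this xE(1) less.prems(2) xE(4)] obtain B C where
        BC: "B \<subseteq> below y" "J (insert ?x B) = y" "C \<subseteq> E" "chain C"
          "\<forall>c\<in>C. ?x \<sqsubseteq> c \<and> c \<sqsubseteq> y" "Suc (card B) \<le> card C" by blast
      have BE: "B \<subseteq> E" using BC(1) below_subset by blast
      have fB: "finite B" using BC(1) below_subset finite_subset by blast
      have fC: "finite C" using BC(3) finite_E finite_subset by blast
      have xIn: "insert x (insert a B) \<subseteq> E" "insert ?x B \<subseteq> E"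
        using BE xE less.prems aE by auto
      have "J (insert x (insert a B)) = J (insert ?x B)"
      proof (rule J_eqI)
        show "z \<sqsubseteq> J (insert ?x B)" if "z \<in> insert x (insert a B)" for z
          using that xIn le_J[OF xE(2) _ xIn(2)] le_J[OF xE(3) _ xIn(2)] by (auto intro: J_upper)
        have "?x \<sqsubseteq> J (insert x (insert a B))" using xIn by (intro J_mono) auto
        then show "z \<sqsubseteq> J (insert x (insert a B))" if "z \<in> insert ?x B" for z
          using that xIn by (cases "z = ?x") (auto intro: J_upper)
      qed (use xIn in auto)
      moreover have "x \<notin> C"
        using BC xE a less.prems aE le_trans[of a ?x x] by blast
      moreover have "\<forall>c\<in>insert x C. x \<sqsubseteq> c \<and> c \<sqsubseteq> y"
        using BC(3,5) less.prems xE le_refl le_trans[OF xE(2)] by blast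
      moreover from this have "chain (insert x C)"
        using BC(4) less.prems(1) le_refl unfolding chain_def by blast
      moreover have "Suc (card (insert a B)) \<le> card (insert x C)"
        using \<open>x \<notin> C\<close> fC BC(6) card_insert_le_m1[of "Suc (card B)" B a] by simp
      ultimately show ?thesis using BC a less.prems
        by (intro exI[of _ "insert a B"] exI[of _ "insert x C"]) (auto simp: below_def)
    qed
  qed
  then obtain B C where BC: "B \<subseteq> below y" "J (insert x B) = y" "C \<subseteq> E" "chain C"
      "\<forall>c\<in>C. x \<sqsubseteq> c \<and> c \<sqsubseteq> y" "Suc (card B) \<le> card C" by blast
  then have "card B \<le> interval_rank L x y"
    using interval_rank_ge[of C x y] by auto
  with BC show ?thesis by blast
qed

text \<open>Steinitz exchange along the chain: an atom \<open>b\<close> separating the two lowest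
  members is traded for an element \<open>a\<close> of \<open>B\<close>, and the chain without its
  least member then lies above the join of \<open>insert b X\<close>. The lower end is given by a
  set \<open>X\<close> because each exchange adds an atom to it.\<close>

lemma chain_card_le:
  assumes "finite B" "B \<subseteq> At" "X \<subseteq> E" "C \<subseteq> E" "chain C" "C \<noteq> {}"
    "\<And>c. c \<in> C \<Longrightarrow> J X \<sqsubseteq> c \<and> c \<sqsubseteq> J (X \<union> B)"
  shows "card C \<le> Suc (card B)"
  using assms
proof (induction "card B" arbitrary: B X C)
  case 0
  then have "B = {}" by simp
  then have "c = J X" if "c \<in> C" for c
    using 0 that le_antisym[of c "J X"] J_closed by (metis Un_empty_right subsetD)
  then have "C \<subseteq> {J X}" by blast
  then show ?case using card_mono[of "{J X}" C] by simp
next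
  case (Suc n)
  have fC: "finite C" using Suc.prems finite_E finite_subset by blast
  obtain m where m: "m \<in> C" "\<forall>c\<in>C. m \<sqsubseteq> c"
    using chain_least[OF fC] Suc.prems by blast
  show ?case
  proof (cases "C = {m}")
    case True then show ?thesis by simp
  next
    case False
    have ne: "C - {m} \<noteq> {}" using False m by blast
    have ch: "chain (C - {m})" using Suc.prems by (auto simp: chain_def)
    obtain k where k: "k \<in> C - {m}" "\<forall>c\<in>C - {m}. k \<sqsubseteq> c"
      using chain_least[OF _ ne ch] fC Suc.prems by blast
    have E: "m \<in> E" "k \<in> E" using m k Suc.prems by auto
    have "\<not> k \<sqsubseteq> m" using m k E le_antisym by blast
    then obtain b where b: "b \<in> At" "b \<sqsubseteq> k" "\<not> b \<sqsubseteq> m"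
      using ex_atom_not_le E by blast
    have BE: "B \<subseteq> E" using Suc.prems At_E by blast
    have bE: "b \<in> E" using b atom_in by blast
    have JXE: "J X \<in> E" using Suc.prems J_closed by blast
    have nbX: "\<not> b \<sqsubseteq> J X"
      using b m Suc.prems E bE JXE le_trans[of b "J X" m] by blast
    have bXB: "b \<sqsubseteq> J (X \<union> B)"
      using b k Suc.prems E bE BE le_trans[of b k "J (X \<union> B)"] J_closed[of "X \<union> B"] by blast
    \<comment> \<open>When the elements of \<open>B\<close> join \<open>X\<close> one at a time,
      \<open>b\<close> falls below the join at the moment some \<open>a\<close> is added.\<close>
    have "\<exists>D a. D \<subseteq> B \<and> a \<in> B \<and> a \<notin> D \<and> \<not> b \<sqsubseteq> J (X \<union> D) \<and> b \<sqsubseteq> J (X \<union> insert a D)"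
    proof -
      have "\<not> b \<sqsubseteq> J (X \<union> D') \<or> (\<exists>D a. D \<subseteq> D' \<and> a \<in> D' \<and> a \<notin> D \<and> \<not> b \<sqsubseteq> J (X \<union> D) \<and> b \<sqsubseteq> J (X \<union> insert a D))"
        if "finite D'" "D' \<subseteq> B" for D'
        using that
      proof (induction D')
        case (insert a F)
        then show ?case by (cases "b \<sqsubseteq> J (X \<union> F)") blast+
      qed (use nbX in simp)
      then show ?thesis using bXB Suc.prems by blast
    qed
    then obtain D a where D: "D \<subseteq> B" "a \<in> B" "a \<notin> D" "\<not> b \<sqsubseteq> J (X \<union> D)" "b \<sqsubseteq> J (X \<union> insert a D)"
      by blast
    have XD: "X \<union> D \<subseteq> E" using D BE Suc.prems by blast
    have ab: "a \<sqsubseteq> J (insert b (X \<union> D))"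
      using atom_exchange[of a b "X \<union> D"] D b Suc.prems XD by auto
    have aE: "a \<in> E" using D BE by blast
    let ?X = "insert b X" and ?B = "B - {a}"
    have eq: "J (?X \<union> ?B) = J (X \<union> B)"
    proof (rule J_eqI)
      show "z \<sqsubseteq> J (X \<union> B)" if "z \<in> ?X \<union> ?B" for z
        using that bXB BE Suc.prems by (auto intro: J_upper)
      have "J (insert b (X \<union> D)) \<sqsubseteq> J (?X \<union> ?B)"
        using D BE Suc.prems bE by (intro J_mono) auto
      then have "a \<sqsubseteq> J (?X \<union> ?B)"
        using ab aE bE XD BE Suc.prems(3) by (intro le_trans[OF ab] J_closed) auto
      then show "z \<sqsubseteq> J (?X \<union> ?B)" if "z \<in> X \<union> B" for z
        using that BE Suc.prems bE by (cases "z = a") (auto intro!: J_upper)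
    qed (use BE Suc.prems bE in auto)
    have "card (C - {m}) \<le> Suc (card ?B)"
    proof (rule Suc.hyps(1))
      show "n = card (B - {a})" using Suc.hyps(2) Suc.prems D by simp
      show "J (insert b X) \<sqsubseteq> c \<and> c \<sqsubseteq> J (insert b X \<union> (B - {a}))" if c: "c \<in> C - {m}" for c
      proof
        have cE: "c \<in> E" using c Suc.prems by blast
        have "b \<sqsubseteq> c" using b k c bE E cE le_trans by blast
        moreover have "x \<sqsubseteq> c" if "x \<in> X" for x
          using that Suc.prems c cE JXE J_upper[of X x] le_trans[of x "J X" c] by blast
        ultimately show "J (insert b X) \<sqsubseteq> c" using Suc.prems bE cE by (subst J_le_iff) auto
        show "c \<sqsubseteq> J (insert b X \<union> (B - {a}))" using eq Suc.prems c by auto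
      qed
    qed (use Suc.prems ch ne bE in auto)
    then show ?thesis using Suc.prems(1) Suc.hyps(2) D(2) m(1) by (simp add: card_Diff_singleton)
  qed
qed

lemma interval_rank_le_card:
  assumes "finite B" "B \<subseteq> At" "X \<subseteq> E"
  shows "interval_rank L (J X) (J (X \<union> B)) \<le> card B"
proof -
  obtain C where C: "C \<subseteq> E" "\<And>c. c \<in> C \<Longrightarrow> J X \<sqsubseteq> c \<and> c \<sqsubseteq> J (X \<union> B)" "chain C"
    "interval_rank L (J X) (J (X \<union> B)) = card C - 1" by (rule interval_rank_chain) blast
  then show ?thesis using chain_card_le[OF assms C(1,3) _ C(2)] by (cases "C = {}") auto
qed

end

section \<open>Building sets and nested sets\<close>

context geom_lattice begin

lemma finite_sub_E: "A \<subseteq> E \<Longrightarrow> finite A"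
  using finite_E finite_subset by blast

lemma le_J_trans: "\<lbrakk>x \<sqsubseteq> J A; J A \<sqsubseteq> J B; x \<in> E; A \<subseteq> E; B \<subseteq> E\<rbrakk> \<Longrightarrow> x \<sqsubseteq> J B"
  by (rule le_trans[of _ "J A"]) (auto intro: J_closed)

lemma ex_max_below:
  assumes "G \<subseteq> E" "g \<in> G" "x \<in> E" "g \<sqsubseteq> x"
  shows "\<exists>y\<in>max_below L G x. g \<sqsubseteq> y"
  using assms(2,4)
proof (induction "card {z \<in> G. z \<sqsubseteq> x \<and> g \<sqsubseteq> z}" arbitrary: g rule: less_induct)
  case less
  show ?case
  proof (cases "g \<in> max_below L G x")
    case True then show ?thesis using less.prems assms(1) le_refl by blast
  next
    case False
    then obtain z where z: "z \<in> G" "z \<sqsubseteq> x" "g \<sqsubseteq> z" "z \<noteq> g"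
      using less.prems by (auto simp: max_below_def)
    have E: "g \<in> E" "z \<in> E" using less.prems z assms(1) by auto
    have "{w \<in> G. w \<sqsubseteq> x \<and> z \<sqsubseteq> w} \<subset> {w \<in> G. w \<sqsubseteq> x \<and> g \<sqsubseteq> w}"
    proof
      show "{w \<in> G. w \<sqsubseteq> x \<and> z \<sqsubseteq> w} \<subseteq> {w \<in> G. w \<sqsubseteq> x \<and> g \<sqsubseteq> w}"
        using E z assms(1) by (auto intro: le_trans[OF z(3)])
      have "\<not> z \<sqsubseteq> g" using z E le_antisym by blast
      then show "{w \<in> G. w \<sqsubseteq> x \<and> z \<sqsubseteq> w} \<noteq> {w \<in> G. w \<sqsubseteq> x \<and> g \<sqsubseteq> w}"
        using less.prems E le_refl by blast
    qed
    then have "card {w \<in> G. w \<sqsubseteq> x \<and> z \<sqsubseteq> w} < card {w \<in> G. w \<sqsubseteq> x \<and> g \<sqsubseteq> w}"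
      using assms(1) finite_sub_E[of G] by (intro psubset_card_mono) auto
    from less.hyps[OF this z(1,2)] obtain y where y: "y \<in> max_below L G x" "z \<sqsubseteq> y" by blast
    then have "y \<in> E" using assms(1) by (auto simp: max_below_def)
    then show ?thesis using y z E le_trans[of g z y] by blast
  qed
qed

lemma building_set_subset: "building_set L G \<Longrightarrow> G \<subseteq> E" "building_set L G \<Longrightarrow> \<bottom> \<notin> G"
  by (auto simp: building_set_def)

text \<open>
  The part of \<open>X\<close> below a maximal element \<open>y\<close> of \<open>G\<close> below \<open>x\<close> determines the \<open>y\<close>-coordinate of
  the join of \<open>X\<close> under the product decomposition of the interval below \<open>x\<close>.
\<close>

lemma building_set_decomp:
  assumes G: "building_set L G" and x: "x \<in> E" "x \<noteq> \<bottom>"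
  shows "\<And>X y. \<lbrakk>X \<subseteq> G; J X = x; y \<in> max_below L G x\<rbrakk> \<Longrightarrow> J {z \<in> X. z \<sqsubseteq> y} = y"
    and "\<And>a y y'. \<lbrakk>y \<in> max_below L G x; y' \<in> max_below L G x; y \<noteq> y'; a \<in> E; a \<sqsubseteq> y; a \<sqsubseteq> y'\<rbrakk> \<Longrightarrow> a = \<bottom>"
proof -
  let ?F = "max_below L G x" and ?I = "\<lambda>y. \<lbrace>\<bottom>..y\<rbrace>"
  let ?X = "\<Pi>\<^sub>E y\<in>?F. ?I y"
  let ?d = "\<lambda>y. \<lambda>z\<in>?F. if z = y then y else \<bottom>"
  have GE: "G \<subseteq> E" using G building_set_subset by blast
  have FE: "?F \<subseteq> E" "?F \<subseteq> G" and Fx: "\<And>y. y \<in> ?F \<Longrightarrow> y \<sqsubseteq> x"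
    using GE by (auto simp: max_below_def)
  have I: "z \<in> ?I y \<longleftrightarrow> z \<in> E \<and> z \<sqsubseteq> y" for z y by (auto simp: at_least_at_most_def bot_le)
  have "x \<in> E - {\<bottom>}" using x by simp
  with G have "let F = max_below L G x; X = (\<Pi>\<^sub>E y\<in>F. \<lbrace>\<bottom>..y\<rbrace>) in
        \<exists>\<phi>. bij_betw \<phi> X \<lbrace>\<bottom>..x\<rbrace> \<and>
            (\<forall>u\<in>X. \<forall>v\<in>X. \<phi> u \<sqsubseteq> \<phi> v \<longleftrightarrow> (\<forall>y\<in>F. u y \<sqsubseteq> v y)) \<and>
            (\<forall>y\<in>F. \<phi> (\<lambda>z\<in>F. if z = y then y else \<bottom>) = y)"
    unfolding building_set_def by (elim conjE bspec)
  then obtain \<phi> where bij: "bij_betw \<phi> ?X (?I x)"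
    and ord': "\<forall>u\<in>?X. \<forall>v\<in>?X. \<phi> u \<sqsubseteq> \<phi> v \<longleftrightarrow> (\<forall>y\<in>?F. u y \<sqsubseteq> v y)"
    and d': "\<forall>y\<in>?F. \<phi> (?d y) = y"
    unfolding Let_def by (elim exE conjE)
  have ord: "\<phi> u \<sqsubseteq> \<phi> v \<longleftrightarrow> (\<forall>y\<in>?F. u y \<sqsubseteq> v y)" if "u \<in> ?X" "v \<in> ?X" for u v
    using ord'[THEN bspec, THEN bspec, OF that] .
  have d: "\<phi> (?d y) = y" if "y \<in> ?F" for y using d'[THEN bspec, OF that] .
  define \<psi> where "\<psi> = inv_into ?X \<phi>"
  have psi: "\<psi> z \<in> ?X" "\<phi> (\<psi> z) = z" if "z \<in> E" "z \<sqsubseteq> x" for z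
  proof -
    have "z \<in> ?I x" using that I by blast
    then have "z \<in> \<phi> ` ?X" using bij by (simp add: bij_betw_def)
    then show "\<psi> z \<in> ?X" "\<phi> (\<psi> z) = z" unfolding \<psi>_def by (rule inv_into_into, rule f_inv_into_f)
  qed
  have dX: "?d y \<in> ?X" if "y \<in> ?F" for y using that by (auto simp: I bot_in bot_le le_refl subsetD[OF FE(1)])
  have phiE: "\<phi> u \<in> E" "\<phi> u \<sqsubseteq> x" if "u \<in> ?X" for u
    using that bij I by (auto simp: bij_betw_def)
  \<comment> \<open>Comparison with \<open>?d y\<close> shows that an element below the factor
    \<open>y\<close> has bottom in every other coordinate.\<close>
  have below_d: "\<forall>y'\<in>?F. \<psi> z y' \<sqsubseteq> (if y' = y then y else \<bottom>)" if "y \<in> ?F" "z \<in> E" "z \<sqsubseteq> y" for y z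
  proof -
    have zx: "z \<sqsubseteq> x" using that FE Fx x le_trans by blast
    have "\<phi> (\<psi> z) \<sqsubseteq> \<phi> (?d y)" using psi(2)[OF that(2) zx] d[OF that(1)] that by simp
    then show ?thesis using ord[OF psi(1)[OF that(2) zx] dX[OF that(1)]] by simp
  qed
  {
    fix a y y' assume a: "y \<in> ?F" "y' \<in> ?F" "y \<noteq> y'" "a \<in> E" "a \<sqsubseteq> y" "a \<sqsubseteq> y'"
    have ax: "a \<sqsubseteq> x" using a FE Fx x le_trans by blast
    have bx: "\<bottom> \<sqsubseteq> x" using x bot_le by blast
    have "\<psi> a w \<sqsubseteq> \<psi> \<bottom> w" if w: "w \<in> ?F" for w
    proof -
      have "\<psi> a w \<sqsubseteq> \<bottom>" using below_d[OF a(1,4,5)] below_d[OF a(2,4,6)] a(3) w by (cases "w = y") auto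
      moreover have "\<psi> a w \<in> E" "\<psi> \<bottom> w \<in> E" 
        using psi(1)[OF a(4) ax] psi(1)[OF bot_in bx] w I by (auto dest!: PiE_mem)
      ultimately show ?thesis using le_trans[OF _ bot_le] bot_in by blast
    qed
    then have "\<phi> (\<psi> a) \<sqsubseteq> \<phi> (\<psi> \<bottom>)"
      using ord[OF psi(1)[OF a(4) ax] psi(1)[OF bot_in bx]] by blast
    then show "a = \<bottom>" using psi(2)[OF a(4) ax] psi(2)[OF bot_in bx] le_bot a(4) by simp
  }
  {
    fix X y assume X: "X \<subseteq> G" "J X = x" and y: "y \<in> ?F"
    have XE: "X \<subseteq> E" using X GE by blast
    let ?w = "J {z \<in> X. z \<sqsubseteq> y}"
    have wE: "?w \<in> E" using XE by (intro J_closed) blast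
    have yE: "y \<in> E" using y FE by blast
    have wy: "?w \<sqsubseteq> y" using XE yE by (subst J_le_iff) auto
    have wx: "?w \<sqsubseteq> x" using le_trans[OF wy Fx[OF y] wE yE x(1)] .
    \<comment> \<open>\<open>t\<close> is full in all coordinates except \<open>y\<close>, where it
      agrees with \<open>?w\<close>. Each member of \<open>X\<close> lies below one factor and hence
      below \<open>\<phi> t\<close>; so does \<open>x\<close>, and comparison at \<open>y\<close>
      shows that the \<open>y\<close>-coordinate of \<open>?w\<close> is already full.\<close>
    define t where "t = (\<lambda>z\<in>?F. if z = y then \<psi> ?w y else z)"
    have wyX: "\<psi> ?w y \<in> ?I y" using psi(1)[OF wE wx] y by (rule PiE_mem)
    have tX: "t \<in> ?X" unfolding t_def using wyX by (auto simp: I le_refl subsetD[OF FE(1)])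
    have "z \<sqsubseteq> \<phi> t" if z: "z \<in> X" for z
    proof -
      have zE: "z \<in> E" "z \<in> G" and zx: "z \<sqsubseteq> x" using z XE X J_upper[OF XE] by auto
      have "\<psi> z v \<sqsubseteq> t v" if v: "v \<in> ?F" for v
      proof -
        obtain y' where y': "y' \<in> ?F" "z \<sqsubseteq> y'" using ex_max_below[OF GE zE(2) x(1) zx] by blast
        have pz: "\<psi> z v \<in> E" "\<psi> z v \<sqsubseteq> v" using PiE_mem[OF psi(1)[OF zE(1) zx] v] I by auto
        show ?thesis
        proof (cases "v = y")
          case False then show ?thesis using pz v by (simp add: t_def)
        next
          case True
          show ?thesis
          proof (cases "y' = y")
            case True
            then have "z \<sqsubseteq> ?w" using z y' XE by (intro J_upper) auto
            then have "\<phi> (\<psi> z) \<sqsubseteq> \<phi> (\<psi> ?w)" using psi(2)[OF zE(1) zx] psi(2)[OF wE wx] by simp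
            then have "\<psi> z y \<sqsubseteq> \<psi> ?w y" using ord[OF psi(1)[OF zE(1) zx] psi(1)[OF wE wx]] y by blast
            then show ?thesis using \<open>v = y\<close> y by (simp add: t_def)
          next
            case False
            then have "\<psi> z v \<sqsubseteq> \<bottom>" using below_d[OF y'(1) zE(1) y'(2)] v \<open>v = y\<close> by auto
            moreover have "t v \<in> E" using PiE_mem[OF tX v] I by blast
            ultimately show ?thesis using le_trans[OF _ bot_le] pz bot_in by blast
          qed
        qed
      qed
      then have "\<phi> (\<psi> z) \<sqsubseteq> \<phi> t" using ord[OF psi(1)[OF zE(1) zx] tX] by blast
      then show ?thesis using psi(2)[OF zE(1) zx] by simp
    qed
    then have "x \<sqsubseteq> \<phi> t" using X XE phiE[OF tX] J_le_iff[of X "\<phi> t"] by blast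
    then have "\<phi> (?d y) \<sqsubseteq> \<phi> t" using d[OF y] Fx[OF y] le_trans[OF Fx[OF y]] yE x phiE[OF tX] by simp
    then have "?d y y \<sqsubseteq> t y" using ord[OF dX[OF y] tX] y by blast
    then have "y \<sqsubseteq> \<psi> ?w y" using y by (simp add: t_def)
    then have "\<forall>v\<in>?F. ?d y v \<sqsubseteq> \<psi> ?w v" 
      using PiE_mem[OF psi(1)[OF wE wx]] I bot_le by auto
    then have "\<phi> (?d y) \<sqsubseteq> \<phi> (\<psi> ?w)" using ord[OF dX[OF y] psi(1)[OF wE wx]] by blast
    then have "y \<sqsubseteq> ?w" using d[OF y] psi(2)[OF wE wx] by simp
    then show "?w = y" using wy wE yE le_antisym by blast
  }
qed

text \<open>The factors of the join above \<open>p\<close> and above \<open>q\<close> share the atom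
  \<open>a\<close>. Distinct factors meet only in the bottom, so the two coincide, and the common
  factor is the join.\<close>

lemma building_set_join:
  assumes G: "building_set L G" and pq: "p \<in> G" "q \<in> G" "a \<in> At" "a \<sqsubseteq> p" "a \<sqsubseteq> q"
  shows "J {p, q} \<in> G"
proof -
  let ?x = "J {p, q}"
  have GE: "G \<subseteq> E" using G building_set_subset by blast
  have E: "p \<in> E" "q \<in> E" "?x \<in> E" using pq GE J_closed[of "{p, q}"] by auto
  have le: "p \<sqsubseteq> ?x" "q \<sqsubseteq> ?x" using E by (auto intro: J_upper)
  have nb: "?x \<noteq> \<bottom>"
    using le_bot[of p] le E pq atom_not_bot le_bot[of a] by (metis atom_in)
  obtain y y' where y: "y \<in> max_below L G ?x" "p \<sqsubseteq> y" "y' \<in> max_below L G ?x" "q \<sqsubseteq> y'"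
    using ex_max_below[OF GE pq(1) E(3) le(1)] ex_max_below[OF GE pq(2) E(3) le(2)] by blast
  have yE: "y \<in> E" "y' \<in> E" "y \<in> G" "y \<sqsubseteq> ?x" using y GE by (auto simp: max_below_def)
  have "a \<sqsubseteq> y" "a \<sqsubseteq> y'" using le_trans[of a p y] le_trans[of a q y'] pq y yE E atom_in by auto
  then have "y = y'"
    using building_set_decomp(2)[OF G E(3) nb y(1,3)] pq atom_in atom_not_bot by blast
  then have "?x \<sqsubseteq> y" using y yE E by (subst J_le_iff) auto
  then show ?thesis using yE E le_antisym by metis
qed

text \<open>Reduces \<open>p \<sqsubseteq> J X\<close> to a single factor \<open>y\<close>, which is
  itself the join of the part of \<open>X\<close> below it.\<close>

lemma building_set_factor:
  assumes G: "building_set L G" and X: "X \<subseteq> G" "p \<in> G" "p \<sqsubseteq> J X"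
  shows "\<exists>y\<in>G. p \<sqsubseteq> y \<and> J {z \<in> X. z \<sqsubseteq> y} = y"
proof -
  have GE: "G \<subseteq> E" using G building_set_subset by blast
  have E: "J X \<in> E" using X GE J_closed by blast
  have nb: "J X \<noteq> \<bottom>" using X GE le_bot building_set_subset(2)[OF G] by (metis subsetD)
  obtain y where y: "y \<in> max_below L G (J X)" "p \<sqsubseteq> y"
    using ex_max_below[OF GE X(2) E X(3)] by blast
  then show ?thesis using building_set_decomp(1)[OF G E nb X(1) refl y(1)] by (auto simp: max_below_def)
qed

end

locale building = geom_lattice L for L :: "'a gorder" (structure) +
  fixes G :: "'a set"
  assumes building: "building_set L G"
begin

text \<open>The ambient \<open>G\<close> is kept fixed, so that removing a minimal non-atom from
  \<open>H\<close> leaves a partial building set for the same \<open>G\<close>.\<close>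

definition pbs :: "'a set \<Rightarrow> bool" where
  "pbs H \<longleftrightarrow> H \<subseteq> G \<and> At \<subseteq> H \<and> (\<forall>p \<in> H - At. \<forall>q \<in> G. p \<sqsubseteq> q \<longrightarrow> q \<in> H - At)"

text \<open>
  In this form, nestedness of \<open>S\<close> visibly depends only on the part of \<open>S\<close> outside the atoms and on the
  join of the atoms in \<open>S\<close>.
\<close>

definition nested :: "'a set \<Rightarrow> 'a set \<Rightarrow> bool" where
  "nested H S \<longleftrightarrow> (\<forall>A\<subseteq>S. \<forall>p\<in>H - At. p \<sqsubseteq> J A \<longrightarrow> (\<exists>s\<in>A. p \<sqsubseteq> s))"

lemma G_E: "G \<subseteq> E" and bot_notin_G: "\<bottom> \<notin> G"
  using building_set_subset[OF building] by auto

lemma pbs_simps: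
  assumes "pbs H"
  shows pbs_G: "H \<subseteq> G" and pbs_E: "H \<subseteq> E" and pbs_At: "At \<subseteq> H" and pbs_finite: "finite H"
    and pbs_bot: "\<bottom> \<notin> H"
proof -
  show G: "H \<subseteq> G" and "At \<subseteq> H" using assms by (auto simp: pbs_def)
  show "H \<subseteq> E" using G G_E by (rule subset_trans)
  then show "finite H" by (rule finite_sub_E)
  show "\<bottom> \<notin> H" using G bot_notin_G by blast
qed

lemma pbs_up: "\<lbrakk>pbs H; p \<in> H - At; q \<in> G; p \<sqsubseteq> q\<rbrakk> \<Longrightarrow> q \<in> H - At"
  unfolding pbs_def by blast

lemma pbs_join:
  assumes H: "pbs H" and pq: "p \<in> H" "q \<in> H" "a \<in> At" "a \<sqsubseteq> p" "a \<sqsubseteq> q"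
  shows "J {p, q} \<in> H"
proof -
  have E: "p \<in> E" "q \<in> E" "a \<in> E" using pbs_E[OF H] pq atom_in by auto
  have x: "J {p, q} \<in> G" using building_set_join[OF building] pq pbs_G[OF H] by blast
  have le: "p \<sqsubseteq> J {p, q}" "q \<sqsubseteq> J {p, q}" using E by (auto intro: J_upper)
  consider "p \<in> H - At" | "q \<in> H - At" | "p \<in> At" "q \<in> At" using pq by blast
  then show ?thesis
  proof cases
    case 3
    then have "p = a" "q = a" using pq E le_atom atom_not_bot by metis+
    then show ?thesis using pq E J_singleton by simp
  qed (use pbs_up[OF H] x le in blast)+
qed

text \<open>If the join of a nonempty part of a nested set lies in \<open>H\<close>, the maximal
  members of that part are an antichain with the same join, hence a single element. Passing to a
  factor reduces a general \<open>p \<sqsubseteq> J A\<close> to this case. Conversely, a member of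
  \<open>A\<close> above \<open>J A\<close> leaves no room for incomparable ones.\<close>

lemma nested_sets_eq:
  assumes H: "pbs H"
  shows "nested_sets L H = {S. S \<subseteq> H \<and> nested H S}"
proof (intro subset_antisym subsetI)
  fix S assume S: "S \<in> nested_sets L H"
  then have SH: "S \<subseteq> H" and an: "\<And>A. \<lbrakk>A \<subseteq> S; 2 \<le> card A; pairwise (\<lambda>p q. \<not> p \<sqsubseteq> q \<and> \<not> q \<sqsubseteq> p) A\<rbrakk> \<Longrightarrow> J A \<notin> H"
    by (auto simp: nested_sets_def)
  have SE: "S \<subseteq> E" using SH pbs_E[OF H] by blast
  have mem: "J A \<in> A" if A: "A \<subseteq> S" "A \<noteq> {}" "J A \<in> H" for A
  proof -
    let ?M = "max_below L A (J A)"
    have AE: "A \<subseteq> E" using A SE by blast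
    have M: "?M \<subseteq> A" by (auto simp: max_below_def)
    have cov: "\<exists>y\<in>?M. a \<sqsubseteq> y" if "a \<in> A" for a
      using ex_max_below[OF AE that J_closed[OF AE] J_upper[OF AE that]] .
    have JM: "J ?M = J A"
    proof (rule J_eqI)
      show "a \<sqsubseteq> J ?M" if a: "a \<in> A" for a
      proof -
        obtain y where "y \<in> ?M" "a \<sqsubseteq> y" using cov[OF a] by blast
        then show ?thesis using a AE M by (intro le_J[of a y]) auto
      qed
      show "a \<sqsubseteq> J A" if "a \<in> ?M" for a using that M AE by (auto intro: J_upper)
    qed (use M AE in auto)
    have pw: "pairwise (\<lambda>p q. \<not> p \<sqsubseteq> q \<and> \<not> q \<sqsubseteq> p) ?M"
      unfolding pairwise_def max_below_def by blast
    have "\<not> 2 \<le> card ?M" using an[OF _ _ pw] M A JM by auto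
    moreover have "?M \<noteq> {}" using cov A(2) by blast
    moreover have "finite ?M" using M AE finite_sub_E[of ?M] by blast
    ultimately have "card ?M = 1" using card_gt_0_iff[of ?M] by linarith
    then obtain m where m: "?M = {m}" by (rule card_1_singletonE)
    then have "m \<in> A" using M by blast
    then show ?thesis using JM m AE J_singleton by (metis subsetD)
  qed
  have "\<exists>s\<in>A. p \<sqsubseteq> s" if A: "A \<subseteq> S" and p: "p \<in> H - At" "p \<sqsubseteq> J A" for A p
  proof -
    have AG: "A \<subseteq> G" using A SH pbs_G[OF H] by blast
    obtain y where y: "y \<in> G" "p \<sqsubseteq> y" "J {z \<in> A. z \<sqsubseteq> y} = y"
      using building_set_factor[OF building AG] p pbs_G[OF H] by blast
    have "y \<in> H - At" using pbs_up[OF H p(1) y(1,2)] .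
    moreover have "{z \<in> A. z \<sqsubseteq> y} \<noteq> {}" using y J_empty bot_notin_G by metis
    ultimately have "J {z \<in> A. z \<sqsubseteq> y} \<in> {z \<in> A. z \<sqsubseteq> y}" using A y(3) by (intro mem) auto
    then show ?thesis using y by auto
  qed
  then show "S \<in> {S. S \<subseteq> H \<and> nested H S}" using SH by (auto simp: nested_def)
next
  fix S assume "S \<in> {S. S \<subseteq> H \<and> nested H S}"
  then have S: "S \<subseteq> H" "nested H S" by auto
  have "J A \<notin> H" if A: "A \<subseteq> S" "2 \<le> card A" "pairwise (\<lambda>p q. \<not> p \<sqsubseteq> q \<and> \<not> q \<sqsubseteq> p) A" for A
  proof
    assume JH: "J A \<in> H"
    have AE: "A \<subseteq> E" using A S pbs_E[OF H] by blast
    have "\<exists>s\<in>A. J A \<sqsubseteq> s"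
    \<comment> \<open>\<open>nested\<close> tests only non-atoms. If the join is an atom, every
      member of \<open>A\<close> equals it, since members of \<open>H\<close> are not
      bottom.\<close>
    proof (cases "J A \<in> At")
      case True
      have "A \<noteq> {}" using A by auto
      then obtain s where s: "s \<in> A" by blast
      then have "s = J A" using le_atom[OF True] J_upper[OF AE s] AE A S pbs_bot[OF H] by blast
      then show ?thesis using s AE le_refl by auto
    next
      case False
      then show ?thesis using S(2) A(1) JH J_closed[OF AE] le_refl unfolding nested_def by blast
    qed
    then obtain s where s: "s \<in> A" "J A \<sqsubseteq> s" by blast
    then have "t = s" if "t \<in> A" for t
      using A(3) that J_upper[OF AE that] le_trans[of t "J A" s] AE J_closed[OF AE] unfolding pairwise_def by blast
    then have "A \<subseteq> {s}" by blast
    then have "card A \<le> 1" using card_mono[of "{s}" A] by simp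
    then show False using A(2) by simp
  qed
  then show "S \<in> nested_sets L H" using S by (auto simp: nested_sets_def)
qed

lemma nested_mono: "nested H S \<Longrightarrow> T \<subseteq> S \<Longrightarrow> nested H T"
  unfolding nested_def by blast

lemma not_le_atom:
  assumes "pbs H" "p \<in> H - At" "a \<in> At" shows "\<not> p \<sqsubseteq> a"
  using le_atom[OF assms(3), of p] assms pbs_E[OF assms(1)] pbs_bot[OF assms(1)] by blast

text \<open>A witness above some \<open>p\<close> in \<open>H - At\<close> is never an atom. So the
  atoms of the test set may be replaced by atoms with a larger join without creating new
  witnesses.\<close>

lemma nested_le:
  assumes H: "pbs H" and S: "S \<subseteq> E" "S' \<subseteq> E" "S - At \<subseteq> S' - At"
    and J: "J (S \<inter> At) \<sqsubseteq> J (S' \<inter> At)" and nested: "nested H S'"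
  shows "nested H S"
  unfolding nested_def
proof (intro allI impI ballI)
  fix A p assume A: "A \<subseteq> S" and p: "p \<in> H - At" "p \<sqsubseteq> J A"
  let ?A = "(A - At) \<union> (S' \<inter> At)"
  have AE: "?A \<subseteq> E" "A \<subseteq> E" using A S by auto
  have "J A \<sqsubseteq> J ?A"
  proof (rule J_cover[OF AE(2,1)])
    fix a assume a: "a \<in> A"
    show "a \<sqsubseteq> J ?A"
    proof (cases "a \<in> At")
      case True
      then have "a \<sqsubseteq> J (S \<inter> At)" using a A S by (intro J_upper) auto
      then have "a \<sqsubseteq> J (S' \<inter> At)"
        using J True atom_in S J_closed[of "S \<inter> At"] J_closed[of "S' \<inter> At"] le_trans by blast
      then show ?thesis using AE True atom_in by (auto intro: le_J_mono)
    next
      case False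
      then show ?thesis using a AE by (auto intro: J_upper)
    qed
  qed
  then have "p \<sqsubseteq> J ?A" using p(1) pbs_E[OF H] by (intro le_J_trans[OF p(2) _ _ AE(2,1)]) auto
  moreover have "?A \<subseteq> S'" using A S by auto
  ultimately obtain s where "s \<in> ?A" "p \<sqsubseteq> s" using nested p unfolding nested_def by blast
  then show "\<exists>s\<in>A. p \<sqsubseteq> s" using not_le_atom[OF H p(1)] by auto
qed

lemma nested_cong:
  assumes "pbs H" "S \<subseteq> E" "S' \<subseteq> E" "S - At = S' - At" "J (S \<inter> At) = J (S' \<inter> At)"
  shows "nested H S \<longleftrightarrow> nested H S'"
  using nested_le[of H S S'] nested_le[of H S' S] assms At_E
  by (metis J_closed le_refl le_infI1 order_refl)

lemma nested_atoms:
  assumes H: "pbs H" and S: "nested H S" "p \<in> H - At" shows "\<not> p \<sqsubseteq> J (S \<inter> At)"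
proof
  assume "p \<sqsubseteq> J (S \<inter> At)"
  then obtain s where "s \<in> S \<inter> At" "p \<sqsubseteq> s" using S unfolding nested_def by (meson inf_le1)
  then show False using not_le_atom[OF H S(2)] by blast
qed

end

section \<open>Adding one minimal non-atom to a partial building set\<close>

locale building_step = building L G for L :: "'a gorder" (structure) and G +
  fixes H H' :: "'a set" and p :: 'a
  assumes H': "pbs H'" and p: "p \<in> H' - At" and min: "\<And>h. \<lbrakk>h \<in> H' - At; h \<sqsubseteq> p\<rbrakk> \<Longrightarrow> h = p"
    and H_def: "H = H' - {p}"
begin

lemma H: "pbs H"
  using H' p min unfolding pbs_def H_def by blast

lemma p_E: "p \<in> E" and p_notin: "p \<notin> H" and H_sub: "H \<subseteq> H'" and p_G: "p \<in> G"
  using p pbs_E[OF H'] pbs_G[OF H'] by (auto simp: H_def)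

text \<open>Only the test for \<open>p\<close> is new. The factor through which \<open>p\<close>
  lies below \<open>J A\<close> is either larger than \<open>p\<close>, and nestedness over
  \<open>H\<close> applies to it, or \<open>p\<close> itself, and then by minimality the members of
  \<open>A\<close> below \<open>p\<close> are atoms.\<close>

lemma nested_step:
  assumes S: "S \<subseteq> H"
  shows "nested H' S \<longleftrightarrow> nested H S \<and> \<not> p \<sqsubseteq> J (S \<inter> At)"
proof (intro iffI conjI)
  assume *: "nested H' S"
  then show "nested H S" using H_sub unfolding nested_def by blast
  show "\<not> p \<sqsubseteq> J (S \<inter> At)" using nested_atoms[OF H' * p] .
next
  assume *: "nested H S \<and> \<not> p \<sqsubseteq> J (S \<inter> At)"
  have SE: "S \<subseteq> E" using S pbs_E[OF H] by blast
  show "nested H' S"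
    unfolding nested_def
  proof (intro allI impI ballI)
    fix A q assume A: "A \<subseteq> S" and q: "q \<in> H' - At" "q \<sqsubseteq> J A"
    show "\<exists>s\<in>A. q \<sqsubseteq> s"
    proof (cases "q = p")
      case False
      then show ?thesis using A q * unfolding nested_def H_def by blast
    next
      case True
      have AG: "A \<subseteq> G" using A S pbs_G[OF H] by blast
      obtain y where y: "y \<in> G" "p \<sqsubseteq> y" "J {z \<in> A. z \<sqsubseteq> y} = y"
        using building_set_factor[OF building AG p_G] q True by blast
      have yH: "y \<in> H' - At" using pbs_up[OF H' p y(1,2)] .
      have yE: "y \<in> E" using y G_E by blast
      have AE: "A \<subseteq> E" using A SE by blast
      have "y \<noteq> p"
      proof
        assume yp: "y = p"
        have "{z \<in> A. z \<sqsubseteq> y} \<subseteq> S \<inter> At" using A S min yp p_notin H_sub by blast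
        then have "y \<sqsubseteq> J (S \<inter> At)" using J_mono[of "{z \<in> A. z \<sqsubseteq> y}" "S \<inter> At"] y(3) SE by auto
        then show False using * yp by blast
      qed
      then have "y \<in> H - At" using yH by (auto simp: H_def)
      moreover have "y \<sqsubseteq> J {z \<in> A. z \<sqsubseteq> y}" using y(3) yE le_refl by simp
      moreover have "{z \<in> A. z \<sqsubseteq> y} \<subseteq> S" using A by blast
      ultimately obtain s where "s \<in> A" "y \<sqsubseteq> s" using * unfolding nested_def by blast
      then show ?thesis using le_trans[OF y(2)] True yE p_E AE by blast
    qed
  qed
qed

text \<open>The set \<open>below p\<close> can stand in for \<open>p\<close>: both have the same
  join, and neither \<open>p\<close> nor an atom lies above any element of \<open>H - At\<close>.
  Faces through \<open>p\<close> are thus expressed over \<open>H\<close> with a larger fixed set,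
  which makes an induction on \<open>H\<close> possible.\<close>

lemma nested_step_insert:
  assumes S: "S \<subseteq> H"
  shows "nested H' (insert p S) \<longleftrightarrow> nested H (S \<union> below p) \<and> \<not> p \<sqsubseteq> J (S \<inter> At)"
proof (intro iffI conjI)
  have SE: "S \<subseteq> E" using S pbs_E[OF H] by blast
  {
    assume *: "nested H' (insert p S)"
    show "\<not> p \<sqsubseteq> J (S \<inter> At)" using nested_atoms[OF H' _ p] nested_mono[OF *] by blast
    show "nested H (S \<union> below p)"
      unfolding nested_def
    proof (intro allI impI ballI)
      fix A q assume A: "A \<subseteq> S \<union> below p" and q: "q \<in> H - At" "q \<sqsubseteq> J A"
      let ?A = "insert p (A \<inter> S)"
      have AE: "A \<subseteq> E" "?A \<subseteq> E" using A SE below_subset p_E by blast+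
      have "J A \<sqsubseteq> J ?A"
      proof (rule J_cover[OF AE])
        fix a assume a: "a \<in> A"
        show "a \<sqsubseteq> J ?A"
        proof (cases "a \<in> S")
          case False
          then have "a \<sqsubseteq> p" using a A by (auto simp: below_def)
          then show ?thesis using a AE by (intro le_J[of a p]) auto
        qed (use a AE in \<open>auto intro: J_upper\<close>)
      qed
      then have "q \<sqsubseteq> J ?A" using q(1) pbs_E[OF H] by (intro le_J_trans[OF q(2) _ _ AE]) auto
      moreover have "?A \<subseteq> insert p S" "q \<in> H' - At" using q(1) H_sub by auto
      ultimately obtain s where s: "s \<in> ?A" "q \<sqsubseteq> s" using * unfolding nested_def by blast
      moreover have "s \<noteq> p" using s(2) q(1) min[of q] H_sub p_notin by auto
      ultimately show "\<exists>s\<in>A. q \<sqsubseteq> s" by blast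
    qed
  }
  assume *: "nested H (S \<union> below p) \<and> \<not> p \<sqsubseteq> J (S \<inter> At)"
  then have S': "nested H' S" using nested_step[OF S] nested_mono[of H "S \<union> below p" S] by blast
  show "nested H' (insert p S)"
    unfolding nested_def
  proof (intro allI impI ballI)
    fix A q assume A: "A \<subseteq> insert p S" and q: "q \<in> H' - At" "q \<sqsubseteq> J A"
    consider "p \<notin> A" | "p \<in> A" "q = p" | "p \<in> A" "q \<in> H - At" using q by (auto simp: H_def)
    then show "\<exists>s\<in>A. q \<sqsubseteq> s"
    proof cases
      case 1
      then show ?thesis using S' A q unfolding nested_def by blast
    next
      case 2
      then show ?thesis using le_refl p_E by blast
    next
      case 3
      let ?A = "(A - {p}) \<union> below p"
      have AE: "A \<subseteq> E" "?A \<subseteq> E" using A SE below_subset p_E by blast+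
      have "p \<sqsubseteq> J ?A" using J_mono[of "below p" ?A] J_below[OF p_E] AE by auto
      then have "a \<sqsubseteq> J ?A" if "a \<in> A" for a
        using that AE by (cases "a = p") (auto intro: J_upper)
      then have "J A \<sqsubseteq> J ?A" using AE by (intro J_cover)
      then have "q \<sqsubseteq> J ?A" using q(1) pbs_E[OF H'] by (intro le_J_trans[OF q(2) _ _ AE]) auto
      moreover have "?A \<subseteq> S \<union> below p" using A by blast
      ultimately obtain s where s: "s \<in> ?A" "q \<sqsubseteq> s" using * 3 unfolding nested_def by blast
      then show ?thesis using not_le_atom[OF H 3(2)] below_subset(1)[of p] by blast
    qed
  qed
qed

end

section \<open>Circuits of the iterated blowup\<close>

context geom_lattice begin

section \<open>Independence and circuits among the atoms\<close>

definition indep :: "'a set \<Rightarrow> bool" where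
  "indep B \<longleftrightarrow> (\<forall>a\<in>B. \<not> a \<sqsubseteq> J (B - {a}))"

definition circuit :: "'a set \<Rightarrow> bool" where
  "circuit C \<longleftrightarrow> C \<subseteq> At \<and> \<not> indep C \<and> (\<forall>D. D \<subset> C \<longrightarrow> indep D)"

text \<open>Dependence provides one such element; exchange carries the property to every other
  one.\<close>

lemma circuit_closure:
  assumes C: "circuit C" and c: "c \<in> C"
  shows "c \<sqsubseteq> J (C - {c})"
proof -
  have CE: "C \<subseteq> At" "C \<subseteq> E" using C At_E by (auto simp: circuit_def)
  obtain a where a: "a \<in> C" "a \<sqsubseteq> J (C - {a})" using C by (auto simp: circuit_def indep_def)
  show ?thesis
  proof (cases "a = c")
    case False
    have "indep (C - {c})" using C c by (auto simp: circuit_def)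
    then have na: "\<not> a \<sqsubseteq> J (C - {c} - {a})" using a False by (auto simp: indep_def)
    have eq: "insert c (C - {c} - {a}) = C - {a}" "insert a (C - {c} - {a}) = C - {c}"
      using a c False by auto
    have "c \<sqsubseteq> J (insert a (C - {c} - {a}))"
      by (rule atom_exchange[OF _ _ _ na]) (use a c CE eq in auto)
    then show ?thesis unfolding eq .
  qed (use a in simp)
qed

lemma J_remove:
  assumes "C \<subseteq> E" "c \<sqsubseteq> J (C - {c})" shows "J (C - {c}) = J C"
proof (rule J_eqI)
  show "a \<sqsubseteq> J (C - {c})" if "a \<in> C" for a
    using that assms by (cases "a = c") (auto intro: J_upper)
qed (use assms J_upper in auto)

lemma circuit_J: "circuit C \<Longrightarrow> c \<in> C \<Longrightarrow> J (C - {c}) = J C"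
  using J_remove circuit_closure At_E by (meson circuit_def subset_trans)

text \<open>A minimal \<open>D'\<close> spanning \<open>g\<close> works: dropping a redundant
  element would keep the span, so \<open>D'\<close> is independent, and a dependence involving
  \<open>g\<close> could be exchanged into a smaller set that spans \<open>g\<close>.\<close>

lemma ex_circuit:
  assumes g: "g \<in> At" "g \<notin> D" and D: "D \<subseteq> At" "g \<sqsubseteq> J D"
  shows "\<exists>D'\<subseteq>D. circuit (insert g D')"
proof -
  have "finite D" using D finite_At finite_subset by blast
  then obtain D' where D': "D' \<subseteq> D" "g \<sqsubseteq> J D'" and min: "\<And>B. B \<subset> D' \<Longrightarrow> \<not> g \<sqsubseteq> J B"
    using finite_has_minimal2[of "{B \<in> Pow D. g \<sqsubseteq> J B}" D] D(2)
    by (auto simp: psubset_eq) (metis (no_types, lifting) dual_order.trans)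
  have DE: "D' \<subseteq> At" "D' \<subseteq> E" using D D' At_E by auto
  have gE: "g \<in> E" using g atom_in by blast
  have ind: "\<not> d \<sqsubseteq> J (B - {d})" if B: "B \<subseteq> D'" "d \<in> B" for B d
  proof
    assume "d \<sqsubseteq> J (B - {d})"
    then have "d \<sqsubseteq> J (D' - {d})" by (rule le_J_mono) (use B DE in auto)
    then have "J (D' - {d}) = J D'" by (rule J_remove[OF DE(2)])
    then show False using min[of "D' - {d}"] D' B by auto
  qed
  have "indep B" if B: "B \<subset> insert g D'" for B
    unfolding indep_def
  proof
    fix c assume c: "c \<in> B"
    show "\<not> c \<sqsubseteq> J (B - {c})"
    proof (cases "g \<in> B")
      case False
      then show ?thesis using ind[of B c] B c by blast
    next
      case True
      then have sub: "B - {g} \<subset> D'" using B by blast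
      show ?thesis
      proof (cases "c = g")
        case True then show ?thesis using min[OF sub] by simp
      next
        case False
        show ?thesis
        proof
          assume le: "c \<sqsubseteq> J (B - {c})"
          have cD: "c \<in> D'" using False B c by blast
          have eq: "B - {c} = insert g (B - {g} - {c})" "insert c (B - {g} - {c}) = B - {g}"
            using True False c by auto
          have nc: "\<not> c \<sqsubseteq> J (B - {g} - {c})" using ind[of "B - {g}" c] sub c False by blast
          have "g \<sqsubseteq> J (insert c (B - {g} - {c}))"
            by (rule atom_exchange[OF _ _ _ nc]) (use g cD DE sub le eq(1) in auto)
          then show False using min[OF sub] eq(2) by simp
        qed
      qed
    qed
  qed
  moreover have "insert g D' - {g} = D'" using g D' by blast
  then have "\<not> indep (insert g D')" using D'(2) by (auto simp: indep_def)
  ultimately have "circuit (insert g D')" using g DE by (auto simp: circuit_def)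
  then show ?thesis using D' by blast
qed

text \<open>
  An element of an iterated blowup is given by a pair \<open>(U, x)\<close> of a set of blown-up elements and
  an element of \<open>L\<close>. The most recently blown-up element is the head of the list.
\<close>

fun exc :: "'a list \<Rightarrow> 'a set \<Rightarrow> 'a \<Rightarrow> 'a blowup_elt" where
  "exc [] U x = Base x"
| "exc (q # qs) U x = (if q \<in> U then Exc (Base q) (exc qs U x) else exc qs U x)"

text \<open>An exceptional element over \<open>(U, x)\<close> appears when \<open>q\<close> and
  \<open>(U, x)\<close> have a join in the previous poset. That join is
  \<open>(U, J {x, q})\<close>, hence the membership condition in the second set.\<close>

fun pairs :: "'a list \<Rightarrow> ('a set \<times> 'a) set" where
  "pairs [] = {({}, x) | x. x \<in> E}"
| "pairs (q # qs) = {(U, x) \<in> pairs qs. \<not> q \<sqsubseteq> x} \<union>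
    {(insert q U, x) | U x. (U, J {x, q}) \<in> pairs qs \<and> \<not> q \<sqsubseteq> x \<and> x \<in> E}"

text \<open>No element blown up earlier may lie below \<open>q\<close>; otherwise \<open>q\<close>
  would have disappeared before its turn.\<close>

fun blowable :: "'a list \<Rightarrow> bool" where
  "blowable [] \<longleftrightarrow> True"
| "blowable (q # qs) \<longleftrightarrow> q \<in> E - At - {\<bottom>} \<and> q \<notin> set qs \<and> (\<forall>p\<in>set qs. \<not> p \<sqsubseteq> q) \<and> blowable qs"

abbreviation blown :: "'a list \<Rightarrow> 'a blowup_elt gorder" where
  "blown qs \<equiv> foldr blowup (map Base qs) (base_poset L)"

lemma pairs_subset: "blowable qs \<Longrightarrow> (U, x) \<in> pairs qs \<Longrightarrow> U \<subseteq> set qs \<and> x \<in> E"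
proof (induction qs arbitrary: U x)
  case (Cons q qs) then show ?case by fastforce
qed auto

lemma pairs_down:
  "\<lbrakk>blowable qs; (U, x) \<in> pairs qs; V \<subseteq> U; y \<in> E; y \<sqsubseteq> x\<rbrakk> \<Longrightarrow> (V, y) \<in> pairs qs"
proof (induction qs arbitrary: U x V y)
  case (Cons q qs)
  have q: "q \<in> E" "blowable qs" "q \<notin> set qs" using Cons.prems by auto
  consider (old) "(U, x) \<in> pairs qs" "\<not> q \<sqsubseteq> x"
    | (new) U' where "U = insert q U'" "(U', J {x, q}) \<in> pairs qs" "\<not> q \<sqsubseteq> x" "x \<in> E"
    using Cons.prems(2) by auto
  then show ?case
  proof cases
    case old
    then have "x \<in> E" using pairs_subset q by blast
    then have "\<not> q \<sqsubseteq> y" using old Cons.prems q le_trans by blast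
    then show ?thesis using Cons.IH[OF q(2) old(1) Cons.prems(3-5)] by simp
  next
    case new
    have le: "x \<sqsubseteq> J {x, q}" "q \<sqsubseteq> J {x, q}" "J {x, q} \<in> E"
      using new q by (auto intro: J_upper J_closed)
    have nq: "\<not> q \<sqsubseteq> y" using new Cons.prems q le_trans by blast
    show ?thesis
    proof (cases "q \<in> V")
      case True
      have "J {y, q} \<sqsubseteq> J {x, q}" using Cons.prems new q le le_trans[of y x] by (subst J_le_iff) auto
      then have "(V - {q}, J {y, q}) \<in> pairs qs"
        using Cons.IH[OF q(2) new(2), of "V - {q}" "J {y, q}"] Cons.prems new q J_closed[of "{y, q}"] by auto
      moreover have "V = insert q (V - {q})" using True by blast
      ultimately show ?thesis using nq Cons.prems(4) by auto
    next
      case False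
      have "y \<sqsubseteq> J {x, q}" using le_trans[of y x "J {x, q}"] Cons.prems new le by blast
      then have "(V, y) \<in> pairs qs" using Cons.IH[OF q(2) new(2), of V y] Cons.prems new False by auto
      then show ?thesis using nq by simp
    qed
  qed
qed (auto)

lemma pairs_empty: "blowable qs \<Longrightarrow> ({}, x) \<in> pairs qs \<longleftrightarrow> x \<in> E \<and> (\<forall>q\<in>set qs. \<not> q \<sqsubseteq> x)"
  by (induction qs) auto

lemma exc_insert: "q \<notin> set qs \<Longrightarrow> exc qs (insert q U) x = exc qs U x"
  by (induction qs) auto

lemma exc_eq_Exc: "exc qs U x = Exc (Base q) w \<Longrightarrow> q \<in> set qs"
  by (induction qs) (auto split: if_splits)

lemma exc_empty: "exc qs {} x = Base x"
  by (induction qs) auto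

text \<open>Since pairs are closed downwards, \<open>q\<close> and \<open>(U, x)\<close> have the
  join \<open>(U, J {x, q})\<close> as soon as they have any upper bound; this matches the existence
  condition in a blowup with the recursion for \<open>pairs\<close>. Carrier and order are treated
  together because the order of one stage decides which joins exist for the next.\<close>

lemma blown_structure:
  assumes "blowable qs"
  shows "carrier (blown qs) = {exc qs U x | U x. (U, x) \<in> pairs qs}" (is ?C)
    and "\<And>U x V y. \<lbrakk>(U, x) \<in> pairs qs; (V, y) \<in> pairs qs\<rbrakk> \<Longrightarrow>
      exc qs U x \<sqsubseteq>\<^bsub>blown qs\<^esub> exc qs V y \<longleftrightarrow> U \<subseteq> V \<and> x \<sqsubseteq> y" (is "\<And>U x V y. _ \<Longrightarrow> _ \<Longrightarrow> ?O U x V y")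
proof -
  have "?C \<and> (\<forall>U x V y. (U, x) \<in> pairs qs \<longrightarrow> (V, y) \<in> pairs qs \<longrightarrow> ?O U x V y)"
    using assms
  proof (induction qs)
    case Nil
    then show ?case by (auto simp: base_poset_def)
  next
    case (Cons q qs)
    let ?P = "blown qs"
    have q: "q \<in> E" "blowable qs" "q \<notin> set qs" "\<And>p. p \<in> set qs \<Longrightarrow> \<not> p \<sqsubseteq> q" using Cons.prems by auto
    have car: "carrier ?P = {exc qs U x | U x. (U, x) \<in> pairs qs}"
      and ord: "\<And>U x V y. (U, x) \<in> pairs qs \<Longrightarrow> (V, y) \<in> pairs qs \<Longrightarrow>
        exc qs U x \<sqsubseteq>\<^bsub>?P\<^esub> exc qs V y \<longleftrightarrow> U \<subseteq> V \<and> x \<sqsubseteq> y"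
      using Cons.IH[OF q(2)] by auto
    have ps: "U \<subseteq> set qs" "x \<in> E" "q \<notin> U" if "(U, x) \<in> pairs qs" for U x
      using pairs_subset[OF q(2) that] q by auto
    have qp: "({}, q) \<in> pairs qs" using q pairs_empty by blast
    have Bq: "Base q = exc qs {} q" by (simp add: exc_empty)
    have Bq_le: "Base q \<sqsubseteq>\<^bsub>?P\<^esub> exc qs U x \<longleftrightarrow> q \<sqsubseteq> x" if "(U, x) \<in> pairs qs" for U x
      unfolding Bq using ord[OF qp that] by simp
    \<comment> \<open>The exceptional elements over \<open>q\<close> are new, so an element of the
      next stage reveals whether its first coordinate contains \<open>q\<close>.\<close>
    have notin: "Exc (Base q) w \<notin> carrier ?P" for w
    proof
      assume "Exc (Base q) w \<in> carrier ?P"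
      then obtain U x where "exc qs U x = Exc (Base q) w" using car by fastforce
      then show False using exc_eq_Exc q(3) by blast
    qed
    have join: "(\<exists>j. least ?P j (Upper ?P {Base q, exc qs U x})) \<longleftrightarrow> (U, J {x, q}) \<in> pairs qs"
      if Ux: "(U, x) \<in> pairs qs" for U x
    proof -
      have xqE: "J {x, q} \<in> E" "x \<sqsubseteq> J {x, q}" "q \<sqsubseteq> J {x, q}"
        using ps[OF Ux] q by (auto intro: J_upper J_closed)
      have upper: "exc qs V y \<in> Upper ?P {Base q, exc qs U x} \<longleftrightarrow> U \<subseteq> V \<and> J {x, q} \<sqsubseteq> y"
        if Vy: "(V, y) \<in> pairs qs" for V y
      proof -
        have "exc qs V y \<in> carrier ?P" using car Vy by blast
        moreover have "{Base q, exc qs U x} \<subseteq> carrier ?P" using car Ux qp Bq by blast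
        ultimately show ?thesis
          using Bq_le[OF Vy] ord[OF Ux Vy] ps[OF Ux] ps[OF Vy] q
          by (subst J_le_iff) (auto simp: Upper_def)
      qed
      show ?thesis
      proof
        assume "\<exists>j. least ?P j (Upper ?P {Base q, exc qs U x})"
        then obtain j where j: "j \<in> Upper ?P {Base q, exc qs U x}" by (auto simp: least_def)
        then have "j \<in> carrier ?P" by (auto simp: Upper_def)
        then obtain V y where Vy: "j = exc qs V y" "(V, y) \<in> pairs qs" using car by blast
        then show "(U, J {x, q}) \<in> pairs qs"
          using upper[OF Vy(2)] j pairs_down[OF q(2) Vy(2)] xqE by auto
      next
        assume *: "(U, J {x, q}) \<in> pairs qs"
        have "least ?P (exc qs U (J {x, q})) (Upper ?P {Base q, exc qs U x})"
          unfolding least_def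
        proof (intro conjI ballI)
          show "Upper ?P {Base q, exc qs U x} \<subseteq> carrier ?P" by (auto simp: Upper_def)
          show "exc qs U (J {x, q}) \<in> Upper ?P {Base q, exc qs U x}"
            using upper[OF *] le_refl xqE by blast
          fix z assume z: "z \<in> Upper ?P {Base q, exc qs U x}"
          then have "z \<in> carrier ?P" by (auto simp: Upper_def)
          then obtain V y where Vy: "z = exc qs V y" "(V, y) \<in> pairs qs" using car by blast
          then show "exc qs U (J {x, q}) \<sqsubseteq>\<^bsub>?P\<^esub> z" using upper[OF Vy(2)] z ord[OF * Vy(2)] by simp
        qed
        then show "\<exists>j. least ?P j (Upper ?P {Base q, exc qs U x})" by blast
      qed
    qed
    have down: "(U, x) \<in> pairs qs" if "(U, J {x, q}) \<in> pairs qs" "x \<in> E" for U x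
      using pairs_down[OF q(2) that(1) subset_refl that(2)] that(2) q(1) by (auto intro: J_upper)
    have carrier: "carrier (blown (q # qs)) = {exc (q # qs) U x | U x. (U, x) \<in> pairs (q # qs)}"
    proof (intro subset_antisym subsetI)
      fix z assume "z \<in> carrier (blown (q # qs))"
      then consider "z \<in> carrier ?P" "\<not> Base q \<sqsubseteq>\<^bsub>?P\<^esub> z"
        | w where "z = Exc (Base q) w" "w \<in> carrier ?P" "\<not> Base q \<sqsubseteq>\<^bsub>?P\<^esub> w"
            "\<exists>j. least ?P j (Upper ?P {Base q, w})"
        by (auto simp: blowup_def)
      then show "z \<in> {exc (q # qs) U x | U x. (U, x) \<in> pairs (q # qs)}"
      proof cases
        case 1
        then obtain U x where Ux: "z = exc qs U x" "(U, x) \<in> pairs qs" using car by blast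
        then have "z = exc (q # qs) U x" "(U, x) \<in> pairs (q # qs)" using 1 ps(3)[OF Ux(2)] Bq_le by auto
        then show ?thesis by blast
      next
        case (2 w)
        then obtain U x where Ux: "w = exc qs U x" "(U, x) \<in> pairs qs" using car by blast
        then have "z = exc (q # qs) (insert q U) x" "(insert q U, x) \<in> pairs (q # qs)"
          using 2 ps[OF Ux(2)] Bq_le join q(3) exc_insert by auto
        then show ?thesis by blast
      qed
    next
      fix z assume "z \<in> {exc (q # qs) U x | U x. (U, x) \<in> pairs (q # qs)}"
      then obtain U x where z: "z = exc (q # qs) U x" "(U, x) \<in> pairs (q # qs)" by blast
      then consider "(U, x) \<in> pairs qs" "\<not> q \<sqsubseteq> x"
        | U' where "U = insert q U'" "(U', J {x, q}) \<in> pairs qs" "\<not> q \<sqsubseteq> x" "x \<in> E" by auto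
      then show "z \<in> carrier (blown (q # qs))"
      proof cases
        case 1
        then have "z = exc qs U x" using z(1) ps(3) by simp
        then show ?thesis using 1 car Bq_le by (auto simp: blowup_def)
      next
        case (2 U')
        have Ux: "(U', x) \<in> pairs qs" using down 2 by blast
        have "z = Exc (Base q) (exc qs U' x)" using z(1) 2 q(3) exc_insert by simp
        moreover have "exc qs U' x \<in> {w \<in> carrier ?P. \<not> Base q \<sqsubseteq>\<^bsub>?P\<^esub> w \<and> (\<exists>j. least ?P j (Upper ?P {Base q, w}))}"
          using 2 Ux car Bq_le[OF Ux] join[OF Ux] by blast
        ultimately show ?thesis by (simp add: blowup_def)
      qed
    qed
    have order: "exc (q # qs) U x \<sqsubseteq>\<^bsub>blown (q # qs)\<^esub> exc (q # qs) V y \<longleftrightarrow> U \<subseteq> V \<and> x \<sqsubseteq> y"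
      if Ux: "(U, x) \<in> pairs (q # qs)" and Vy: "(V, y) \<in> pairs (q # qs)" for U x V y
    proof -
      have repr: "(U - {q}, x) \<in> pairs qs \<and>
          exc (q # qs) U x = (if q \<in> U then Exc (Base q) (exc qs (U - {q}) x) else exc qs (U - {q}) x)"
        if Ux: "(U, x) \<in> pairs (q # qs)" for U x
      proof (cases "q \<in> U")
        case True
        then obtain U' where U': "U = insert q U'" "(U', J {x, q}) \<in> pairs qs" "x \<in> E" using Ux ps by auto
        then have "U - {q} = U'" using ps(3) by blast
        then show ?thesis using True U' down q(3) exc_insert by auto
      next
        case False
        then show ?thesis using Ux by auto
      qed
      have lt: "u \<sqsubseteq>\<^bsub>blown (q # qs)\<^esub> v \<longleftrightarrow> u \<in> carrier ?P \<and> v \<in> carrier ?P \<and> u \<sqsubseteq>\<^bsub>?P\<^esub> v \<or>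
         (\<exists>x y. u = Exc (Base q) x \<and> v = Exc (Base q) y \<and> x \<sqsubseteq>\<^bsub>?P\<^esub> y) \<or>
         (\<exists>y. u \<in> carrier ?P \<and> v = Exc (Base q) y \<and> u \<sqsubseteq>\<^bsub>?P\<^esub> y)" for u v
        by (simp add: blowup_def)
      note rU = repr[OF Ux] and rV = repr[OF Vy]
      let ?u = "exc qs (U - {q}) x" and ?v = "exc qs (V - {q}) y"
      have uP: "?u \<in> carrier ?P" and vP: "?v \<in> carrier ?P" using rU rV car by auto
      have nu: "?u \<noteq> Exc (Base q) w" and nv: "?v \<noteq> Exc (Base q) w" for w
        using uP vP notin by metis+
      have "exc (q # qs) U x \<sqsubseteq>\<^bsub>blown (q # qs)\<^esub> exc (q # qs) V y \<longleftrightarrow> (q \<in> U \<longrightarrow> q \<in> V) \<and> ?u \<sqsubseteq>\<^bsub>?P\<^esub> ?v"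
        unfolding lt conjunct2[OF rU] conjunct2[OF rV]
        using uP vP nu nv notin by auto
      also have "?u \<sqsubseteq>\<^bsub>?P\<^esub> ?v \<longleftrightarrow> U - {q} \<subseteq> V - {q} \<and> x \<sqsubseteq> y" using ord rU rV by blast
      also have "(q \<in> U \<longrightarrow> q \<in> V) \<and> (U - {q} \<subseteq> V - {q} \<and> x \<sqsubseteq> y) \<longleftrightarrow> U \<subseteq> V \<and> x \<sqsubseteq> y" by blast
      finally show ?thesis .
    qed
    show ?case using carrier order by blast
  qed
  then show ?C "\<And>U x V y. (U, x) \<in> pairs qs \<Longrightarrow> (V, y) \<in> pairs qs \<Longrightarrow> ?O U x V y" by blast+
qed


lemma pairs_singleton: "blowable qs \<Longrightarrow> q \<in> set qs \<Longrightarrow> ({q}, \<bottom>) \<in> pairs qs"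
proof (induction qs)
  case (Cons q' qs)
  have q': "q' \<in> E" "q' \<noteq> \<bottom>" "\<not> q' \<sqsubseteq> \<bottom>" using Cons.prems le_bot by auto
  show ?case
  proof (cases "q = q'")
    case True
    have "J {\<bottom>, q'} = q'" using q' bot_in bot_le le_refl by (intro J_eq_elemI) (auto intro: J_upper)
    then have "({}, J {\<bottom>, q'}) \<in> pairs qs" using Cons.prems pairs_empty[of qs q'] by auto
    then show ?thesis using True q' bot_in by auto
  next
    case False
    then show ?thesis using Cons q' by auto
  qed
qed simp

lemma blown_bottom: assumes "blowable qs" shows "\<bottom>\<^bsub>blown qs\<^esub> = Base \<bottom>"
proof -
  let ?P = "blown qs"
  note st = blown_structure[OF assms]
  have nb: "q \<noteq> \<bottom>" "q \<in> E" if "q \<in> set qs" for q using assms that by (induction qs) auto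
  have b: "({}, \<bottom>) \<in> pairs qs" using pairs_empty[OF assms] bot_in le_bot nb by blast
  have least: "least ?P (Base \<bottom>) (carrier ?P)"
    unfolding least_def
  proof (intro conjI ballI)
    show "Base \<bottom> \<in> carrier ?P" unfolding st(1) exc_empty[of qs \<bottom>, symmetric] using b by blast
    fix z assume "z \<in> carrier ?P"
    then obtain U x where z: "z = exc qs U x" "(U, x) \<in> pairs qs" using st(1) by blast
    then show "Base \<bottom> \<sqsubseteq>\<^bsub>?P\<^esub> z"
      using st(2)[OF b z(2)] exc_empty[of qs \<bottom>] pairs_subset[OF assms z(2)] bot_le by simp
  qed simp
  have "z = Base \<bottom>" if z: "least ?P z (carrier ?P)" for z
  proof -
    have "z \<in> carrier ?P" "z \<sqsubseteq>\<^bsub>?P\<^esub> Base \<bottom>" using z least by (auto simp: least_def)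
    then obtain U x where Ux: "z = exc qs U x" "(U, x) \<in> pairs qs" "exc qs U x \<sqsubseteq>\<^bsub>?P\<^esub> exc qs {} \<bottom>"
      using st(1) by (auto simp: exc_empty)
    then have "U = {}" "x \<sqsubseteq> \<bottom>" using st(2)[OF Ux(2) b] by auto
    then show ?thesis using Ux pairs_subset[OF assms Ux(2)] le_bot exc_empty by blast
  qed
  then show ?thesis unfolding bottom_def[of ?P] using least by (intro some_equality)
qed

section \<open>Atoms and flats of the iterated blowup\<close>

definition exc_atom :: "'a \<Rightarrow> 'a blowup_elt" where
  "exc_atom g = (if g \<in> At then Base g else Exc (Base g) (Base \<bottom>))"

lemma exc_atom_inj: "exc_atom g = exc_atom h \<Longrightarrow> g = h"
  by (auto simp: exc_atom_def split: if_splits)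

text \<open>The pair is \<open>({}, g)\<close> for an atom of \<open>L\<close> and
  \<open>({g}, \<bottom>)\<close> for a blown-up element, so the order above it is a test on a
  single coordinate.\<close>

lemma exc_atom_eq:
  assumes "blowable qs" "g \<in> At \<union> set qs"
  shows "\<exists>U x. exc_atom g = exc qs U x \<and> (U, x) \<in> pairs qs \<and>
    (\<forall>V y. y \<in> E \<longrightarrow> (U \<subseteq> V \<and> x \<sqsubseteq> y \<longleftrightarrow> (if g \<in> At then g \<sqsubseteq> y else g \<in> V)))"
proof -
  have q: "q \<notin> At" "q \<noteq> \<bottom>" "q \<in> E" if "q \<in> set qs" for q using assms(1) that by (induction qs) auto
  show ?thesis
  proof (cases "g \<in> At")
    case True
    have "\<not> p \<sqsubseteq> g" if "p \<in> set qs" for p using le_atom[OF True, of p] q[OF that] True by auto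
    then have "({}, g) \<in> pairs qs" using pairs_empty[OF assms(1)] True atom_in by blast
    then show ?thesis using True by (intro exI[of _ "{}"] exI[of _ g]) (auto simp: exc_atom_def exc_empty)
  next
    case False
    then have g: "g \<in> set qs" using assms by blast
    have "exc rs {g} \<bottom> = (if g \<in> set rs then Exc (Base g) (Base \<bottom>) else Base \<bottom>)" if "distinct rs" for rs
      using that by (induction rs) auto
    moreover have "distinct qs" using assms(1) by (induction qs) auto
    ultimately have "exc qs {g} \<bottom> = exc_atom g" using g False by (simp add: exc_atom_def)
    then show ?thesis using False pairs_singleton[OF assms(1) g] bot_le
      by (intro exI[of _ "{g}"] exI[of _ \<bottom>]) auto
  qed
qed

lemma exc_atom_le:
  assumes "blowable qs" "g \<in> At \<union> set qs" "(V, y) \<in> pairs qs"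
  shows "exc_atom g \<sqsubseteq>\<^bsub>blown qs\<^esub> exc qs V y \<longleftrightarrow> (if g \<in> At then g \<sqsubseteq> y else g \<in> V)"
proof -
  obtain U x where "exc_atom g = exc qs U x" "(U, x) \<in> pairs qs"
    "\<forall>V y. y \<in> E \<longrightarrow> (U \<subseteq> V \<and> x \<sqsubseteq> y \<longleftrightarrow> (if g \<in> At then g \<sqsubseteq> y else g \<in> V))"
    using exc_atom_eq[OF assms(1,2)] by blast
  then show ?thesis using blown_structure(2)[OF assms(1) _ assms(3)] pairs_subset[OF assms(1,3)] by simp
qed

lemma exc_inj:
  assumes qs: "blowable qs" and "(U, x) \<in> pairs qs" "(V, y) \<in> pairs qs" "exc qs U x = exc qs V y"
  shows "U = V \<and> x = y"
proof -
  have E: "x \<in> E" "y \<in> E" using assms pairs_subset by blast+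
  have "U \<subseteq> V \<and> x \<sqsubseteq> y" using blown_structure(2)[OF qs, of U x] assms le_refl[OF E(1)] by (metis order_refl)
  moreover have "V \<subseteq> U \<and> y \<sqsubseteq> x" using blown_structure(2)[OF qs, of V y] assms le_refl[OF E(2)] by (metis order_refl)
  ultimately show ?thesis using E le_antisym by blast
qed

lemma blown_atoms:
  assumes "blowable qs" shows "atoms (blown qs) = exc_atom ` (At \<union> set qs)"
proof -
  let ?P = "blown qs"
  note st = blown_structure[OF assms]
  have q: "q \<notin> At" "q \<noteq> \<bottom>" "q \<in> E" if "q \<in> set qs" for q using assms that by (induction qs) auto
  have b: "({}, \<bottom>) \<in> pairs qs" using pairs_empty[OF assms] bot_in le_bot q by blast
  have bE: "Base \<bottom> = exc qs {} \<bottom>" by (simp add: exc_empty)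
  have Vset: "V \<inter> At = {}" if "(V, y) \<in> pairs qs" for V y using pairs_subset[OF assms that] q by blast
  show ?thesis
  proof (intro subset_antisym subsetI)
    fix z assume "z \<in> atoms ?P"
    then have z: "z \<in> carrier ?P" "z \<noteq> Base \<bottom>" 
      "\<And>w. w \<in> carrier ?P \<Longrightarrow> w \<sqsubseteq>\<^bsub>?P\<^esub> z \<Longrightarrow> w = Base \<bottom> \<or> w = z"
      using blown_bottom[OF assms] by (auto simp: atoms_def)
    then obtain V y where Vy: "z = exc qs V y" "(V, y) \<in> pairs qs" using st(1) by blast
    have "V \<noteq> {} \<or> y \<noteq> \<bottom>" using z(2) Vy bE by metis
    then obtain g where g: "g \<in> At \<union> set qs" "if g \<in> At then g \<sqsubseteq> y else g \<in> V"
    proof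
      assume "V \<noteq> {}"
      then obtain v where "v \<in> V" by blast
      moreover from this have "v \<notin> At" "v \<in> set qs"
        using pairs_subset[OF assms Vy(2)] Vset[OF Vy(2)] by auto
      ultimately show thesis using that[of v] by simp
    next
      assume "y \<noteq> \<bottom>"
      then obtain a where "a \<in> At" "a \<sqsubseteq> y" using ex_atom pairs_subset[OF assms Vy(2)] by blast
      then show thesis using that[of a] by auto
    qed
    have "exc_atom g \<sqsubseteq>\<^bsub>?P\<^esub> z" using exc_atom_le[OF assms g(1) Vy(2)] g(2) Vy(1) by simp
    moreover have "exc_atom g \<in> carrier ?P" using exc_atom_eq[OF assms g(1)] st(1) by blast
    moreover have "exc_atom g \<noteq> Base \<bottom>" using atom_not_bot by (auto simp: exc_atom_def)
    ultimately have "z = exc_atom g" using z(3) by metis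
    then show "z \<in> exc_atom ` (At \<union> set qs)" using g(1) by blast
  next
    fix z assume "z \<in> exc_atom ` (At \<union> set qs)"
    then obtain g where g: "g \<in> At \<union> set qs" "z = exc_atom g" by blast
    then obtain U x where Ux: "z = exc qs U x" "(U, x) \<in> pairs qs"
      using exc_atom_eq[OF assms g(1)] by blast
    have gUx: "if g \<in> At then g \<sqsubseteq> x else g \<in> U"
      using exc_atom_le[OF assms g(1) Ux(2)] st(2)[OF Ux(2) Ux(2)] g Ux le_refl pairs_subset[OF assms Ux(2)] by auto
    have "z \<in> carrier ?P" using Ux st(1) by blast
    moreover have "z \<noteq> Base \<bottom>" using atom_not_bot g by (auto simp: exc_atom_def)
    moreover have "w = Base \<bottom> \<or> w = z" if w: "w \<in> carrier ?P" "w \<sqsubseteq>\<^bsub>?P\<^esub> z" for w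
    proof (rule disjCI)
      assume wz: "w \<noteq> z"
      obtain V y where Vy: "w = exc qs V y" "(V, y) \<in> pairs qs" using w st(1) by blast
      have le: "V \<subseteq> U" "y \<sqsubseteq> x" using w Vy st(2)[OF Vy(2) Ux(2)] Ux by auto
      have E: "y \<in> E" "x \<in> E" using pairs_subset[OF assms] Vy Ux by blast+
      have n: "\<not> (if g \<in> At then g \<sqsubseteq> y else g \<in> V)"
      proof
        assume "if g \<in> At then g \<sqsubseteq> y else g \<in> V"
        then have "exc qs U x \<sqsubseteq>\<^bsub>?P\<^esub> exc qs V y" using exc_atom_le[OF assms g(1) Vy(2)] g(2) Ux(1) by simp
        then have "U = V" "x = y" using st(2)[OF Ux(2) Vy(2)] le E le_antisym by auto
        then show False using wz Ux Vy by simp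
      qed
      have "U = (if g \<in> At then {} else {g}) \<and> x = (if g \<in> At then g else \<bottom>)"
      proof -
        obtain U' x' where U'x': "exc_atom g = exc qs U' x'" "(U', x') \<in> pairs qs"
          "\<And>V y. y \<in> E \<Longrightarrow> (U' \<subseteq> V \<and> x' \<sqsubseteq> y \<longleftrightarrow> (if g \<in> At then g \<sqsubseteq> y else g \<in> V))"
          using exc_atom_eq[OF assms g(1)] by blast
        then have eq: "U' = U" "x' = x" using exc_inj[OF assms U'x'(2) Ux(2)] g Ux by auto
        show ?thesis
        proof (cases "g \<in> At")
          case True
          then have "U \<subseteq> {}" "x \<sqsubseteq> g" "g \<sqsubseteq> x" using U'x'(3)[of g "{}"] gUx eq atom_in le_refl by auto
          then show ?thesis using True E atom_in le_antisym by auto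
        next
          case False
          then have "U \<subseteq> {g}" "x \<sqsubseteq> \<bottom>" "g \<in> U" using U'x'(3)[of \<bottom> "{g}"] gUx eq bot_in by auto
          then show ?thesis using False E le_bot by auto
        qed
      qed
      then have "V = {} \<and> y = \<bottom>"
        using n le E le_atom[of g y] le_bot[of y] atom_in by (auto split: if_splits)
      then show "w = Base \<bottom>" using Vy bE by simp
    qed
    ultimately show "z \<in> atoms ?P" using blown_bottom[OF assms] by (auto simp: atoms_def)
  qed
qed

text \<open>These are the flats of the direct sum of the matroid of \<open>L\<close> below
  \<open>y\<close> and the free matroid on \<open>V\<close>.\<close>

lemma blown_flats:
  assumes qs: "blowable qs" and Vy: "(V, y) \<in> pairs qs"
  shows "interval_flats (blown qs) (exc qs V y) =
    (\<lambda>(U, x). exc_atom ` (below x \<union> U)) ` {(U, x). U \<subseteq> V \<and> x \<in> E \<and> x \<sqsubseteq> y}"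
proof -
  let ?P = "blown qs"
  note st = blown_structure[OF qs]
  have q: "q \<notin> At" if "q \<in> set qs" for q using qs that by (induction qs) auto
  have At: "{a \<in> atoms ?P. a \<sqsubseteq>\<^bsub>?P\<^esub> exc qs U x} = exc_atom ` (below x \<union> U)" if Ux: "(U, x) \<in> pairs qs" for U x
    using exc_atom_le[OF qs _ Ux] pairs_subset[OF qs Ux] q
    unfolding blown_atoms[OF qs] below_def by (auto split: if_splits)
  have "{z \<in> carrier ?P. z \<sqsubseteq>\<^bsub>?P\<^esub> exc qs V y} = (\<lambda>(U, x). exc qs U x) ` {(U, x). U \<subseteq> V \<and> x \<in> E \<and> x \<sqsubseteq> y}"
  proof (intro subset_antisym subsetI)
    fix z assume "z \<in> {z \<in> carrier ?P. z \<sqsubseteq>\<^bsub>?P\<^esub> exc qs V y}"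
    then have z: "z \<in> carrier ?P" "z \<sqsubseteq>\<^bsub>?P\<^esub> exc qs V y" by auto
    then obtain U x where "z = exc qs U x" "(U, x) \<in> pairs qs" using st(1) by blast
    moreover from this have "exc qs U x \<sqsubseteq>\<^bsub>?P\<^esub> exc qs V y" using z by simp
    ultimately show "z \<in> (\<lambda>(U, x). exc qs U x) ` {(U, x). U \<subseteq> V \<and> x \<in> E \<and> x \<sqsubseteq> y}"
      using st(2)[OF _ Vy] pairs_subset[OF qs] by (intro image_eqI[of _ _ "(U, x)"]) auto
  next
    fix z assume "z \<in> (\<lambda>(U, x). exc qs U x) ` {(U, x). U \<subseteq> V \<and> x \<in> E \<and> x \<sqsubseteq> y}"
    then obtain U x where z: "z = exc qs U x" "U \<subseteq> V" "x \<in> E" "x \<sqsubseteq> y" by auto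
    then have "(U, x) \<in> pairs qs" using pairs_down[OF qs Vy] by blast
    then show "z \<in> {z \<in> carrier ?P. z \<sqsubseteq>\<^bsub>?P\<^esub> exc qs V y}" using z st(1) st(2)[OF _ Vy] by blast
  qed
  then have "interval_flats ?P (exc qs V y) =
      (\<lambda>z. {a \<in> atoms ?P. a \<sqsubseteq>\<^bsub>?P\<^esub> z}) ` (\<lambda>(U, x). exc qs U x) ` {(U, x). U \<subseteq> V \<and> x \<in> E \<and> x \<sqsubseteq> y}"
    unfolding interval_flats_def by (simp only:)
  also have "\<dots> = (\<lambda>(U, x). exc_atom ` (below x \<union> U)) ` {(U, x). U \<subseteq> V \<and> x \<in> E \<and> x \<sqsubseteq> y}"
    unfolding image_image
  proof (rule image_cong[OF refl])
    fix s assume "s \<in> {(U, x). U \<subseteq> V \<and> x \<in> E \<and> x \<sqsubseteq> y}"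
    then obtain U x where s: "s = (U, x)" "U \<subseteq> V" "x \<in> E" "x \<sqsubseteq> y" by auto
    then show "{a \<in> atoms ?P. a \<sqsubseteq>\<^bsub>?P\<^esub> (case s of (U, x) \<Rightarrow> exc qs U x)} = (case s of (U, x) \<Rightarrow> exc_atom ` (below x \<union> U))"
      using At[OF pairs_down[OF qs Vy s(2-4)]] by simp
  qed
  finally show ?thesis .
qed

end

lemma Upper_iff: "A \<subseteq> carrier P \<Longrightarrow> z \<in> carrier P \<Longrightarrow> z \<in> Upper P A \<longleftrightarrow> (\<forall>a\<in>A. a \<sqsubseteq>\<^bsub>P\<^esub> z)"
  unfolding Upper_def by blast

context geom_lattice begin

text \<open>In the direct sum the elements of \<open>V\<close> are coloops, so no circuit meets
  them.\<close>

lemma interval_circuit_iff: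
  assumes qs: "blowable qs" and Vy: "(V, y) \<in> pairs qs"
  shows "interval_circuit (blown qs) (exc qs V y) (exc_atom ` C) \<longleftrightarrow> circuit C \<and> C \<subseteq> below y"
proof -
  let ?F = "(\<lambda>(U, x). exc_atom ` (below x \<union> U)) ` {(U, x). U \<subseteq> V \<and> x \<in> E \<and> x \<sqsubseteq> y}"
  have yE: "y \<in> E" using Vy pairs_subset[OF qs] by blast
  have V: "V \<inter> At = {}"
  proof -
    have "q \<notin> At" if "q \<in> set qs" for q using qs that by (induction qs) auto
    then show ?thesis using pairs_subset[OF qs Vy] by blast
  qed
  have mem: "exc_atom a \<in> exc_atom ` X \<longleftrightarrow> a \<in> X" for a X using exc_atom_inj by blast
  have img: "exc_atom ` X \<subseteq> exc_atom ` Y \<longleftrightarrow> X \<subseteq> Y" for X Y using exc_atom_inj by blast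
  have "\<Union> ?F = exc_atom ` (below y \<union> V)"
  proof (rule subset_antisym)
    have "below x \<subseteq> below y" if "x \<in> E" "x \<sqsubseteq> y" for x using le_iff_below[OF that(1) yE] that by blast
    then show "\<Union> ?F \<subseteq> exc_atom ` (below y \<union> V)" by auto
    show "exc_atom ` (below y \<union> V) \<subseteq> \<Union> ?F"
      using yE le_refl by (intro Union_upper image_eqI[of _ _ "(V, y)"]) auto
  qed
  then have ground: "exc_atom ` B \<subseteq> \<Union> ?F \<longleftrightarrow> B \<subseteq> below y \<union> V" for B using img by simp
  have notcl: "exc_atom a \<notin> flat_closure ?F (exc_atom ` B) \<longleftrightarrow> (\<exists>U x. U \<subseteq> V \<and> x \<in> E \<and> x \<sqsubseteq> y \<and> B \<subseteq> below x \<union> U \<and> a \<notin> below x \<union> U)" for a B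
    unfolding flat_closure_def using mem img by auto
  have ind: "flat_indep ?F (exc_atom ` B) \<longleftrightarrow> B \<subseteq> below y \<union> V \<and> indep (B \<inter> At)" for B
  proof -
    have img_diff: "exc_atom ` B - {exc_atom a} = exc_atom ` (B - {a})" for a using exc_atom_inj by blast
    have "flat_indep ?F (exc_atom ` B) \<longleftrightarrow> B \<subseteq> below y \<union> V \<and>
      (\<forall>a\<in>B. \<exists>U x. U \<subseteq> V \<and> x \<in> E \<and> x \<sqsubseteq> y \<and> B - {a} \<subseteq> below x \<union> U \<and> a \<notin> below x \<union> U)"
      unfolding flat_indep_def ground by (simp only: ball_simps img_diff notcl)
    also have "\<dots> \<longleftrightarrow> B \<subseteq> below y \<union> V \<and> indep (B \<inter> At)"
    proof (intro conj_cong refl)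
      assume B: "B \<subseteq> below y \<union> V"
      have BE: "B \<inter> At - {a} \<subseteq> E" for a using At_E by blast
      show "(\<forall>a\<in>B. \<exists>U x. U \<subseteq> V \<and> x \<in> E \<and> x \<sqsubseteq> y \<and> B - {a} \<subseteq> below x \<union> U \<and> a \<notin> below x \<union> U) \<longleftrightarrow> indep (B \<inter> At)"
        unfolding indep_def
      proof (intro iffI ballI)
        fix a assume all: "\<forall>a\<in>B. \<exists>U x. U \<subseteq> V \<and> x \<in> E \<and> x \<sqsubseteq> y \<and> B - {a} \<subseteq> below x \<union> U \<and> a \<notin> below x \<union> U"
          and a: "a \<in> B \<inter> At"
        from all a obtain U x where Ux: "U \<subseteq> V" "x \<in> E" "B - {a} \<subseteq> below x \<union> U" "a \<notin> below x" by blast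
        have "J (B \<inter> At - {a}) \<sqsubseteq> x" using Ux V BE[of a] by (subst J_le_iff) (auto simp: below_def)
        then show "\<not> a \<sqsubseteq> J (B \<inter> At - {a})"
          using Ux a atom_in J_closed[OF BE] le_trans[of a "J (B \<inter> At - {a})" x] by (auto simp: below_def)
      next
        fix a assume all: "\<forall>a\<in>B \<inter> At. \<not> a \<sqsubseteq> J (B \<inter> At - {a})" and a: "a \<in> B"
        show "\<exists>U x. U \<subseteq> V \<and> x \<in> E \<and> x \<sqsubseteq> y \<and> B - {a} \<subseteq> below x \<union> U \<and> a \<notin> below x \<union> U"
        proof (cases "a \<in> At")
          case True
          have "J (B \<inter> At - {a}) \<sqsubseteq> y" using BE[of a] yE B V by (subst J_le_iff) (auto simp: below_def)
          moreover have "B - {a} \<subseteq> below (J (B \<inter> At - {a})) \<union> (B - At)"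
            using BE[of a] by (auto simp: below_def intro: J_upper)
          moreover have "a \<notin> below (J (B \<inter> At - {a})) \<union> (B - At)" using True a all by (auto simp: below_def)
          moreover have "B - At \<subseteq> V" using B by (auto simp: below_def)
          ultimately show ?thesis using J_closed[OF BE[of a]] by blast
        next
          case False
          then show ?thesis using B yE le_refl by (intro exI[of _ "V - {a}"] exI[of _ y]) (auto simp: below_def)
        qed
      qed
    qed
    finally show ?thesis .
  qed
  have sub: "D \<subset> exc_atom ` C \<longleftrightarrow> (\<exists>B. B \<subset> C \<and> D = exc_atom ` B)" for D
  proof
    assume D: "D \<subset> exc_atom ` C"
    then obtain B where B: "B \<subseteq> C" "D = exc_atom ` B" by (meson psubset_imp_subset subset_image_iff)
    then have "B \<noteq> C" using D by blast
    then show "\<exists>B. B \<subset> C \<and> D = exc_atom ` B" using B by blast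
  next
    assume "\<exists>B. B \<subset> C \<and> D = exc_atom ` B"
    then obtain B where B: "B \<subset> C" "D = exc_atom ` B" by blast
    then obtain c where "c \<in> C" "c \<notin> B" by blast
    then have "exc_atom c \<in> exc_atom ` C" "exc_atom c \<notin> D" using B(2) mem by auto
    then show "D \<subset> exc_atom ` C" using B by blast
  qed
  have all: "(\<forall>D. D \<subset> exc_atom ` C \<longrightarrow> flat_indep ?F D) \<longleftrightarrow> (\<forall>B. B \<subset> C \<longrightarrow> flat_indep ?F (exc_atom ` B))"
    unfolding sub by blast
  have "interval_circuit (blown qs) (exc qs V y) (exc_atom ` C) \<longleftrightarrow>
      C \<subseteq> below y \<union> V \<and> \<not> indep (C \<inter> At) \<and> (\<forall>B. B \<subset> C \<longrightarrow> indep (B \<inter> At))"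
    unfolding interval_circuit_def blown_flats[OF qs Vy] flat_circuit_def ground all ind by blast
  also have "\<dots> \<longleftrightarrow> circuit C \<and> C \<subseteq> below y"
  proof
    assume *: "C \<subseteq> below y \<union> V \<and> \<not> indep (C \<inter> At) \<and> (\<forall>B. B \<subset> C \<longrightarrow> indep (B \<inter> At))"
    \<comment> \<open>\<open>C \<inter> At\<close> is dependent, whereas the atoms of every proper
      subset of \<open>C\<close> are independent.\<close>
    then have "\<not> C \<inter> At \<subset> C" by (metis Int_assoc Int_absorb)
    then have "C \<subseteq> At" by blast
    then show "circuit C \<and> C \<subseteq> below y" using * V by (auto simp: circuit_def Int_absorb2)
  next
    assume "circuit C \<and> C \<subseteq> below y"
    then show "C \<subseteq> below y \<union> V \<and> \<not> indep (C \<inter> At) \<and> (\<forall>B. B \<subset> C \<longrightarrow> indep (B \<inter> At))"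
      by (auto simp: circuit_def Int_absorb2)
  qed
  finally show ?thesis .
qed

text \<open>Any upper bound \<open>(V, y)\<close> of a circuit can be lowered to
  \<open>({}, J C)\<close>. This pair is present exactly when no blown-up element lies below
  \<open>J C\<close>, and it is then the join; so arbitrary upper bounds and the join give the same
  condition.\<close>

lemma circuit_upper_iff:
  assumes qs: "blowable qs" and C: "C \<subseteq> At \<union> set qs"
  shows "(\<exists>j x. least (blown qs) j (Upper (blown qs) (exc_atom ` C)) \<and> x \<in> carrier (blown qs) \<and> j \<sqsubseteq>\<^bsub>blown qs\<^esub> x \<and>
      interval_circuit (blown qs) x (exc_atom ` C)) \<longleftrightarrow> circuit C \<and> (\<forall>q\<in>set qs. \<not> q \<sqsubseteq> J C)" (is "?l \<longleftrightarrow> ?r")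
    and "(\<exists>j. least (blown qs) j (Upper (blown qs) (exc_atom ` C)) \<and>
      interval_circuit (blown qs) j (exc_atom ` C)) \<longleftrightarrow> circuit C \<and> (\<forall>q\<in>set qs. \<not> q \<sqsubseteq> J C)" (is "?l' \<longleftrightarrow> _")
proof -
  let ?P = "blown qs"
  note st = blown_structure[OF qs]
  have imp1: "?l' \<Longrightarrow> ?l"
  proof -
    assume ?l'
    then obtain j where j: "least ?P j (Upper ?P (exc_atom ` C))" "interval_circuit ?P j (exc_atom ` C)" by blast
    then have "j \<in> carrier ?P" by (auto simp: least_def Upper_def)
    moreover from this obtain U x where "j = exc qs U x" "(U, x) \<in> pairs qs" using st(1) by blast
    then have "j \<sqsubseteq>\<^bsub>?P\<^esub> j" using st(2) pairs_subset[OF qs] le_refl by blast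
    ultimately show ?l using j by blast
  qed
  have imp2: "?l \<Longrightarrow> ?r"
  proof -
    assume ?l
    then obtain x where x: "x \<in> carrier ?P" "interval_circuit ?P x (exc_atom ` C)" by blast
    then obtain V y where Vy: "x = exc qs V y" "(V, y) \<in> pairs qs" using st(1) by blast
    then have C: "circuit C" "C \<subseteq> below y" using x interval_circuit_iff[OF qs Vy(2)] by auto
    have yE: "y \<in> E" using pairs_subset[OF qs Vy(2)] by blast
    have CE: "C \<subseteq> E" using C below_subset by blast
    have "J C \<sqsubseteq> y" using C yE CE by (subst J_le_iff) (auto simp: below_def)
    then have "({}, J C) \<in> pairs qs" using pairs_down[OF qs Vy(2)] J_closed[OF CE] by blast
    then show ?r using C pairs_empty[OF qs] by blast
  qed
  have imp3: "?r \<Longrightarrow> ?l'"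
  proof -
    assume r: ?r
    have CA: "C \<subseteq> At" "C \<subseteq> E" using r At_E by (auto simp: circuit_def)
    have JC: "({}, J C) \<in> pairs qs" using r pairs_empty[OF qs] J_closed[OF CA(2)] by blast
    have "exc_atom ` C \<subseteq> atoms ?P" unfolding blown_atoms[OF qs] using C by (rule image_mono)
    moreover have "atoms ?P \<subseteq> carrier ?P" unfolding atoms_def by blast
    ultimately have car: "exc_atom ` C \<subseteq> carrier ?P" by (rule subset_trans)
    have up: "exc qs V y \<in> Upper ?P (exc_atom ` C) \<longleftrightarrow> J C \<sqsubseteq> y" if Vy: "(V, y) \<in> pairs qs" for V y
    proof -
      have "exc qs V y \<in> carrier ?P" unfolding st(1) using Vy by blast
      then have "exc qs V y \<in> Upper ?P (exc_atom ` C) \<longleftrightarrow> (\<forall>c\<in>C. exc_atom c \<sqsubseteq>\<^bsub>?P\<^esub> exc qs V y)"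
        by (simp only: Upper_iff[OF car] ball_simps)
      also have "\<dots> \<longleftrightarrow> (\<forall>c\<in>C. c \<sqsubseteq> y)"
      proof (rule ball_cong[OF refl])
        fix c assume "c \<in> C"
        then have "c \<in> At" using CA by blast
        then show "exc_atom c \<sqsubseteq>\<^bsub>?P\<^esub> exc qs V y \<longleftrightarrow> c \<sqsubseteq> y" using exc_atom_le[OF qs _ Vy, of c] by simp
      qed
      also have "\<dots> \<longleftrightarrow> J C \<sqsubseteq> y" using J_le_iff[OF CA(2), of y] pairs_subset[OF qs Vy] by simp
      finally show ?thesis .
    qed
    have "least ?P (exc qs {} (J C)) (Upper ?P (exc_atom ` C))"
      unfolding least_def
    proof (intro conjI ballI)
      show "Upper ?P (exc_atom ` C) \<subseteq> carrier ?P" by (auto simp: Upper_def)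
      show "exc qs {} (J C) \<in> Upper ?P (exc_atom ` C)" using up[OF JC] J_closed[OF CA(2)] le_refl by blast
      fix z assume z: "z \<in> Upper ?P (exc_atom ` C)"
      then have "z \<in> carrier ?P" by (auto simp: Upper_def)
      then obtain V y where Vy: "z = exc qs V y" "(V, y) \<in> pairs qs" using st(1) by blast
      then show "exc qs {} (J C) \<sqsubseteq>\<^bsub>?P\<^esub> z" using up[OF Vy(2)] st(2)[OF JC Vy(2)] z by simp
    qed
    moreover have "interval_circuit ?P (exc qs {} (J C)) (exc_atom ` C)"
      using interval_circuit_iff[OF qs JC] r CA J_upper[OF CA(2)] by (auto simp: below_def)
    ultimately show ?l' by blast
  qed
  show "?l \<longleftrightarrow> ?r" "?l' \<longleftrightarrow> ?r" using imp1 imp2 imp3 by blast+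
qed

end

section \<open>The blowup sequence, and circuits translated back to the lattice\<close>

lemma linear_order_sorted_list:
  assumes r: "linear_order_on H r" and "finite A" "A \<subseteq> H"
  shows "\<exists>!ps. set ps = A \<and> distinct ps \<and> sorted_wrt (\<lambda>p q. (p, q) \<in> r) ps"
  using assms(2,3)
proof (induction "card A" arbitrary: A)
  case 0
  then show ?case by auto
next
  case (Suc n)
  have min: "\<exists>m\<in>B. \<forall>b\<in>B. (m, b) \<in> r" if "finite B" "B \<noteq> {}" "B \<subseteq> H" for B
    using that
  proof (induction B rule: finite_ne_induct)
    case (singleton x)
    then show ?case using r by (auto simp: order_on_defs refl_on_def)
  next
    case (insert x F)
    then obtain m where m: "m \<in> F" "\<forall>b\<in>F. (m, b) \<in> r" by auto
    have refl: "(x, x) \<in> r" using r insert.prems by (auto simp: order_on_defs refl_on_def)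
    have "(m, x) \<in> r \<or> (x, m) \<in> r" using r insert m unfolding order_on_defs total_on_def by (metis insertI1 insert_subset subsetD)
    then show ?case
    proof
      assume "(x, m) \<in> r"
      moreover have "trans r" using r by (simp add: order_on_defs)
      ultimately have "\<forall>b\<in>F. (x, b) \<in> r" using m by (blast dest: transD)
      then show ?thesis using refl by blast
    qed (use m in blast)
  qed
  have "A \<noteq> {}" using Suc.hyps(2) by auto
  then obtain m where m: "m \<in> A" "\<forall>b\<in>A. (m, b) \<in> r" using min Suc.prems by blast
  have anti: "x = y" if "(x, y) \<in> r" "(y, x) \<in> r" for x y
    using r that by (auto simp: order_on_defs antisym_def)
  have "n = card (A - {m})" "finite (A - {m})" "A - {m} \<subseteq> H" using Suc m by auto
  then obtain ps where ps: "set ps = A - {m}" "distinct ps" "sorted_wrt (\<lambda>p q. (p, q) \<in> r) ps"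
    and uniq: "\<And>qs. set qs = A - {m} \<Longrightarrow> distinct qs \<Longrightarrow> sorted_wrt (\<lambda>p q. (p, q) \<in> r) qs \<Longrightarrow> qs = ps"
    using Suc.hyps(1) by metis
  show ?case
  proof (rule ex1I[of _ "m # ps"])
    show "set (m # ps) = A \<and> distinct (m # ps) \<and> sorted_wrt (\<lambda>p q. (p, q) \<in> r) (m # ps)"
      using ps m by auto
    fix qs assume qs: "set qs = A \<and> distinct qs \<and> sorted_wrt (\<lambda>p q. (p, q) \<in> r) qs"
    then obtain q qs' where q: "qs = q # qs'" using m by (cases qs) auto
    have "q = m"
    proof (rule ccontr)
      assume "q \<noteq> m"
      then have "m \<in> set qs'" using qs q m by auto
      then have "(q, m) \<in> r" using qs q by auto
      moreover have "(m, q) \<in> r" using m qs q by auto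
      ultimately show False using anti \<open>q \<noteq> m\<close> by blast
    qed
    then show "qs = m # ps" using uniq[of qs'] qs q by auto
  qed
qed

context building begin

lemma iterated_blowup_eq:
  assumes H: "pbs H" and r: "compatible_order L H r"
  obtains qs where "blowable qs" "set qs = H - At" "iterated_blowup L H r = blown qs"
proof -
  let ?ps = "blowup_seq L H r"
  have lin: "linear_order_on H r" and comp: "\<And>p q. p \<in> H \<Longrightarrow> q \<in> H \<Longrightarrow> q \<sqsubseteq> p \<Longrightarrow> (p, q) \<in> r"
    using r by (auto simp: compatible_order_def)
  have anti: "x = y" if "(x, y) \<in> r" "(y, x) \<in> r" for x y
    using lin that by (auto simp: order_on_defs antisym_def)
  have "set ?ps = H - At \<and> distinct ?ps \<and> sorted_wrt (\<lambda>p q. (p, q) \<in> r) ?ps"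
    unfolding blowup_seq_def
    by (rule theI', rule linear_order_sorted_list[OF lin]) (use pbs_finite[OF H] in auto)
  then have ps: "set ?ps = H - At" "distinct ?ps" "sorted_wrt (\<lambda>p q. (p, q) \<in> r) ?ps" by auto
  have "blowable qs" if "set qs \<subseteq> H - At" "distinct qs" "sorted_wrt (\<lambda>p q. (q, p) \<in> r) qs" for qs
    using that
  proof (induction qs)
    case (Cons q qs)
    \<comment> \<open>\<open>p\<close> strictly precedes \<open>q\<close>, whereas
      \<open>p \<sqsubseteq> q\<close> would make \<open>q\<close> precede \<open>p\<close>.\<close>
    have "\<not> p \<sqsubseteq> q" if p: "p \<in> set qs" for p
      using comp[of q p] anti[of p q] Cons.prems p by auto
    then show ?case using Cons pbs_E[OF H] pbs_bot[OF H] by auto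
  qed simp
  moreover have "sorted_wrt (\<lambda>p q. (q, p) \<in> r) (rev ?ps)" using ps(3) by (simp add: sorted_wrt_rev)
  ultimately have "blowable (rev ?ps)" using ps by simp
  moreover have "iterated_blowup L H r = blown (rev ?ps)"
    by (simp add: iterated_blowup_def foldr_conv_fold rev_map)
  ultimately show thesis using that[of "rev ?ps"] ps by simp
qed

lemma circuit_no_larger:
  assumes H: "pbs H" and S: "nested H S" "S \<subseteq> At" and q: "q \<in> H - At"
  shows "\<not> q \<sqsubseteq> J S"
  using nested_atoms[OF H S(1) q] S(2) by (simp add: Int_absorb2)

text \<open>Nestedness already keeps every non-atom of \<open>H\<close> from lying below a join of
  atoms of \<open>S\<close>, so the blowup adds no further condition.\<close>

lemma nested_circuit_iff:
  assumes H: "pbs H" and r: "compatible_order L H r"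
  shows "nested_circuit L H r S \<longleftrightarrow> S \<in> nested_sets L H \<and> circuit S"
proof -
  obtain qs where qs: "blowable qs" "set qs = H - At" "iterated_blowup L H r = blown qs"
    by (rule iterated_blowup_eq[OF H r])
  have ba: "blowup_atom L = exc_atom" by (auto simp: blowup_atom_def exc_atom_def)
  have AH: "At \<union> set qs = H" using qs pbs_At[OF H] by blast
  show ?thesis
  proof (cases "S \<in> nested_sets L H")
    case True
    then have S: "S \<subseteq> H" "nested H S" using nested_sets_eq[OF H] by auto
    have "nested_circuit L H r S \<longleftrightarrow> circuit S \<and> (\<forall>q\<in>set qs. \<not> q \<sqsubseteq> J S)"
      unfolding nested_circuit_def Let_def ba qs(3)
      using True circuit_upper_iff(2)[OF qs(1), of S] S(1) unfolding AH by blast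
    moreover have "\<not> q \<sqsubseteq> J S" if "circuit S" "q \<in> set qs" for q
      using circuit_no_larger[OF H S(2)] that qs(2) by (auto simp: circuit_def)
    ultimately show ?thesis using True by blast
  qed (simp add: nested_circuit_def)
qed

text \<open>The extra element satisfies \<open>J (insert g S) = J S\<close>, so nestedness of
  \<open>S\<close> alone ensures that the whole circuit is bounded in the blowup.\<close>

lemma broken_circuit_iff:
  assumes H: "pbs H" and r: "compatible_order L H r"
  shows "broken_circuit L H r S \<longleftrightarrow> S \<in> nested_sets L H \<and> S \<noteq> {} \<and>
    (\<exists>g\<in>H. (\<forall>s\<in>S. (g, s) \<in> r \<and> g \<noteq> s) \<and> circuit (insert g S))"
proof -
  obtain qs where qs: "blowable qs" "set qs = H - At" "iterated_blowup L H r = blown qs"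
    by (rule iterated_blowup_eq[OF H r])
  have ba: "blowup_atom L = exc_atom" by (auto simp: blowup_atom_def exc_atom_def)
  have AH: "At \<union> set qs = H" using qs pbs_At[OF H] by blast
  show ?thesis
  proof (cases "S \<in> nested_sets L H")
    case True
    then have S: "S \<subseteq> H" "nested H S" using nested_sets_eq[OF H] by auto
    have "(\<exists>j x. least (blown qs) j (Upper (blown qs) (exc_atom ` insert g S)) \<and> x \<in> carrier (blown qs) \<and>
        j \<sqsubseteq>\<^bsub>blown qs\<^esub> x \<and> interval_circuit (blown qs) x (exc_atom ` insert g S)) \<longleftrightarrow> circuit (insert g S)"
      (is "?l \<longleftrightarrow> _") if g: "g \<in> H" "\<forall>s\<in>S. (g, s) \<in> r \<and> g \<noteq> s" for g
    proof -
      have "g \<notin> S" using g by blast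
      have "\<not> q \<sqsubseteq> J (insert g S)" if c: "circuit (insert g S)" and q: "q \<in> set qs" for q
      proof -
        have "J (insert g S) = J S" using circuit_J[OF c, of g] \<open>g \<notin> S\<close> by simp
        moreover have "\<not> q \<sqsubseteq> J S"
          using circuit_no_larger[OF H S(2)] q c qs(2) by (auto simp: circuit_def)
        ultimately show ?thesis by simp
      qed
      moreover have "?l \<longleftrightarrow> circuit (insert g S) \<and> (\<forall>q\<in>set qs. \<not> q \<sqsubseteq> J (insert g S))"
        by (rule circuit_upper_iff(1)[OF qs(1)]) (use S g AH in blast)
      ultimately show ?thesis by blast
    qed
    then show ?thesis
      unfolding broken_circuit_def Let_def ba qs(3) using True by blast
  qed (simp add: broken_circuit_def)
qed

end

section \<open>The relations above an element\<close>

text \<open>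
  \<open>I\<close> need only be closed under multiplication by elements of the subring \<open>R\<close>. For the algebra
  itself, \<open>I\<close> consists of the polynomials whose product with a fixed \<open>e\<^sub>S\<close> lies in the defining ideal.
\<close>

locale relation_ideal = building L G for L :: "'a gorder" (structure) and G +
  fixes H S :: "'a set" and z :: "'a \<Rightarrow> 'r::comm_ring_1" and R I :: "'r set"
  assumes H: "pbs H" and S: "S \<subseteq> H"
    and R_add: "\<And>f g. f \<in> R \<Longrightarrow> g \<in> R \<Longrightarrow> f + g \<in> R"
    and R_mult: "\<And>f g. f \<in> R \<Longrightarrow> g \<in> R \<Longrightarrow> f * g \<in> R"
    and R_one: "1 \<in> R" and R_minus: "\<And>f. f \<in> R \<Longrightarrow> - f \<in> R"
    and z_R: "\<And>h. h \<in> H \<Longrightarrow> z h \<in> R"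
    and I_zero: "0 \<in> I" and I_add: "\<And>f g. f \<in> I \<Longrightarrow> g \<in> I \<Longrightarrow> f + g \<in> I"
    and I_mult: "\<And>f g. f \<in> R \<Longrightarrow> g \<in> I \<Longrightarrow> f * g \<in> I"
    and atom_sum: "\<And>a. a \<in> At \<Longrightarrow> (\<Sum>h \<in> {h \<in> H. a \<sqsubseteq> h}. z h) \<in> I"
    and nonnested: "\<And>T. T \<subseteq> H \<Longrightarrow> \<not> nested H (S \<union> T) \<Longrightarrow> prod z T \<in> I"
begin

definition above :: "'a \<Rightarrow> 'r" where
  "above g = (\<Sum>h \<in> {h \<in> H. g \<sqsubseteq> h}. z h)"

lemma fin: "finite {h \<in> H. P h}" using pbs_finite[OF H] by simp

lemma R_zero: "0 \<in> R" using R_add[OF R_one R_minus[OF R_one]] by simp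

lemma R_sum: "(\<And>x. x \<in> A \<Longrightarrow> f x \<in> R) \<Longrightarrow> sum f A \<in> R"
  by (induction A rule: infinite_finite_induct) (auto intro: R_zero R_add)

lemma R_prod: "(\<And>x. x \<in> A \<Longrightarrow> f x \<in> R) \<Longrightarrow> prod f A \<in> R"
  by (induction A rule: infinite_finite_induct) (auto intro: R_one R_mult)

lemma R_power: "f \<in> R \<Longrightarrow> f ^ n \<in> R"
  by (induction n) (auto intro: R_one R_mult)

lemma above_R: "above g \<in> R"
  unfolding above_def by (intro R_sum z_R) auto

lemma I_sum: "(\<And>x. x \<in> A \<Longrightarrow> f x \<in> I) \<Longrightarrow> sum f A \<in> I"
  by (induction A rule: infinite_finite_induct) (auto intro: I_zero I_add)

lemma I_minus: "f \<in> I \<Longrightarrow> - f \<in> I"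
  using I_mult[OF R_minus[OF R_one], of f] by simp

lemma I_diff: "f \<in> I \<Longrightarrow> g \<in> I \<Longrightarrow> f - g \<in> I"
  using I_add[OF _ I_minus, of f g] by simp

lemma I_cong: "f - g \<in> I \<Longrightarrow> g \<in> I \<Longrightarrow> f \<in> I"
  using I_add[of "f - g" g] by simp

text \<open>Sharing an atom puts \<open>J {h, k}\<close> into \<open>H\<close>, and it lies below
  neither \<open>h\<close> nor \<open>k\<close>; so the pair is not nested.\<close>

lemma prod_incomparable:
  assumes a: "a \<in> At" "a \<sqsubseteq> h" "a \<sqsubseteq> k" and hk: "h \<in> H" "k \<in> H" "\<not> h \<sqsubseteq> k" "\<not> k \<sqsubseteq> h"
  shows "z h * z k \<in> I"
proof -
  have E: "h \<in> E" "k \<in> E" using hk pbs_E[OF H] by auto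
  have j: "J {h, k} \<in> H" using pbs_join[OF H hk(1,2) a] .
  have le: "h \<sqsubseteq> J {h, k}" "k \<sqsubseteq> J {h, k}" "J {h, k} \<in> E" using E by (auto intro: J_upper J_closed)
  have "J {h, k} \<notin> At"
  proof
    assume "J {h, k} \<in> At"
    then have "h = J {h, k}" "k = J {h, k}" using le_atom le E hk pbs_bot[OF H] by metis+
    then show False using hk le_refl E by metis
  qed
  have nle: "\<not> J {h, k} \<sqsubseteq> h" "\<not> J {h, k} \<sqsubseteq> k"
    using le_trans[of k "J {h, k}" h] le_trans[of h "J {h, k}" k] le E hk by auto
  have "\<not> nested H (S \<union> {h, k})"
  proof
    assume "nested H (S \<union> {h, k})"
    then have "\<exists>s\<in>{h, k}. J {h, k} \<sqsubseteq> s"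
      using j \<open>J {h, k} \<notin> At\<close> le_refl[OF le(3)] unfolding nested_def by (meson Diff_iff Un_upper2)
    then show False using nle by blast
  qed
  then have "prod z {h, k} \<in> I" using hk by (intro nonnested) auto
  moreover have "h \<noteq> k" using hk le_refl E by blast
  ultimately show ?thesis by simp
qed

text \<open>An element above \<open>g\<close> but not above \<open>h\<close> is incomparable with
  \<open>h\<close> and shares the atom \<open>a\<close> with it, so \<open>z h\<close> kills its
  variable. What survives of \<open>above g\<close> are the elements above
  \<open>J {g, h}\<close>.\<close>

lemma mult_above:
  assumes a: "a \<in> At" "a \<sqsubseteq> g" "a \<sqsubseteq> h" and g: "g \<in> E" and h: "h \<in> H" "\<not> g \<sqsubseteq> h"
  shows "z h * above g ^ n - z h * above (J {g, h}) ^ n \<in> I"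
proof (induction n)
  case (Suc n)
  let ?g = "J {g, h}"
  have hE: "h \<in> E" using h pbs_E[OF H] by blast
  have gE: "?g \<in> E" "g \<sqsubseteq> ?g" "h \<sqsubseteq> ?g" using g hE by (auto intro: J_upper J_closed)
  have aE: "a \<in> E" using a atom_in by blast
  have "{k \<in> H. g \<sqsubseteq> k} = {k \<in> H. ?g \<sqsubseteq> k} \<union> {k \<in> H. g \<sqsubseteq> k \<and> \<not> h \<sqsubseteq> k}"
    using J_le_iff[of "{g, h}"] g hE pbs_E[OF H] by auto
  moreover have "{k \<in> H. ?g \<sqsubseteq> k} \<inter> {k \<in> H. g \<sqsubseteq> k \<and> \<not> h \<sqsubseteq> k} = {}"
    using J_le_iff[of "{g, h}"] g hE pbs_E[OF H] by auto
  ultimately have "above g = above ?g + (\<Sum>k\<in>{k \<in> H. g \<sqsubseteq> k \<and> \<not> h \<sqsubseteq> k}. z k)"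
    unfolding above_def by (simp only: sum.union_disjoint[OF fin fin])
  then have "z h * (above g - above ?g) = (\<Sum>k\<in>{k \<in> H. g \<sqsubseteq> k \<and> \<not> h \<sqsubseteq> k}. z h * z k)"
    by (simp add: sum_distrib_left)
  also have "\<dots> \<in> I"
  proof (rule I_sum)
    fix k assume "k \<in> {k \<in> H. g \<sqsubseteq> k \<and> \<not> h \<sqsubseteq> k}"
    then have k: "k \<in> H" "g \<sqsubseteq> k" "\<not> h \<sqsubseteq> k" "k \<in> E" using pbs_E[OF H] by auto
    have "a \<sqsubseteq> k" using le_trans[OF a(2) k(2) aE g k(4)] .
    moreover have "\<not> k \<sqsubseteq> h" using le_trans[OF k(2) _ g k(4) hE] h by blast
    ultimately show "z h * z k \<in> I" using prod_incomparable[OF a(1,3)] h k by blast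
  qed
  finally have "above ?g ^ n * (z h * (above g - above ?g)) \<in> I"
    by (rule I_mult[OF R_power[OF above_R]])
  moreover have "above g * (z h * above g ^ n - z h * above ?g ^ n) \<in> I"
    using Suc.IH by (intro I_mult above_R)
  ultimately have "above g * (z h * above g ^ n - z h * above ?g ^ n) + above ?g ^ n * (z h * (above g - above ?g)) \<in> I"
    by (intro I_add)
  moreover have "above g * (z h * above g ^ n - z h * above ?g ^ n) + above ?g ^ n * (z h * (above g - above ?g)) =
    z h * above g ^ Suc n - z h * above ?g ^ Suc n" by (simp add: algebra_simps)
  ultimately show ?case by (simp only:)
qed (simp add: I_zero)

text \<open>
  One factor \<open>above g\<close> is replaced modulo \<open>I\<close> by minus the sum of the \<open>z h\<close> with \<open>h \<ge> a\<close> but not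
  \<open>h \<ge> g\<close>, where \<open>a\<close> is one of the atoms; each such \<open>h\<close> absorbs \<open>a\<close>.
\<close>

lemma prod_above_power:
  assumes "finite B" "B \<subseteq> At" "S1 \<subseteq> S" "g \<in> H" "T \<subseteq> H" "\<And>s. s \<in> S1 \<union> T \<Longrightarrow> s \<sqsubseteq> g \<and> s \<noteq> g"
    "J (S1 \<union> T \<union> B) = g"
  shows "prod z T * above g ^ card B \<in> I"
  using assms
\<comment> \<open>Both vary because absorbing \<open>a\<close> through a new \<open>h\<close> turns
  \<open>g\<close> into \<open>J {g, h}\<close> and \<open>T\<close> into
  \<open>insert h T\<close>.\<close>
proof (induction B arbitrary: g T rule: finite_induct)
  case empty
  have TE: "S1 \<union> T \<subseteq> E" using empty S pbs_E[OF H] by blast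
  have gE: "g \<in> E" using empty pbs_E[OF H] by blast
  \<comment> \<open>The elements of \<open>S1 \<union> T\<close> lie strictly below \<open>g\<close>
    and join to it. This violates the test at a non-atom \<open>g\<close>; below an atom
    \<open>g\<close> there are no such elements, and the empty join is not \<open>g\<close>.\<close>
  have "\<not> nested H (S \<union> T)"
  proof
    assume n: "nested H (S \<union> T)"
    have "g \<in> At"
    proof (rule ccontr)
      assume "g \<notin> At"
      then have "\<exists>s\<in>S1 \<union> T. g \<sqsubseteq> s"
        using n empty le_refl[OF gE] unfolding nested_def
        by (metis DiffI Un_mono Un_empty_right order_refl)
      then show False using empty.prems(5) TE gE le_antisym by blast
    qed
    then have "S1 \<union> T = {}"
      using empty.prems(5) le_atom[of g] TE empty.prems S pbs_bot[OF H] by blast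
    then have "g = \<bottom>" using empty.prems(6) J_empty by simp
    then show False using atom_not_bot \<open>g \<in> At\<close> by blast
  qed
  then show ?case using nonnested empty by simp
next
  case (insert a B)
  have a: "a \<in> At" "a \<in> E" using insert.prems At_E by auto
  have gE: "g \<in> E" using insert pbs_E[OF H] by blast
  have E: "S1 \<subseteq> E" "T \<subseteq> E" "B \<subseteq> E" using insert.prems S pbs_E[OF H] At_E by auto
  have ag: "a \<sqsubseteq> g" using J_upper[of "S1 \<union> T \<union> insert a B" a] E a insert.prems(6) by auto
  let ?D = "{h \<in> H. a \<sqsubseteq> h \<and> \<not> g \<sqsubseteq> h}"
  have "{h \<in> H. a \<sqsubseteq> h} = {h \<in> H. g \<sqsubseteq> h} \<union> ?D"
    using le_trans[OF ag _ a(2) gE] pbs_E[OF H] by blast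
  moreover have "{h \<in> H. g \<sqsubseteq> h} \<inter> ?D = {}" by blast
  ultimately have "above a = above g + (\<Sum>h\<in>?D. z h)"
    unfolding above_def by (simp only: sum.union_disjoint[OF fin fin])
  then have split: "prod z T * above g ^ Suc (card B) =
      (prod z T * above g ^ card B) * above a - (\<Sum>h\<in>?D. prod z T * above g ^ card B * z h)"
    by (simp add: algebra_simps sum_distrib_left)
  have PR: "prod z T \<in> R" using insert.prems by (intro R_prod z_R) auto
  have "(prod z T * above g ^ card B) * above a \<in> I"
    using atom_sum[OF a(1)] unfolding above_def[symmetric]
    by (intro I_mult R_mult PR R_power above_R)
  moreover have "prod z T * above g ^ card B * z h \<in> I" if "h \<in> ?D" for h
  proof -
    have h: "h \<in> H" "a \<sqsubseteq> h" "\<not> g \<sqsubseteq> h" "h \<in> E" using that pbs_E[OF H] by auto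
    show ?thesis
    proof (cases "h \<in> T")
      \<comment> \<open>\<open>T\<close> already contains an element above \<open>a\<close>, so the
        remaining atoms span \<open>g\<close> without \<open>a\<close>.\<close>
      case True
      have "J (S1 \<union> T \<union> B) = J (S1 \<union> T \<union> insert a B)"
      proof (rule J_eqI)
        show "x \<sqsubseteq> J (S1 \<union> T \<union> B)" if "x \<in> S1 \<union> T \<union> insert a B" for x
          using that E True h le_J[OF h(2), of "S1 \<union> T \<union> B"] a by (auto intro: J_upper)
        show "x \<sqsubseteq> J (S1 \<union> T \<union> insert a B)" if "x \<in> S1 \<union> T \<union> B" for x
          using that E a by (auto intro!: J_upper)
      qed (use E a in auto)
      then have "prod z T * above g ^ card B \<in> I"
        using insert.prems by (intro insert.IH) auto
      then show ?thesis using I_mult[OF z_R[OF h(1)], of "prod z T * above g ^ card B"] by (simp add: mult_ac)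
    next
      case False
      let ?g = "J {g, h}"
      have g': "?g \<in> E" "g \<sqsubseteq> ?g" "h \<sqsubseteq> ?g" using gE h by (auto intro: J_upper J_closed)
      have "?g \<in> H" using pbs_join[OF H insert.prems(3) h(1) a(1) ag h(2)] .
      moreover have "s \<sqsubseteq> ?g \<and> s \<noteq> ?g" if s: "s \<in> S1 \<union> insert h T" for s
      proof (cases "s = h")
        case True
        then show ?thesis using g' h by auto
      next
        case False
        then have "s \<sqsubseteq> g" "s \<noteq> g" "s \<in> E" using s insert.prems(5)[of s] E by auto
        then show ?thesis using g' gE le_trans[of s g ?g] le_antisym[of s g] by auto
      qed
      moreover have "J (S1 \<union> insert h T \<union> B) = ?g"
      proof (rule J_eq_elemI)
        have hTE: "S1 \<union> insert h T \<union> B \<subseteq> E" using E h by auto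
        show "S1 \<union> insert h T \<union> B \<subseteq> E" "?g \<in> E" by fact+
        have leg: "x \<sqsubseteq> g" if "x \<in> S1 \<union> T \<union> B" for x
          using J_upper[of "S1 \<union> T \<union> insert a B" x] E a insert.prems(6) that by auto
        show "x \<sqsubseteq> ?g" if x: "x \<in> S1 \<union> insert h T \<union> B" for x
        proof (cases "x = h")
          case False
          then have "x \<sqsubseteq> g" using x leg by auto
          then show ?thesis using le_trans[of x g ?g] g' gE x hTE by auto
        qed (use g' in simp)
        have "a \<sqsubseteq> J (S1 \<union> insert h T \<union> B)" using le_J[OF h(2) _ hTE a(2)] by simp
        then have "x \<sqsubseteq> J (S1 \<union> insert h T \<union> B)" if "x \<in> S1 \<union> T \<union> insert a B" for x
          using that hTE by (cases "x = a") (auto intro!: J_upper)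
        then have "J (S1 \<union> T \<union> insert a B) \<sqsubseteq> J (S1 \<union> insert h T \<union> B)"
          using E a hTE by (intro J_cover) auto
        moreover have "h \<sqsubseteq> J (S1 \<union> insert h T \<union> B)" using hTE by (auto intro: J_upper)
        ultimately show "?g \<sqsubseteq> J (S1 \<union> insert h T \<union> B)"
          using insert.prems(6) gE h J_closed[OF hTE] by (subst J_le_iff) auto
      qed
      ultimately have "prod z (insert h T) * above ?g ^ card B \<in> I"
        using insert.prems h by (intro insert.IH) auto
      moreover have "finite T" using insert.prems(4) pbs_finite[OF H] finite_subset by blast
      ultimately have 1: "prod z T * (z h * above ?g ^ card B) \<in> I" using False by (simp add: mult_ac)
      have "prod z T * (z h * above g ^ card B - z h * above ?g ^ card B) \<in> I"
        using mult_above[OF a(1) ag h(2) gE h(1,3)] PR by (intro I_mult)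
      then have "prod z T * (z h * above g ^ card B) - prod z T * (z h * above ?g ^ card B) \<in> I"
        by (simp add: algebra_simps)
      from I_cong[OF this 1] show ?thesis by (simp add: mult_ac)
    qed
  qed
  ultimately show ?case using insert.hyps split by (auto intro!: I_diff I_sum)
qed

end

section \<open>Linear functionals on polynomials\<close>

type_synonym 'a pol = "('a \<Rightarrow>\<^sub>0 nat) \<Rightarrow>\<^sub>0 rat"

definition X :: "'a \<Rightarrow> 'a pol" where
  "X g = Poly_Mapping.single (Poly_Mapping.single g 1) 1"

text \<open>A functional is given by an arbitrary table \<open>v\<close> of values on the monomials;
  relations become conditions on that table.\<close>

definition lin :: "('b \<Rightarrow> rat) \<Rightarrow> ('b \<Rightarrow>\<^sub>0 rat) \<Rightarrow> rat" where
  "lin v f = (\<Sum>b\<in>Poly_Mapping.keys f. Poly_Mapping.lookup f b * v b)"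

lemma lin_superset:
  "finite A \<Longrightarrow> Poly_Mapping.keys f \<subseteq> A \<Longrightarrow> lin v f = (\<Sum>b\<in>A. Poly_Mapping.lookup f b * v b)"
  unfolding lin_def by (intro sum.mono_neutral_left) (auto simp: in_keys_iff)

lemma lin_add: "lin v (f + g) = lin v f + lin v g"
proof -
  let ?A = "Poly_Mapping.keys f \<union> Poly_Mapping.keys g"
  have "lin v (f + g) = (\<Sum>b\<in>?A. Poly_Mapping.lookup (f + g) b * v b)"
    using keys_add[of f g] by (intro lin_superset) auto
  also have "\<dots> = (\<Sum>b\<in>?A. Poly_Mapping.lookup f b * v b) + (\<Sum>b\<in>?A. Poly_Mapping.lookup g b * v b)"
    by (simp add: lookup_add distrib_right sum.distrib)
  also have "\<dots> = lin v f + lin v g" by (simp add: lin_superset[of ?A])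
  finally show ?thesis .
qed

lemma lin_zero [simp]: "lin v 0 = 0" by (simp add: lin_def)

lemma lin_sum: "lin v (sum f A) = (\<Sum>a\<in>A. lin v (f a))"
  by (induction A rule: infinite_finite_induct) (auto simp: lin_add)

lemma lin_single: "lin v (Poly_Mapping.single b c) = c * v b"
  by (cases "c = 0") (simp_all add: lin_def)

lemma sum_singles: "(\<Sum>b\<in>Poly_Mapping.keys f. Poly_Mapping.single b (Poly_Mapping.lookup f b)) = f"
  by (simp add: poly_mapping_eq_iff fun_eq_iff lookup_sum lookup_single when_def in_keys_iff)

lemma lin_cong: "(\<And>b. b \<in> Poly_Mapping.keys f \<Longrightarrow> v b = w b) \<Longrightarrow> lin v f = lin w f"
  by (simp add: lin_def)

lemma lin_single_mult:
  fixes f :: "'a pol"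
  shows "lin v (Poly_Mapping.single m c * f) = c * lin (\<lambda>b. v (m + b)) f"
proof -
  have "lin v (Poly_Mapping.single m c * (\<Sum>b\<in>A. Poly_Mapping.single b (Poly_Mapping.lookup f b))) =
    (\<Sum>b\<in>A. c * (Poly_Mapping.lookup f b * v (m + b)))" for A
    by (simp add: sum_distrib_left mult_single lin_sum lin_single mult.assoc)
  from this[of "Poly_Mapping.keys f"] show ?thesis
    unfolding sum_singles by (simp add: lin_def sum_distrib_left)
qed

lemma lin_mult_singles:
  fixes f g :: "'a pol"
  shows "lin v (g * f) = (\<Sum>m\<in>Poly_Mapping.keys f. Poly_Mapping.lookup f m * lin v (g * Poly_Mapping.single m 1))"
proof -
  have "lin v (g * (\<Sum>m\<in>A. Poly_Mapping.single m (Poly_Mapping.lookup f m))) =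
      (\<Sum>m\<in>A. Poly_Mapping.lookup f m * lin v (g * Poly_Mapping.single m 1))" for A
    by (simp add: sum_distrib_left lin_sum mult.commute[of g] lin_single_mult)
  from this[of "Poly_Mapping.keys f"] show ?thesis unfolding sum_singles .
qed

lemma lin_mult_zeroI:
  fixes f g :: "'a pol"
  shows "(\<And>m. lin v (g * Poly_Mapping.single m 1) = 0) \<Longrightarrow> lin v (g * f) = 0"
  using lin_mult_singles[of v g f] by simp

definition free_of :: "'a \<Rightarrow> 'a pol set" where
  "free_of p = {f. \<forall>b\<in>Poly_Mapping.keys f. Poly_Mapping.lookup b p = 0}"

lemma free_of_add: "f \<in> free_of p \<Longrightarrow> g \<in> free_of p \<Longrightarrow> f + g \<in> free_of p"
  using keys_add[of f g] by (auto simp: free_of_def)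

lemma free_of_mult: "f \<in> free_of p \<Longrightarrow> g \<in> free_of p \<Longrightarrow> f * g \<in> free_of p"
  using keys_mult[of f g] by (fastforce simp: free_of_def lookup_add)

lemma free_of_uminus: "f \<in> free_of p \<Longrightarrow> - f \<in> free_of p"
  by (auto simp: free_of_def in_keys_iff)

lemma free_of_const: "0 \<in> free_of p" "1 \<in> free_of p"
  by (auto simp: free_of_def simp flip: single_one split: if_splits)

lemma free_of_sum: "(\<And>a. a \<in> A \<Longrightarrow> f a \<in> free_of p) \<Longrightarrow> sum f A \<in> free_of p"
  by (induction A rule: infinite_finite_induct) (auto intro: free_of_const free_of_add)

lemma free_of_prod: "(\<And>a. a \<in> A \<Longrightarrow> f a \<in> free_of p) \<Longrightarrow> prod f A \<in> free_of p"
  by (induction A rule: infinite_finite_induct) (auto intro: free_of_const free_of_mult)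

lemma free_of_power: "f \<in> free_of p \<Longrightarrow> f ^ n \<in> free_of p"
  by (induction n) (auto intro: free_of_const free_of_mult)

lemma free_of_X: "g \<noteq> p \<Longrightarrow> X g \<in> free_of p"
  by (auto simp: free_of_def X_def lookup_single when_def)

lemma free_of_single: "Poly_Mapping.lookup b p = 0 \<Longrightarrow> Poly_Mapping.single b c \<in> free_of p"
  by (auto simp: free_of_def)

lemma X_power: "X g ^ n = Poly_Mapping.single (Poly_Mapping.single g n) 1"
  by (induction n) (simp_all add: X_def mult_single flip: single_one single_add)

section \<open>The commutative algebras attached to nested sets\<close>

context building begin

text \<open>
  The linear relations express the variable of an atom \<open>a\<close> through the variables of the
  non-atomic elements of \<open>H\<close> above \<open>a\<close>.
\<close>

definition gen :: "'a set \<Rightarrow> 'a \<Rightarrow> 'a pol" where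
  "gen H g = (if g \<in> At then - (\<Sum>h \<in> {h \<in> H - At. g \<sqsubseteq> h}. X h) else X g)"

text \<open>For \<open>A = {}\<close> this comes from the Stanley-Reisner ideal of the nested set
  complex by eliminating the atom variables. A general \<open>A\<close> plays the role of a fixed
  exterior part.\<close>

inductive_set nonface_ideal :: "'a set \<Rightarrow> 'a set \<Rightarrow> 'a pol set" for H A where
  zero: "0 \<in> nonface_ideal H A"
| step: "f \<in> nonface_ideal H A \<Longrightarrow> T \<subseteq> H \<Longrightarrow> \<not> nested H (A \<union> T) \<Longrightarrow>
    q * prod (gen H) T + f \<in> nonface_ideal H A"

lemma nonface_gen: "T \<subseteq> H \<Longrightarrow> \<not> nested H (A \<union> T) \<Longrightarrow> prod (gen H) T \<in> nonface_ideal H A"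
  using nonface_ideal.step[OF nonface_ideal.zero, of T H A 1] by simp

lemma nonface_add:
  "f \<in> nonface_ideal H A \<Longrightarrow> g \<in> nonface_ideal H A \<Longrightarrow> f + g \<in> nonface_ideal H A"
  by (induction rule: nonface_ideal.induct) (auto simp: add.assoc intro: nonface_ideal.step)

lemma nonface_mult: "f \<in> nonface_ideal H A \<Longrightarrow> g * f \<in> nonface_ideal H A"
proof (induction rule: nonface_ideal.induct)
  case (step f T q)
  then show ?case using nonface_ideal.step[of "g * f" H A T "g * q"]
    by (simp add: distrib_left mult.assoc)
qed (simp add: nonface_ideal.zero)

lemma nonface_mono: "f \<in> nonface_ideal H A \<Longrightarrow> A \<subseteq> B \<Longrightarrow> f \<in> nonface_ideal H B"
proof (induction rule: nonface_ideal.induct)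
  case (step f T q)
  then show ?case by (intro nonface_ideal.step) (use nested_mono in blast)+
qed (auto intro: nonface_ideal.zero)

lemma gen_sum:
  assumes H: "pbs H" and a: "a \<in> At"
  shows "(\<Sum>h \<in> {h \<in> H. a \<sqsubseteq> h}. gen H h) = 0"
proof -
  have aE: "a \<in> E" using a atom_in by blast
  have "{h \<in> H. a \<sqsubseteq> h} = insert a {h \<in> H - At. a \<sqsubseteq> h}"
    using a aE pbs_At[OF H] le_refl le_atom[of _ a] atom_not_bot by blast
  moreover have "finite {h \<in> H - At. a \<sqsubseteq> h}" using pbs_finite[OF H] by simp
  ultimately have "(\<Sum>h \<in> {h \<in> H. a \<sqsubseteq> h}. gen H h) = gen H a + (\<Sum>h \<in> {h \<in> H - At. a \<sqsubseteq> h}. gen H h)"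
    using a by simp
  moreover have "(\<Sum>h \<in> {h \<in> H - At. a \<sqsubseteq> h}. gen H h) = (\<Sum>h \<in> {h \<in> H - At. a \<sqsubseteq> h}. X h)"
    by (rule sum.cong) (auto simp: gen_def)
  ultimately show ?thesis using a by (simp add: gen_def)
qed

lemma relation_ideal_nonface:
  assumes "pbs H" "A \<subseteq> H" shows "relation_ideal L G H A (gen H) UNIV (nonface_ideal H A)"
  using assms building_axioms
  by (intro relation_ideal.intro relation_ideal_axioms.intro)
    (auto intro: nonface_ideal.zero nonface_add nonface_mult nonface_gen simp: gen_sum)

definition admissible :: "'a set \<Rightarrow> 'a set \<Rightarrow> ('a \<Rightarrow>\<^sub>0 nat) set" where
  "admissible H A = {b. Poly_Mapping.keys b \<subseteq> H \<and> nested H (A \<union> Poly_Mapping.keys b) \<and>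
     (\<forall>g\<in>Poly_Mapping.keys b. Poly_Mapping.lookup b g <
        interval_rank L (J {f \<in> A \<union> Poly_Mapping.keys b. f \<sqsubset> g}) g)}"

text \<open>No element of \<open>H\<close> lies strictly below an atom. The bound leaves no positive
  exponent for atom variables, in agreement with their elimination.\<close>

lemma atom_interval_rank:
  assumes H: "pbs H" and A: "A \<subseteq> H" and g: "g \<in> At"
  shows "interval_rank L (J {f \<in> A. f \<sqsubset> g}) g \<le> 1"
proof -
  have empty: "{f \<in> A. f \<sqsubset> g} = {}"
    using le_atom[OF g] A pbs_E[OF H] pbs_bot[OF H] unfolding less_iff by blast
  show ?thesis unfolding empty using interval_rank_le_card[of "{g}" "{}"] g atom_in[OF g] J_singleton by simp
qed

lemma admissible_keys:
  assumes "pbs H" "A \<subseteq> H" "b \<in> admissible H A" shows "Poly_Mapping.keys b \<subseteq> H - At"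
proof
  fix g assume g: "g \<in> Poly_Mapping.keys b"
  have "g \<notin> At"
  proof
    assume "g \<in> At"
    then have "interval_rank L (J {f \<in> A \<union> Poly_Mapping.keys b. f \<sqsubset> g}) g \<le> 1"
      using assms by (intro atom_interval_rank) (auto simp: admissible_def)
    then have "Poly_Mapping.lookup b g < 1" using assms g unfolding admissible_def by fastforce
    then show False using g by (simp add: in_keys_iff)
  qed
  then show "g \<in> H - At" using g assms by (auto simp: admissible_def)
qed

end

section \<open>Linear independence in the commutative algebras\<close>

text \<open>The binomial expansion of \<open>(u + Y) ^ d = 0\<close> for a new variable
  \<open>Y\<close>, read as a recurrence: the term of index \<open>i\<close> acts on the coefficient
  of \<open>Y ^ i\<close>, and the first \<open>d\<close> terms are free.\<close>

function rec_seq :: "nat \<Rightarrow> 'a pol \<Rightarrow> (nat \<Rightarrow> ('a \<Rightarrow>\<^sub>0 nat) \<Rightarrow> rat) \<Rightarrow> nat \<Rightarrow> ('a \<Rightarrow>\<^sub>0 nat) \<Rightarrow> rat" where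
  "rec_seq d u w i = (if i < d then w i else (\<lambda>b. - (\<Sum>j<d. of_nat (d choose j) *
     lin (rec_seq d u w (i - d + j)) (u ^ (d - j) * Poly_Mapping.single b 1))))"
  by pat_completeness auto
termination by (relation "measure (\<lambda>(d, u, w, i). i)") auto

declare rec_seq.simps [simp del]

lemma rec_seq_less: "i < d \<Longrightarrow> rec_seq d u w i = w i"
  by (simp add: rec_seq.simps)

lemma lin_rec_seq:
  fixes u q :: "'a pol"
  assumes "d \<le> i"
  shows "lin (rec_seq d u w i) q = - (\<Sum>j<d. of_nat (d choose j) * lin (rec_seq d u w (i - d + j)) (u ^ (d - j) * q))"
proof -
  let ?l = "\<lambda>j b. lin (rec_seq d u w (i - d + j)) (u ^ (d - j) * Poly_Mapping.single b 1)"
  have "lin (rec_seq d u w i) q =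
      (\<Sum>b\<in>Poly_Mapping.keys q. Poly_Mapping.lookup q b * - (\<Sum>j<d. of_nat (d choose j) * ?l j b))"
    unfolding lin_def[of "rec_seq d u w i"] using assms by (subst rec_seq.simps) simp
  also have "\<dots> = - (\<Sum>b\<in>Poly_Mapping.keys q. \<Sum>j<d. of_nat (d choose j) * (Poly_Mapping.lookup q b * ?l j b))"
    by (simp add: sum_distrib_left sum_negf mult_ac)
  also have "\<dots> = - (\<Sum>j<d. of_nat (d choose j) * (\<Sum>b\<in>Poly_Mapping.keys q. Poly_Mapping.lookup q b * ?l j b))"
    by (subst sum.swap) (simp add: sum_distrib_left)
  also have "\<dots> = - (\<Sum>j<d. of_nat (d choose j) * lin (rec_seq d u w (i - d + j)) (u ^ (d - j) * q))"
    by (simp only: lin_mult_singles[of _ _ q])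
  finally show ?thesis .
qed

text \<open>
  The algebra of \<open>H'\<close> is the algebra of \<open>H\<close> extended by the powers of the variable of \<open>p\<close>,
  with coefficients in the restriction to the flat \<open>p\<close>, subject to a monic equation
  \<open>(u + X p) ^ d = 0\<close>. Dually, a functional on it is a sequence of functionals satisfying the
  corresponding linear recurrence.
\<close>

locale functional_step = building_step L G H H' p for L :: "'a gorder" (structure) and G H H' p +
  fixes A :: "'a set" and w :: "nat \<Rightarrow> ('a \<Rightarrow>\<^sub>0 nat) \<Rightarrow> rat"
  assumes A: "A \<subseteq> H'" and nested_A: "nested H' A"
    and w_zero: "\<And>f. p \<notin> A \<Longrightarrow> f \<in> nonface_ideal H (A - {p}) \<Longrightarrow> lin (w 0) f = 0"
    and w_flat: "\<And>i f. 0 < i \<or> p \<in> A \<Longrightarrow> f \<in> nonface_ideal H ((A - {p}) \<union> below p) \<Longrightarrow> lin (w i) f = 0"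
begin

definition "A0 = A - {p}"
definition "Z = A0 \<union> below p"
definition "S1 = A0 \<inter> below p"
text \<open>The exclusive bound that the basis puts on the exponent of \<open>p\<close>: by
  minimality of \<open>p\<close>, the members of \<open>A\<close> strictly below \<open>p\<close>
  are atoms, namely \<open>S1\<close>.\<close>

definition "d = interval_rank L (J S1) p"
text \<open>Together with \<open>Y\<close> this gives \<open>u + Y\<close>, the sum over all
  elements of \<open>H'\<close> above \<open>p\<close>.\<close>

definition "u = (\<Sum>h \<in> {h \<in> H. p \<sqsubseteq> h}. X h)"
definition "Y = X p"
definition "psi = rec_seq d u w"
definition "Psi b = psi (Poly_Mapping.lookup b p) (Poly_Mapping.update p 0 b)"
text \<open>The largest ideal on which \<open>Psi\<close> vanishes. Unlike vanishing itself,
  membership can be checked on generators.\<close>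

definition "K = {g. \<forall>f. lin Psi (g * f) = 0}"

lemma A0: "A0 \<subseteq> H" "A0 \<subseteq> E" and Z: "Z \<subseteq> H" "Z \<subseteq> E" and S1: "S1 \<subseteq> A0" "S1 \<subseteq> At" "S1 \<subseteq> E"
proof -
  show "A0 \<subseteq> H" using A by (auto simp: A0_def H_def)
  then show "A0 \<subseteq> E" "Z \<subseteq> H" "Z \<subseteq> E" "S1 \<subseteq> A0" "S1 \<subseteq> At" "S1 \<subseteq> E"
    using pbs_E[OF H] pbs_At[OF H] below_subset[of p] unfolding Z_def S1_def by blast+
qed

lemma p_not_span: "\<not> p \<sqsubseteq> J (A0 \<inter> At)"
  using nested_atoms[OF H' nested_mono[OF nested_A] p, of A0] by (auto simp: A0_def)

lemma JS1: "J S1 \<in> E" "J S1 \<sqsubseteq> p" "J S1 \<noteq> p"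
proof -
  show "J S1 \<in> E" using S1 J_closed by blast
  show "J S1 \<sqsubseteq> p" using S1 p_E by (subst J_le_iff) (auto simp: S1_def below_def)
  have "J S1 \<sqsubseteq> J (A0 \<inter> At)" using S1 A0 by (intro J_mono) auto
  then show "J S1 \<noteq> p" using p_not_span by auto
qed

lemma d_pos: "0 < d"
proof -
  have "card {J S1, p} - 1 \<le> d"
    unfolding d_def using JS1 p_E le_refl by (intro interval_rank_ge) (auto simp: chain_def)
  then show ?thesis using JS1 by simp
qed

lemma relA0: "relation_ideal L G H A0 (gen H) UNIV (nonface_ideal H A0)"
  and relZ: "relation_ideal L G H Z (gen H) UNIV (nonface_ideal H Z)"
  using relation_ideal_nonface[OF H] A0 Z by auto

lemma gen_nonatom: "h \<notin> At \<Longrightarrow> gen H h = X h" "h \<notin> At \<Longrightarrow> gen H' h = X h"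
  by (simp_all add: gen_def)

lemma u_above: "relation_ideal.above L H (gen H) p = u"
proof -
  have "h \<notin> At" if "p \<sqsubseteq> h" for h using not_le_atom[OF H' p] that by blast
  then show ?thesis
    unfolding relation_ideal.above_def[OF relA0] u_def by (intro sum.cong) (auto simp: gen_def)
qed

lemma gen_plus_u:
  assumes "a \<in> below p"
  shows "gen H a + u = - (\<Sum>h \<in> {h \<in> H - At. a \<sqsubseteq> h \<and> \<not> p \<sqsubseteq> h}. X h)"
proof -
  have a: "a \<in> At" "a \<sqsubseteq> p" "a \<in> E" using assms atom_in by (auto simp: below_def)
  have fin: "finite {h \<in> H. P h}" for P using pbs_finite[OF H] by simp
  have fin': "finite {h \<in> H - At. P h}" for P using pbs_finite[OF H] by simp
  have "{h \<in> H - At. a \<sqsubseteq> h} = {h \<in> H. p \<sqsubseteq> h} \<union> {h \<in> H - At. a \<sqsubseteq> h \<and> \<not> p \<sqsubseteq> h}"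
    using not_le_atom[OF H' p] le_trans[OF a(2) _ a(3) p_E] pbs_E[OF H] by blast
  moreover have "{h \<in> H. p \<sqsubseteq> h} \<inter> {h \<in> H - At. a \<sqsubseteq> h \<and> \<not> p \<sqsubseteq> h} = {}" by blast
  ultimately show ?thesis
    using a by (simp only: gen_def u_def sum.union_disjoint[OF fin fin']) simp
qed

lemma join_above:
  assumes a: "a \<in> below p" and h: "h \<in> H - At" "a \<sqsubseteq> h" "\<not> p \<sqsubseteq> h"
  shows "J {p, h} \<in> H - At" "J {p, h} \<in> E" "p \<sqsubseteq> J {p, h}" "h \<sqsubseteq> J {p, h}" "\<not> J {p, h} \<sqsubseteq> h"
proof -
  have hE: "h \<in> E" "h \<in> H'" using h pbs_E[OF H] H_sub by auto
  show le: "J {p, h} \<in> E" "p \<sqsubseteq> J {p, h}" "h \<sqsubseteq> J {p, h}"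
    using hE p_E by (auto intro: J_upper J_closed)
  show "\<not> J {p, h} \<sqsubseteq> h" using le_trans[OF le(2) _ p_E le(1) hE(1)] h by blast
  have "J {p, h} \<in> H'" using a h p hE by (intro pbs_join[OF H', of _ _ a]) (auto simp: below_def)
  moreover have "J {p, h} \<notin> At" using not_le_atom[OF H' p] le by blast
  moreover have "J {p, h} \<noteq> p"
  proof
    assume "J {p, h} = p"
    then have "h \<sqsubseteq> p" using le(3) by simp
    then show False using min[of h] h H_sub p_notin by blast
  qed
  ultimately show "J {p, h} \<in> H - At" by (auto simp: H_def)
qed

text \<open>The factors \<open>gen H a\<close> are replaced by \<open>- u\<close> one after the
  other. The error \<open>gen H a + u\<close> consists of variables \<open>X h\<close> with
  \<open>h\<close> above \<open>a\<close> but not above \<open>p\<close>. Such an \<open>h\<close>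
  takes over the role of \<open>a\<close>, and \<open>prod_above_power\<close> at
  \<open>J {p, h}\<close> applies, with the factors still present as \<open>T\<close> and the atoms
  already replaced as \<open>B\<close>.\<close>

lemma prod_gen_spanning:
  assumes C: "C \<subseteq> below p" "J (S1 \<union> C) = p" and "C2 \<subseteq> C"
  shows "prod (gen H) C - prod (gen H) (C - C2) * (- u) ^ card C2 \<in> nonface_ideal H A0"
proof -
  interpret RI: relation_ideal L G H A0 "gen H" UNIV "nonface_ideal H A0" by (rule relA0)
  have "finite C2" using assms below_subset finite_subset by metis
  then show ?thesis
    using assms(3)
  proof (induction C2)
    case empty
    then show ?case by (simp add: nonface_ideal.zero)
  next
    case (insert a C2)
    let ?C = "C - insert a C2" and ?n = "card C2"
    have a: "a \<in> below p" "a \<in> C" "a \<in> At" "a \<sqsubseteq> p" using insert C by (auto simp: below_def)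
    have CE: "C \<subseteq> At" "C \<subseteq> E" using C below_subset[of p] by auto
    have fC: "finite C" using CE finite_sub_E by blast
    have CC: "C - C2 = insert a ?C" "a \<notin> ?C" using insert a by auto
    have "prod (gen H) ?C * (- u) ^ ?n * X h \<in> nonface_ideal H A0"
      if "h \<in> {h \<in> H - At. a \<sqsubseteq> h \<and> \<not> p \<sqsubseteq> h}" for h
    proof -
      have h: "h \<in> H - At" "a \<sqsubseteq> h" "\<not> p \<sqsubseteq> h" "h \<in> E" using that pbs_E[OF H] by auto
      let ?g = "J {p, h}"
      note g = join_above[OF a(1) h(1-3)]
      have gX: "gen H h = X h" using h gen_nonatom by simp
      have TE: "S1 \<union> insert h ?C \<union> C2 \<subseteq> E" using S1 CE h insert.prems by auto
      have 1: "X h * u ^ ?n - X h * RI.above ?g ^ ?n \<in> nonface_ideal H A0"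
        using RI.mult_above[OF a(3,4) h(2) p_E _ h(3), of ?n] h(1) unfolding gX u_above by blast
      have strict: "s \<sqsubseteq> ?g \<and> s \<noteq> ?g" if s: "s \<in> S1 \<union> insert h ?C" for s
      proof (cases "s = h")
        case True
        then show ?thesis using g h le_refl by auto
      next
        case False
        then have "s \<in> At" "s \<sqsubseteq> p" using s C by (auto simp: S1_def below_def)
        then show ?thesis
          using le_trans[of s p ?g] g p_E atom_in not_le_atom[OF H' p, of s] by auto
      qed
      have J: "J (S1 \<union> insert h ?C \<union> C2) = ?g"
      proof (rule J_eq_elemI[OF TE g(2)])
        fix x assume x: "x \<in> S1 \<union> insert h ?C \<union> C2"
        show "x \<sqsubseteq> ?g"
        proof (cases "x = h")
          case False
          then have "x \<sqsubseteq> p" "x \<in> E" using x C insert.prems TE by (auto simp: S1_def below_def)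
          then show ?thesis using le_trans[of x p ?g] g p_E by blast
        qed (use g in simp)
      next
        have aJ: "a \<sqsubseteq> J (S1 \<union> insert h ?C \<union> C2)"
          using le_J[OF h(2) _ TE] a atom_in by blast
        have "x \<sqsubseteq> J (S1 \<union> insert h ?C \<union> C2)" if "x \<in> S1 \<union> C" for x
          using that aJ TE by (cases "x = a") (auto intro!: J_upper)
        then have "J (S1 \<union> C) \<sqsubseteq> J (S1 \<union> insert h ?C \<union> C2)"
          using S1 CE TE by (intro J_cover) auto
        moreover have "h \<sqsubseteq> J (S1 \<union> insert h ?C \<union> C2)" using TE by (auto intro: J_upper)
        ultimately show "?g \<sqsubseteq> J (S1 \<union> insert h ?C \<union> C2)"
          using C(2) p_E h(4) J_closed[OF TE] by (subst J_le_iff) auto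
      qed
      have "prod (gen H) (insert h ?C) * RI.above ?g ^ ?n \<in> nonface_ideal H A0"
        using insert.hyps insert.prems CE S1 g(1) h(1) strict J pbs_At[OF H]
        by (intro RI.prod_above_power[of C2 S1]) auto
      moreover have "h \<notin> ?C" using h CE by blast
      ultimately have 2: "prod (gen H) ?C * (X h * RI.above ?g ^ ?n) \<in> nonface_ideal H A0"
        using fC gX by (simp add: mult_ac)
      have "prod (gen H) ?C * (X h * u ^ ?n) - prod (gen H) ?C * (X h * RI.above ?g ^ ?n) \<in> nonface_ideal H A0"
        using nonface_mult[OF 1, of "prod (gen H) ?C"] by (simp add: algebra_simps)
      then have "prod (gen H) ?C * (X h * u ^ ?n) \<in> nonface_ideal H A0" using 2 by (rule RI.I_cong)
      then have "(-1) ^ ?n * (prod (gen H) ?C * (X h * u ^ ?n)) \<in> nonface_ideal H A0"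
        by (rule nonface_mult)
      moreover have "(-1) ^ ?n * (prod (gen H) ?C * (X h * u ^ ?n)) = prod (gen H) ?C * (- u) ^ ?n * X h"
        by (subst power_minus[of u]) (simp add: mult_ac)
      ultimately show ?thesis by (simp only:)
    qed
    then have "- (\<Sum>h \<in> {h \<in> H - At. a \<sqsubseteq> h \<and> \<not> p \<sqsubseteq> h}. prod (gen H) ?C * (- u) ^ ?n * X h) \<in> nonface_ideal H A0"
      by (intro RI.I_minus RI.I_sum)
    then have "prod (gen H) ?C * (- u) ^ ?n * (gen H a + u) \<in> nonface_ideal H A0"
      unfolding gen_plus_u[OF a(1)] by (simp add: sum_distrib_left)
    moreover have "prod (gen H) C - prod (gen H) (C - C2) * (- u) ^ ?n \<in> nonface_ideal H A0"
      using insert by auto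
    ultimately have "(prod (gen H) C - prod (gen H) (C - C2) * (- u) ^ ?n) +
        prod (gen H) ?C * (- u) ^ ?n * (gen H a + u) \<in> nonface_ideal H A0"
      by (intro nonface_add)
    moreover have "prod (gen H) (insert a ?C) = gen H a * prod (gen H) ?C"
      by (rule prod.insert) (use CC(2) fC in auto)
    then have "prod (gen H) (C - C2) = gen H a * prod (gen H) ?C" by (simp only: CC(1))
    then have "(prod (gen H) C - prod (gen H) (C - C2) * (- u) ^ ?n) +
        prod (gen H) ?C * (- u) ^ ?n * (gen H a + u) = prod (gen H) C - prod (gen H) ?C * (- u) ^ Suc ?n"
      by (simp add: algebra_simps)
    ultimately show ?case using insert.hyps by simp
  qed
qed

text \<open>At most \<open>d\<close> atoms \<open>B\<close> complete \<open>S1\<close> to a spanning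
  set of \<open>p\<close>. Adding them to \<open>T\<close> obstructs nestedness as much as adding
  all of \<open>below p\<close>, and their product is \<open>(- u) ^ card B\<close> modulo the
  ideal. So \<open>u ^ d\<close> carries the larger ideal into the smaller one.\<close>

lemma u_power:
  assumes "f \<in> nonface_ideal H Z"
  shows "u ^ d * f \<in> nonface_ideal H A0"
  using assms
proof (induction rule: nonface_ideal.induct)
  case zero
  then show ?case by (simp add: nonface_ideal.zero)
next
  case (step f T q)
  obtain B where B: "B \<subseteq> below p" "card B \<le> d" "J (insert (J S1) B) = p"
    using spanning_atoms[OF JS1(1) p_E JS1(2)] unfolding d_def by blast
  have BE: "B \<subseteq> At" "B \<subseteq> E" "B \<subseteq> H" using B below_subset[of p] pbs_At[OF H] by auto
  have TE: "T \<subseteq> E" using step.hyps pbs_E[OF H] by blast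
  have fin: "finite T" "finite B" using TE BE finite_sub_E by auto
  have JB: "J (S1 \<union> B) = p"
  proof -
    have "J (S1 \<union> B) = J ({J S1} \<union> B)"
      using S1 BE JS1 J_singleton by (intro J_Un_cong) auto
    then show ?thesis using B by simp
  qed
  have "\<not> nested H (A0 \<union> (T \<union> B))"
  proof
    assume n: "nested H (A0 \<union> (T \<union> B))"
    have "nested H (Z \<union> T)"
    proof (rule nested_le[OF H _ _ _ _ n])
      let ?W = "(A0 \<union> (T \<union> B)) \<inter> At"
      have WE: "?W \<subseteq> E" using At_E by blast
      have "J (S1 \<union> B) \<sqsubseteq> J ?W" using S1 BE WE by (intro J_mono) auto
      then have pW: "p \<sqsubseteq> J ?W" using JB by simp
      show "J ((Z \<union> T) \<inter> At) \<sqsubseteq> J ?W"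
      proof (rule J_cover)
        fix a assume a: "a \<in> (Z \<union> T) \<inter> At"
        then have aE: "a \<in> E" using atom_in by blast
        show "a \<sqsubseteq> J ?W"
        proof (cases "a \<in> below p")
          case True
          then show ?thesis using le_trans[OF _ pW aE p_E J_closed[OF WE]] by (auto simp: below_def)
        next
          case False
          then show ?thesis using a WE by (intro J_upper) (auto simp: Z_def)
        qed
      qed (use At_E in auto)
    qed (use A0 Z TE BE below_subset(1)[of p] in \<open>auto simp: Z_def\<close>)
    then show False using step.hyps by blast
  qed
  then have "prod (gen H) (T \<union> B) \<in> nonface_ideal H A0"
    using step.hyps BE by (intro nonface_gen) auto
  \<comment> \<open>\<open>T\<close> and \<open>B\<close> may overlap; the factor over
    \<open>T \<inter> B\<close> turns the product over the union into the product of both.\<close>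
  then have "prod (gen H) (T \<inter> B) * prod (gen H) (T \<union> B) \<in> nonface_ideal H A0" by (rule nonface_mult)
  then have TB: "prod (gen H) T * prod (gen H) B \<in> nonface_ideal H A0"
    using prod.union_inter[OF fin, of "gen H"] by (simp add: mult.commute)
  have "prod (gen H) B - prod (gen H) (B - B) * (- u) ^ card B \<in> nonface_ideal H A0"
    by (rule prod_gen_spanning[OF B(1) JB]) simp
  then have "prod (gen H) T * (prod (gen H) B - (- u) ^ card B) \<in> nonface_ideal H A0"
    by (intro nonface_mult) simp
  moreover have "- (prod (gen H) T * prod (gen H) B) \<in> nonface_ideal H A0"
    using nonface_mult[OF TB, of "-1"] by simp
  ultimately have "prod (gen H) T * (prod (gen H) B - (- u) ^ card B) + - (prod (gen H) T * prod (gen H) B) \<in> nonface_ideal H A0"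
    by (rule nonface_add)
  then have "prod (gen H) T * - ((- u) ^ card B) \<in> nonface_ideal H A0" by (simp add: algebra_simps)
  then have "- q * u ^ (d - card B) * (-1) ^ card B * (prod (gen H) T * - ((- u) ^ card B)) \<in> nonface_ideal H A0"
    by (rule nonface_mult)
  moreover have "- q * u ^ (d - card B) * (-1) ^ card B * (prod (gen H) T * - ((- u) ^ card B)) = u ^ d * (q * prod (gen H) T)"
  proof -
    have "(-1) ^ card B * (- u) ^ card B = u ^ card B" by (simp flip: power_mult_distrib)
    moreover have "u ^ d = u ^ (d - card B) * u ^ card B" using B(2) by (simp flip: power_add)
    ultimately have "u ^ d * (q * prod (gen H) T) =
        q * prod (gen H) T * u ^ (d - card B) * ((-1) ^ card B * (- u) ^ card B)"
      by (simp only: mult_ac)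
    also have "\<dots> = - q * u ^ (d - card B) * (-1) ^ card B * (prod (gen H) T * - ((- u) ^ card B))"
      by (simp add: mult_ac)
    finally show ?thesis by (rule sym)
  qed
  ultimately have "u ^ d * (q * prod (gen H) T) \<in> nonface_ideal H A0" by (simp only:)
  then show ?case using step.IH by (simp add: distrib_left nonface_add)
qed

lemma psi_Z: "0 < i \<or> p \<in> A \<Longrightarrow> f \<in> nonface_ideal H Z \<Longrightarrow> lin (psi i) f = 0"
proof (induction i arbitrary: f rule: less_induct)
  case (less i)
  show ?case
  proof (cases "i < d")
    case True
    then show ?thesis using w_flat less.prems by (simp add: psi_def rec_seq_less Z_def A0_def)
  next
    case False
    have "lin (psi (i - d + j)) (u ^ (d - j) * f) = 0" if j: "j < d" for j
    proof (cases "0 < i - d + j \<or> p \<in> A")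
      case True
      then show ?thesis using j False nonface_mult[OF less.prems(2)] by (intro less.IH) auto
    next
      \<comment> \<open>Index zero is reached only from \<open>i = d\<close> with
        \<open>j = 0\<close>, where the full power \<open>u ^ d\<close> is available.\<close>
      case zero: False
      then have "u ^ (d - j) * f \<in> nonface_ideal H A0" using u_power[OF less.prems(2)] by simp
      then show ?thesis using zero d_pos w_zero by (simp add: psi_def rec_seq_less A0_def)
    qed
    then show ?thesis
      using lin_rec_seq[of d i u w f] False by (simp add: psi_def)
  qed
qed

lemma psi_A: "p \<notin> A \<Longrightarrow> f \<in> nonface_ideal H A0 \<Longrightarrow> lin (psi i) f = 0"
proof (cases "i = 0")
  case True
  then show "p \<notin> A \<Longrightarrow> f \<in> nonface_ideal H A0 \<Longrightarrow> lin (psi i) f = 0"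
    using w_zero d_pos by (simp add: psi_def rec_seq_less A0_def)
next
  case False
  then show "f \<in> nonface_ideal H A0 \<Longrightarrow> lin (psi i) f = 0"
    using psi_Z nonface_mono[of f H A0 Z] by (auto simp: Z_def)
qed

lemma lin_Psi: "q \<in> free_of p \<Longrightarrow> lin Psi (Y ^ i * q) = lin (psi i) q"
proof -
  assume q: "q \<in> free_of p"
  have "Psi (Poly_Mapping.single p i + b) = psi i b" if "b \<in> Poly_Mapping.keys q" for b
  proof -
    have b: "Poly_Mapping.lookup b p = 0" using q that by (auto simp: free_of_def)
    have "Poly_Mapping.update p 0 (Poly_Mapping.single p i + b) = b"
      using b by (simp add: poly_mapping_eq_iff fun_eq_iff lookup_update lookup_add lookup_single when_def)
    then show ?thesis using b by (simp add: Psi_def lookup_add)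
  qed
  then have "lin (\<lambda>b. Psi (Poly_Mapping.single p i + b)) q = lin (psi i) q" by (rule lin_cong)
  then show ?thesis by (simp add: Y_def X_power lin_single_mult)
qed

text \<open>Every monomial is a power of \<open>Y\<close> times a monomial free of \<open>p\<close>,
  and the power selects the term of \<open>psi\<close> that applies.\<close>

lemma lin_Psi_mult_zeroI:
  assumes "g \<in> free_of p" "\<And>i q. k \<le> i \<Longrightarrow> lin (psi i) (g * q) = 0"
  shows "lin Psi (Y ^ k * g * f) = 0"
proof (rule lin_mult_zeroI)
  fix m :: "'a \<Rightarrow>\<^sub>0 nat"
  let ?m = "Poly_Mapping.update p 0 m" and ?i = "Poly_Mapping.lookup m p"
  have m: "m = Poly_Mapping.single p ?i + ?m"
    by (simp add: poly_mapping_eq_iff fun_eq_iff lookup_update lookup_add lookup_single when_def)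
  have "Poly_Mapping.single m 1 = Y ^ ?i * Poly_Mapping.single ?m (1 :: rat)"
    unfolding Y_def X_power mult_single by (subst m) simp
  then have "Y ^ k * g * Poly_Mapping.single m 1 = Y ^ (k + ?i) * (g * Poly_Mapping.single ?m 1)"
    by (simp add: power_add mult_ac)
  moreover have "g * Poly_Mapping.single ?m 1 \<in> free_of p"
    using assms(1) by (intro free_of_mult free_of_single) (simp_all add: lookup_update)
  ultimately show "lin Psi (Y ^ k * g * Poly_Mapping.single m 1) = 0"
    using lin_Psi assms(2)[of "k + ?i"] by simp
qed

section \<open>The ideal annihilated by the functional\<close>

lemma K_add: "f \<in> K \<Longrightarrow> g \<in> K \<Longrightarrow> f + g \<in> K"
  by (simp add: K_def distrib_right lin_add)

lemma K_mult: "g \<in> K \<Longrightarrow> f * g \<in> K"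
  unfolding K_def by (auto simp: mult.assoc) (metis mult.assoc mult.commute)

lemma K_zero: "0 \<in> K" by (simp add: K_def)

lemma K_minus: "f \<in> K \<Longrightarrow> - f \<in> K" using K_mult[of f "-1"] by simp

lemma K_diff: "f \<in> K \<Longrightarrow> g \<in> K \<Longrightarrow> f - g \<in> K" using K_add[OF _ K_minus, of f g] by simp

lemma K_cong: "f - g \<in> K \<Longrightarrow> g \<in> K \<Longrightarrow> f \<in> K" using K_add[of "f - g" g] by simp

lemma gen_free: "h \<in> H \<Longrightarrow> gen H h \<in> free_of p"
  using p_notin by (auto simp: gen_def intro!: free_of_uminus free_of_sum free_of_X)

lemma u_free: "u \<in> free_of p"
  unfolding u_def using p_notin by (intro free_of_sum free_of_X) auto

text \<open>The binomial expansion turns this into the recurrence that defines \<open>psi\<close>,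
  with the summand of index \<open>d\<close> as the newly defined term.\<close>

lemma K_u_Y: "(u + Y) ^ d \<in> K"
  unfolding K_def
proof (rule CollectI, rule allI, rule lin_mult_zeroI)
  fix m :: "'a \<Rightarrow>\<^sub>0 nat"
  let ?m = "Poly_Mapping.update p 0 m" and ?i = "Poly_Mapping.lookup m p"
  let ?q = "Poly_Mapping.single ?m (1 :: rat)"
  have m: "m = Poly_Mapping.single p ?i + ?m"
    by (simp add: poly_mapping_eq_iff fun_eq_iff lookup_update lookup_add lookup_single when_def)
  have q: "?q \<in> free_of p" by (intro free_of_single) (simp add: lookup_update)
  have "Poly_Mapping.single m 1 = Y ^ ?i * ?q"
    unfolding Y_def X_power mult_single by (subst m) simp
  moreover have "(u + Y) ^ d = (\<Sum>j\<le>d. of_nat (d choose j) * Y ^ j * u ^ (d - j))"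
    by (subst add.commute) (rule binomial_ring)
  ultimately have "(u + Y) ^ d * Poly_Mapping.single m 1 =
      (\<Sum>j\<le>d. of_nat (d choose j) * Y ^ j * u ^ (d - j) * (Y ^ ?i * ?q))"
    by (simp only: sum_distrib_right)
  also have "\<dots> = (\<Sum>j\<le>d. of_nat (d choose j) * (Y ^ (j + ?i) * (u ^ (d - j) * ?q)))"
    by (rule sum.cong) (simp_all add: power_add mult_ac)
  finally have "(u + Y) ^ d * Poly_Mapping.single m 1 =
      (\<Sum>j\<le>d. of_nat (d choose j) * (Y ^ (j + ?i) * (u ^ (d - j) * ?q)))" .
  then have "lin Psi ((u + Y) ^ d * Poly_Mapping.single m 1) =
      (\<Sum>j\<le>d. lin Psi (of_nat (d choose j) * (Y ^ (j + ?i) * (u ^ (d - j) * ?q))))"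
    by (simp add: lin_sum)
  also have "\<dots> = (\<Sum>j\<le>d. of_nat (d choose j) * lin (psi (j + ?i)) (u ^ (d - j) * ?q))"
  proof (rule sum.cong[OF refl])
    fix j
    have "lin Psi (of_nat n * f) = of_nat n * lin Psi f" for n f
      by (induction n) (simp_all add: lin_add distrib_right)
    then show "lin Psi (of_nat (d choose j) * (Y ^ (j + ?i) * (u ^ (d - j) * ?q))) =
      of_nat (d choose j) * lin (psi (j + ?i)) (u ^ (d - j) * ?q)"
      using lin_Psi[OF free_of_mult[OF free_of_power[OF u_free] q]] by simp
  qed
  also have "\<dots> = (\<Sum>j<d. of_nat (d choose j) * lin (psi (j + ?i)) (u ^ (d - j) * ?q)) + lin (psi (d + ?i)) ?q"
    by (simp flip: lessThan_Suc_atMost)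
  also have "\<dots> = 0"
    using lin_rec_seq[of d "d + ?i" u w ?q] by (simp add: psi_def add.commute)
  finally show "lin Psi ((u + Y) ^ d * Poly_Mapping.single m 1) = 0" .
qed

text \<open>The factor \<open>Y\<close> shifts every coefficient to a positive index, where
  \<open>psi\<close> vanishes on the larger ideal; for \<open>p \<in> A\<close> it does so at index
  zero as well.\<close>

lemma K_Z: "f \<in> nonface_ideal H Z \<Longrightarrow> Y * f \<in> K"
  and K_Z': "p \<in> A \<Longrightarrow> f \<in> nonface_ideal H Z \<Longrightarrow> f \<in> K"
proof -
  have "Y * f \<in> K \<and> (p \<in> A \<longrightarrow> f \<in> K)" if "f \<in> nonface_ideal H Z" for f
    using that
  proof (induction rule: nonface_ideal.induct)
    case (step f T q)
    have g: "prod (gen H) T \<in> nonface_ideal H Z" using step.hyps by (intro nonface_gen)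
    have free: "prod (gen H) T \<in> free_of p" using step.hyps gen_free by (intro free_of_prod) auto
    have z: "lin (psi i) (prod (gen H) T * q) = 0" if "0 < i \<or> p \<in> A" for i q
      using psi_Z[OF that nonface_mult[OF g, of q]] by (simp add: mult.commute)
    have "Y ^ 1 * prod (gen H) T \<in> K"
      unfolding K_def using lin_Psi_mult_zeroI[OF free, of 1] z by auto
    moreover have "Y ^ 0 * prod (gen H) T \<in> K" if "p \<in> A"
      unfolding K_def using lin_Psi_mult_zeroI[OF free, of 0] z that by auto
    ultimately have "q * (Y * prod (gen H) T) \<in> K" "p \<in> A \<Longrightarrow> q * prod (gen H) T \<in> K"
      by (auto intro: K_mult)
    then show ?case using step.IH by (auto simp: algebra_simps intro: K_add)
  qed (simp add: K_zero)
  then show "f \<in> nonface_ideal H Z \<Longrightarrow> Y * f \<in> K"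
    and "p \<in> A \<Longrightarrow> f \<in> nonface_ideal H Z \<Longrightarrow> f \<in> K" by auto
qed

lemma K_A: "p \<notin> A \<Longrightarrow> f \<in> nonface_ideal H A0 \<Longrightarrow> f \<in> K"
proof -
  assume pA: "p \<notin> A"
  assume "f \<in> nonface_ideal H A0"
  then show "f \<in> K"
  proof (induction rule: nonface_ideal.induct)
    case (step f T q)
    have g: "prod (gen H) T \<in> nonface_ideal H A0" using step.hyps by (intro nonface_gen)
    have free: "prod (gen H) T \<in> free_of p" using step.hyps gen_free by (intro free_of_prod) auto
    have z: "lin (psi i) (prod (gen H) T * q) = 0" for i q
      using psi_A[OF pA nonface_mult[OF g, of q]] by (simp add: mult.commute)
    have "Y ^ 0 * prod (gen H) T \<in> K"
      unfolding K_def using lin_Psi_mult_zeroI[OF free, of 0] z by auto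
    then show ?case using step.IH by (auto intro: K_add K_mult)
  qed (simp add: K_zero)
qed

text \<open>Once all atoms below \<open>p\<close> are fixed, a non-atom \<open>h\<close> that shares
  an atom with \<open>p\<close> without lying above it is a nonface: \<open>J {p, h}\<close> lies in
  \<open>H\<close> and below the join of \<open>h\<close> and these atoms.\<close>

lemma gen_u_Z: "a \<in> below p \<Longrightarrow> gen H a + u \<in> nonface_ideal H Z"
proof -
  interpret RI: relation_ideal L G H Z "gen H" UNIV "nonface_ideal H Z" by (rule relZ)
  assume a: "a \<in> below p"
  have "X h \<in> nonface_ideal H Z" if "h \<in> {h \<in> H - At. a \<sqsubseteq> h \<and> \<not> p \<sqsubseteq> h}" for h
  proof -
    have h: "h \<in> H - At" "a \<sqsubseteq> h" "\<not> p \<sqsubseteq> h" "h \<in> E" using that pbs_E[OF H] by auto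
    note g = join_above[OF a h(1-3)]
    have "\<not> nested H (Z \<union> {h})"
    proof
      assume n: "nested H (Z \<union> {h})"
      have sub: "below p \<union> {h} \<subseteq> E" using below_subset h by auto
      have "J (below p) \<sqsubseteq> J (below p \<union> {h})" using sub by (intro J_mono) auto
      moreover have "h \<sqsubseteq> J (below p \<union> {h})" using sub by (auto intro: J_upper)
      ultimately have "J {p, h} \<sqsubseteq> J (below p \<union> {h})"
        using J_below[OF p_E] p_E h J_closed[OF sub] by (subst J_le_iff) auto
      moreover have "below p \<union> {h} \<subseteq> Z \<union> {h}" by (auto simp: Z_def)
      ultimately obtain s where "s \<in> below p \<union> {h}" "J {p, h} \<sqsubseteq> s"
        using n g(1) unfolding nested_def by blast
      then show False using g(5) not_le_atom[OF H g(1)] below_subset(1)[of p] by blast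
    qed
    then have "prod (gen H) {h} \<in> nonface_ideal H Z" using h by (intro nonface_gen) auto
    then show ?thesis using h gen_nonatom by simp
  qed
  then show ?thesis unfolding gen_plus_u[OF a] by (intro RI.I_minus RI.I_sum)
qed

text \<open>The parameter \<open>t\<close> is \<open>0\<close> for the atom generators of
  \<open>H\<close> and \<open>1\<close> for those of \<open>H'\<close>, which differ by
  \<open>Y\<close>. The multiplier \<open>e\<close> is \<open>Y\<close>, or \<open>1\<close> when
  \<open>p \<in> A\<close>.\<close>

lemma prod_gen_shift:
  assumes "finite C" "C \<subseteq> below p" "\<And>a. a \<in> below p \<Longrightarrow> e * (gen H a + u) \<in> K"
  shows "e * ((\<Prod>a\<in>C. gen H a - t * Y) - (- u - t * Y) ^ card C) \<in> K"
  using assms(1,2)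
proof (induction C)
  case (insert a C)
  have "(gen H a - t * Y) * (e * ((\<Prod>a\<in>C. gen H a - t * Y) - (- u - t * Y) ^ card C)) +
      (- u - t * Y) ^ card C * (e * (gen H a + u)) \<in> K"
    by (rule K_add[OF K_mult K_mult]) (use insert assms(3) in auto)
  moreover have "(gen H a - t * Y) * (e * ((\<Prod>a\<in>C. gen H a - t * Y) - (- u - t * Y) ^ card C)) +
      (- u - t * Y) ^ card C * (e * (gen H a + u)) =
      e * ((\<Prod>a\<in>insert a C. gen H a - t * Y) - (- u - t * Y) ^ card (insert a C))"
    using insert.hyps by (simp add: algebra_simps)
  ultimately show ?case by (simp only:)
qed (simp add: K_zero)

lemma prod_diff_dvd:
  assumes "finite C" shows "Y dvd (\<Prod>a\<in>C. gen H a - Y) - prod (gen H) C"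
  using assms
proof (induction C)
  case (insert a C)
  have "(\<Prod>a\<in>insert a C. gen H a - Y) - prod (gen H) (insert a C) =
      gen H a * ((\<Prod>a\<in>C. gen H a - Y) - prod (gen H) C) - Y * (\<Prod>a\<in>C. gen H a - Y)"
    using insert.hyps by (simp add: algebra_simps)
  then show ?case using insert.IH by (metis dvd_diff dvd_mult dvd_triv_left)
qed simp

text \<open>Both brackets lie in the ideal of the elements \<open>gen H a + u\<close> and agree at
  \<open>Y = 0\<close>, so their difference is a combination of the elements
  \<open>Y * (gen H a + u)\<close> of \<open>K\<close>.\<close>

lemma prod_gen_shift_diff:
  assumes "finite C" "C \<subseteq> below p"
  shows "((\<Prod>a\<in>C. gen H a - Y) - (- u - Y) ^ card C) - (prod (gen H) C - (- u) ^ card C) \<in> K"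
  using assms
proof (induction C)
  case (insert a C)
  let ?P = "\<Prod>a\<in>C. gen H a - Y" and ?Q = "prod (gen H) C" and ?n = "card C"
  have yY: "Y * (gen H b + u) \<in> K" if "b \<in> below p" for b using K_Z[OF gen_u_Z[OF that]] .
  have "Y * (?Q - (- u) ^ ?n) \<in> K"
    using prod_gen_shift[OF insert.hyps(1) _ yY, of 0] insert.prems by simp
  moreover have "(gen H a - Y) * ((?P - (- u - Y) ^ ?n) - (?Q - (- u) ^ ?n)) \<in> K"
    using insert by (intro K_mult) auto
  moreover have "(gen H a + u) * ((- u - Y) ^ ?n - (- u) ^ ?n) \<in> K"
  proof -
    obtain Q where "(- u - Y) ^ ?n - (- u) ^ ?n = ((- u - Y) - (- u)) * Q"
      using power_diff_sumr2[of "- u - Y" ?n "- u"] by blast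
    then have "(gen H a + u) * ((- u - Y) ^ ?n - (- u) ^ ?n) = - Q * (Y * (gen H a + u))"
      by (simp add: mult_ac)
    then show ?thesis using K_mult[OF yY, of a "- Q"] insert.prems by simp
  qed
  ultimately have "(gen H a - Y) * ((?P - (- u - Y) ^ ?n) - (?Q - (- u) ^ ?n)) +
      (gen H a + u) * ((- u - Y) ^ ?n - (- u) ^ ?n) - Y * (?Q - (- u) ^ ?n) \<in> K"
    by (intro K_add K_diff)
  moreover have "(gen H a - Y) * ((?P - (- u - Y) ^ ?n) - (?Q - (- u) ^ ?n)) +
      (gen H a + u) * ((- u - Y) ^ ?n - (- u) ^ ?n) - Y * (?Q - (- u) ^ ?n) =
    ((\<Prod>a\<in>insert a C. gen H a - Y) - (- u - Y) ^ card (insert a C)) - (prod (gen H) (insert a C) - (- u) ^ card (insert a C))"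
    using insert.hyps by (simp add: algebra_simps)
  ultimately show ?case by (simp only:)
qed (simp add: K_zero)

lemma gen_step:
  assumes "h \<in> H" shows "gen H' h = (if h \<in> below p then gen H h - Y else gen H h)"
proof (cases "h \<in> At")
  case True
  have fin: "finite {k \<in> H - At. h \<sqsubseteq> k}" using pbs_finite[OF H] by simp
  have "{k \<in> H' - At. h \<sqsubseteq> k} = (if h \<sqsubseteq> p then insert p {k \<in> H - At. h \<sqsubseteq> k} else {k \<in> H - At. h \<sqsubseteq> k})"
    using p by (auto simp: H_def)
  then show ?thesis using True fin p_notin by (auto simp: gen_def below_def Y_def)
next
  case False
  then show ?thesis using below_subset(1)[of p] gen_nonatom by auto
qed

text \<open>The factor through which \<open>p\<close> lies below these atoms is \<open>p\<close>
  itself, since a larger one would be a non-atom of \<open>H\<close> below a join of nested atoms.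
  So the atoms below \<open>p\<close> alone span it, and the rank bounds how many come from
  \<open>T\<close>.\<close>

lemma spanning_of_nested:
  assumes T: "T \<subseteq> H" and n: "nested H (A0 \<union> T)" and le: "p \<sqsubseteq> J ((A0 \<union> T) \<inter> At)"
  shows "J (S1 \<union> (T \<inter> below p)) = p" "d \<le> card (T \<inter> below p)"
proof -
  let ?X = "(A0 \<union> T) \<inter> At"
  have XG: "?X \<subseteq> G" "?X \<subseteq> E" using pbs_At[OF H] pbs_G[OF H] At_E by auto
  obtain y where y: "y \<in> G" "p \<sqsubseteq> y" "J {z \<in> ?X. z \<sqsubseteq> y} = y"
    using building_set_factor[OF building XG(1) p_G le] by blast
  have yH: "y \<in> H' - At" using pbs_up[OF H' p y(1,2)] .
  have "y = p"
  proof (rule ccontr)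
    assume "y \<noteq> p"
    then have "\<not> y \<sqsubseteq> J ?X" using nested_atoms[OF H n] yH by (auto simp: H_def)
    moreover have "J {z \<in> ?X. z \<sqsubseteq> y} \<sqsubseteq> J ?X" using XG by (intro J_mono) auto
    ultimately show False using y(3) by simp
  qed
  moreover have "{z \<in> ?X. z \<sqsubseteq> p} = S1 \<union> (T \<inter> below p)" by (auto simp: S1_def below_def)
  ultimately show J: "J (S1 \<union> (T \<inter> below p)) = p" using y(3) by simp
  have "interval_rank L (J S1) (J (S1 \<union> (T \<inter> below p))) \<le> card (T \<inter> below p)"
    using below_subset[of p] S1 by (intro interval_rank_le_card) auto
  then show "d \<le> card (T \<inter> below p)" unfolding J d_def .
qed

lemma K_shifted_power: "d \<le> n \<Longrightarrow> (- u - Y) ^ n \<in> K"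
proof -
  assume "d \<le> n"
  then have "(- u - Y) ^ n = ((-1) ^ n * (u + Y) ^ (n - d)) * (u + Y) ^ d"
    using power_minus[of "u + Y" n] by (simp add: mult.assoc flip: power_add)
  then show ?thesis using K_mult[OF K_u_Y] by simp
qed

text \<open>Non-nestedness over \<open>H'\<close> has two sources: failure over \<open>H\<close>, or
  atoms spanning \<open>p\<close>. In the second case the generators of the atoms below
  \<open>p\<close> multiply, modulo \<open>K\<close>, to a power of \<open>- u - Y\<close> with
  exponent at least \<open>d\<close>.\<close>

lemma K_generators:
  assumes T: "T \<subseteq> H'" and nn: "\<not> nested H' (A \<union> T)"
  shows "prod (gen H') T \<in> K"
proof -
  define T0 where "T0 = T - {p}"
  define C where "C = T0 \<inter> below p"
  define T1 where "T1 = T0 - below p"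
  define e where "e = (if p \<in> T then Y else 1)"
  have T0: "T0 \<subseteq> H" "finite T0" "T1 \<subseteq> H" "C \<subseteq> H" "finite C" "C \<subseteq> below p"
    using T pbs_finite[OF H'] finite_subset[of T H'] by (auto simp: T0_def T1_def C_def H_def)
  have "prod (gen H') T = e * prod (gen H') T0"
  proof (cases "p \<in> T")
    case True
    then have "T = insert p T0" "p \<notin> T0" by (auto simp: T0_def)
    then show ?thesis using True T0 p gen_nonatom by (simp add: e_def Y_def)
  qed (simp add: e_def T0_def)
  also have "prod (gen H') T0 = prod (gen H') T1 * prod (gen H') C"
    unfolding T1_def C_def using T0(2) by (subst prod.union_disjoint[symmetric]) (auto intro!: prod.cong)
  also have "prod (gen H') T1 = prod (gen H) T1"
    using T0 by (intro prod.cong refl) (auto simp: gen_step T1_def)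
  also have "prod (gen H') C = (\<Prod>a\<in>C. gen H a - Y)"
  proof (intro prod.cong refl)
    fix a assume "a \<in> C"
    then have "a \<in> H" "a \<in> below p" using T0 by auto
    then show "gen H' a = gen H a - Y" by (simp add: gen_step)
  qed
  finally have eq: "prod (gen H') T = prod (gen H) T1 * (e * (\<Prod>a\<in>C. gen H a - Y))" by (simp add: mult_ac)
  have ZT: "A0 \<union> T0 \<union> below p = Z \<union> T1" by (auto simp: Z_def T1_def)
  have AT: "A0 \<union> T0 \<subseteq> H" using A0 T0 by auto
  have J: "J (S1 \<union> C) = p \<and> d \<le> card C" if "nested H (A0 \<union> T0)" "p \<sqsubseteq> J ((A0 \<union> T0) \<inter> At)"
    using spanning_of_nested[OF T0(1) that] by (simp add: C_def)
  show ?thesis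
  proof (cases "p \<in> A \<union> T")
    case True
    then have "A \<union> T = insert p (A0 \<union> T0)" by (auto simp: A0_def T0_def)
    then consider "\<not> nested H (Z \<union> T1)" | "nested H (Z \<union> T1)" "p \<sqsubseteq> J ((A0 \<union> T0) \<inter> At)"
      using nn nested_step_insert[OF AT] ZT by auto
    then show ?thesis
    proof cases
      case 1
      \<comment> \<open>As \<open>p\<close> belongs to \<open>A\<close> or contributes the factor
        \<open>Y\<close>, relations of the larger ideal may be used.\<close>
      then have "prod (gen H) T1 \<in> nonface_ideal H Z" using T0 by (intro nonface_gen)
      then have "e * prod (gen H) T1 \<in> K" using K_Z K_Z' True by (auto simp: e_def)
      then have "(\<Prod>a\<in>C. gen H a - Y) * (e * prod (gen H) T1) \<in> K" by (rule K_mult)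
      then show ?thesis unfolding eq by (simp add: mult_ac)
    next
      case 2
      then have "nested H (A0 \<union> T0)" using nested_mono ZT by blast
      then have dC: "d \<le> card C" using J 2 by blast
      have "e * (gen H a + u) \<in> K" if "a \<in> below p" for a
        using K_Z[OF gen_u_Z[OF that]] K_Z'[OF _ gen_u_Z[OF that]] True by (auto simp: e_def)
      then have "e * ((\<Prod>a\<in>C. gen H a - 1 * Y) - (- u - 1 * Y) ^ card C) \<in> K"
        using T0 by (intro prod_gen_shift) auto
      then have "e * (\<Prod>a\<in>C. gen H a - Y) - e * (- u - Y) ^ card C \<in> K" by (simp add: algebra_simps)
      then have "e * (\<Prod>a\<in>C. gen H a - Y) \<in> K" using K_cong K_mult[OF K_shifted_power[OF dC]] by blast
      then show ?thesis unfolding eq by (rule K_mult)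
    qed
  next
    case False
    then have e: "e = 1" "p \<notin> A" "A \<union> T = A0 \<union> T0" by (auto simp: e_def A0_def T0_def)
    then consider "\<not> nested H (A0 \<union> T0)" | "nested H (A0 \<union> T0)" "p \<sqsubseteq> J ((A0 \<union> T0) \<inter> At)"
      using nn nested_step[OF AT] by auto
    then show ?thesis
    proof cases
      case 1
      \<comment> \<open>Only the smaller ideal is available here. It controls the unshifted product;
        the shift contributes multiples of \<open>Y\<close>, to which the larger ideal
        applies.\<close>
      have "prod (gen H) T0 = prod (gen H) T1 * prod (gen H) C"
        unfolding T1_def C_def using T0(2) by (subst prod.union_disjoint[symmetric]) (auto intro!: prod.cong)
      moreover have "prod (gen H) T0 \<in> K" using 1 T0 e by (intro K_A nonface_gen) auto
      ultimately have 2: "prod (gen H) T1 * prod (gen H) C \<in> K" by simp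
      have "\<not> nested H (Z \<union> T1)" using 1 nested_mono ZT by blast
      then have YT: "Y * prod (gen H) T1 \<in> K" using T0 by (intro K_Z nonface_gen) auto
      obtain Q where "(\<Prod>a\<in>C. gen H a - Y) - prod (gen H) C = Y * Q"
        using prod_diff_dvd[OF T0(5)] by (elim dvdE)
      then have "prod (gen H) T1 * ((\<Prod>a\<in>C. gen H a - Y) - prod (gen H) C) = Q * (Y * prod (gen H) T1)"
        by (simp add: mult_ac)
      then have "prod (gen H) T1 * (\<Prod>a\<in>C. gen H a - Y) - prod (gen H) T1 * prod (gen H) C =
        Q * (Y * prod (gen H) T1)" by (simp only: right_diff_distrib)
      then have "prod (gen H) T1 * (\<Prod>a\<in>C. gen H a - Y) \<in> K"
        using K_cong[OF _ 2] K_mult[OF YT] by simp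
      then show ?thesis using eq e by simp
    next
      case 2
      note JC = J[OF 2]
      have "prod (gen H) C - prod (gen H) (C - C) * (- u) ^ card C \<in> nonface_ideal H A0"
        using JC T0 by (intro prod_gen_spanning) auto
      then have 3: "prod (gen H) C - (- u) ^ card C \<in> K" using K_A e by simp
      have "(\<Prod>a\<in>C. gen H a - Y) - (- u - Y) ^ card C \<in> K"
        using K_cong[OF prod_gen_shift_diff[OF T0(5,6)] 3] .
      then have "(\<Prod>a\<in>C. gen H a - Y) \<in> K" using K_cong K_shifted_power JC by blast
      then show ?thesis unfolding eq e using K_mult by simp
    qed
  qed
qed

lemma Psi_vanishes: "f \<in> nonface_ideal H' A \<Longrightarrow> lin Psi f = 0"
proof -
  assume "f \<in> nonface_ideal H' A"
  then have "f \<in> K"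
    by (induction rule: nonface_ideal.induct) (auto intro: K_zero K_add K_mult K_generators)
  then have "lin Psi (f * 1) = 0" unfolding K_def by blast
  then show ?thesis by simp
qed

text \<open>If \<open>p\<close> lies below \<open>g\<close>, then \<open>p\<close> and
  \<open>below p\<close> contribute the same join. Otherwise no atom below \<open>p\<close> lies
  below \<open>g\<close>: it would put \<open>J {p, g}\<close> into \<open>H'\<close>, nestedness
  would make \<open>p\<close> and \<open>g\<close> comparable, and \<open>g \<sqsubseteq> p\<close>
  contradicts minimality.\<close>

lemma rank_below_cong:
  assumes M: "M \<subseteq> H" and n: "nested H' (insert p M)" and g: "g \<in> M" "g \<notin> At"
  shows "J {f \<in> insert p M. f \<sqsubset> g} = J {f \<in> M \<union> below p. f \<sqsubset> g}"
proof -
  have gE: "g \<in> E" "g \<in> H'" "g \<noteq> p" and ME: "M \<subseteq> E" using g M pbs_E[OF H] H_sub p_notin by auto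
  show ?thesis
  proof (cases "p \<sqsubseteq> g")
    case True
    have bel: "{f \<in> M \<union> below p. f \<sqsubset> g} = {f \<in> M. f \<sqsubset> g} \<union> below p"
      using True g le_trans[OF _ True _ p_E gE(1)] below_subset[of p] by (auto simp: less_iff below_def atom_in)
    have ins: "{f \<in> insert p M. f \<sqsubset> g} = {f \<in> M. f \<sqsubset> g} \<union> {p}"
      using True gE by (auto simp: less_iff)
    have "J ({p} \<union> {f \<in> M. f \<sqsubset> g}) = J (below p \<union> {f \<in> M. f \<sqsubset> g})"
      using ME p_E below_subset J_below[OF p_E] J_singleton[OF p_E] by (intro J_Un_cong) auto
    then show ?thesis unfolding bel ins by (simp only: Un_commute)
  next
    case False
    have "\<not> a \<sqsubset> g" if a: "a \<in> below p" for a
    proof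
      assume ag: "a \<sqsubset> g"
      have "J {p, g} \<in> H'"
        using a ag p gE by (intro pbs_join[OF H', of _ _ a]) (auto simp: below_def less_iff)
      have le: "p \<sqsubseteq> J {p, g}" "g \<sqsubseteq> J {p, g}" "J {p, g} \<in> E" using gE p_E by (auto intro: J_upper J_closed)
      then have "J {p, g} \<in> H' - At" using not_le_atom[OF H' p] \<open>J {p, g} \<in> H'\<close> by blast
      then obtain s where s: "s \<in> {p, g}" "J {p, g} \<sqsubseteq> s"
        using n le_refl[OF le(3)] g(1) unfolding nested_def by (metis insert_mono insertI1 insert_subset subset_insertI2 empty_subsetI)
      then have "g \<sqsubseteq> p \<or> p \<sqsubseteq> g" using le gE p_E le_trans[of g "J {p, g}" p] le_trans[of p "J {p, g}" g] by auto
      then show False using False min[of g] gE g by blast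
    qed
    moreover have "\<not> p \<sqsubset> g" using False by (simp add: less_iff)
    ultimately have "{f \<in> insert p M. f \<sqsubset> g} = {f \<in> M \<union> below p. f \<sqsubset> g}" by auto
    then show ?thesis by simp
  qed
qed

text \<open>The exponent of \<open>p\<close> selects one of the free terms of the sequence, and the
  other exponents are admissible for the ideal on which that term lives.\<close>

lemma admissible_step:
  assumes b: "b \<in> admissible H' A"
  shows "Poly_Mapping.lookup b p < d"
    and "p \<notin> A \<Longrightarrow> Poly_Mapping.lookup b p = 0 \<Longrightarrow> Poly_Mapping.update p 0 b \<in> admissible H A0"
    and "p \<in> A \<or> 0 < Poly_Mapping.lookup b p \<Longrightarrow> Poly_Mapping.update p 0 b \<in> admissible H Z"
proof -
  let ?b = "Poly_Mapping.update p 0 b" and ?T = "Poly_Mapping.keys b"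
  have keys: "Poly_Mapping.keys ?b = ?T - {p}" by (simp add: keys_update)
  have T: "?T \<subseteq> H' - At" by (rule admissible_keys[OF H' A b])
  have n: "nested H' (A \<union> ?T)"
    and rk: "\<And>g. g \<in> ?T \<Longrightarrow> Poly_Mapping.lookup b g < interval_rank L (J {f \<in> A \<union> ?T. f \<sqsubset> g}) g"
    using b by (auto simp: admissible_def)
  have T0: "?T - {p} \<subseteq> H" using T by (auto simp: H_def)
  show "Poly_Mapping.lookup b p < d"
  proof (cases "p \<in> ?T")
    case True
    have "{f \<in> A \<union> ?T. f \<sqsubset> p} = S1"
    proof (intro subset_antisym subsetI)
      fix f assume f: "f \<in> {f \<in> A \<union> ?T. f \<sqsubset> p}"
      then have "f \<in> H'" "f \<noteq> p" "f \<sqsubseteq> p" using A T by (auto simp: less_iff)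
      then have "f \<in> At" using min by blast
      then show "f \<in> S1" using f T by (auto simp: S1_def A0_def below_def less_iff)
    next
      fix f assume "f \<in> S1"
      then show "f \<in> {f \<in> A \<union> ?T. f \<sqsubset> p}" using p by (auto simp: S1_def A0_def below_def less_iff)
    qed
    then show ?thesis using rk[OF True] by (simp add: d_def)
  next
    case False
    then show ?thesis using d_pos by (simp add: in_keys_iff)
  qed
  show "?b \<in> admissible H A0" if "p \<notin> A" "Poly_Mapping.lookup b p = 0"
  proof -
    have "p \<notin> ?T" using that by (simp add: in_keys_iff)
    then have "?T - {p} = ?T" "A0 = A" using that by (auto simp: A0_def)
    moreover have "nested H (A \<union> ?T)" using n H_sub unfolding nested_def by blast
    ultimately show ?thesis using rk T0 unfolding admissible_def mem_Collect_eq keys by (auto simp: lookup_update)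
  qed
  show "?b \<in> admissible H Z" if pA: "p \<in> A \<or> 0 < Poly_Mapping.lookup b p"
  proof -
    let ?M = "A0 \<union> (?T - {p})"
    have AT: "A \<union> ?T = insert p ?M" using pA by (auto simp: A0_def in_keys_iff)
    have M: "?M \<subseteq> H" using A0 T0 by blast
    have nM: "nested H' (insert p ?M)" using n AT by simp
    have ZT: "?M \<union> below p = Z \<union> (?T - {p})" by (auto simp: Z_def)
    have "nested H (Z \<union> (?T - {p}))" using nM nested_step_insert[OF M] ZT by simp
    moreover have "Poly_Mapping.lookup b g < interval_rank L (J {f \<in> Z \<union> (?T - {p}). f \<sqsubset> g}) g"
      if g: "g \<in> ?T - {p}" for g
      using rk[of g] g rank_below_cong[OF M nM, of g] T unfolding AT ZT by auto
    ultimately show ?thesis using T0 unfolding admissible_def mem_Collect_eq keys by (auto simp: lookup_update)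
  qed
qed

end

context building_step begin

lemma functional_step_exists:
  assumes IH: "\<And>A v. A \<subseteq> H \<Longrightarrow> \<exists>v'. (\<forall>f\<in>nonface_ideal H A. lin v' f = 0) \<and> (\<forall>b\<in>admissible H A. v' b = v b)"
    and A: "A \<subseteq> H'"
  shows "\<exists>v'. (\<forall>f\<in>nonface_ideal H' A. lin v' f = 0) \<and> (\<forall>b\<in>admissible H' A. v' b = v b)"
proof (cases "nested H' A")
  case False
  then have "admissible H' A = {}" using nested_mono by (fastforce simp: admissible_def)
  then show ?thesis by (intro exI[of _ "\<lambda>_. 0"]) (auto simp: lin_def)
next
  case True
  let ?A = "\<lambda>i. if 0 < i \<or> p \<in> A then (A - {p}) \<union> below p else A - {p}"
  have sub: "?A i \<subseteq> H" for i :: nat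
    using A below_subset(1)[of p] pbs_At[OF H] by (auto simp: H_def)
  \<comment> \<open>The values wanted at exponent \<open>i\<close> of \<open>p\<close> are
    prescribed to the functional of index \<open>i\<close>.\<close>
  have "\<forall>i. \<exists>v'. (\<forall>f\<in>nonface_ideal H (?A i). lin v' f = 0) \<and>
      (\<forall>b\<in>admissible H (?A i). v' b = v (b + Poly_Mapping.single p i))"
    using IH[OF sub, of _ "\<lambda>b. v (b + Poly_Mapping.single p _)"] by blast
  then obtain w where w: "\<And>i f. f \<in> nonface_ideal H (?A i) \<Longrightarrow> lin (w i) f = 0"
    "\<And>i b. b \<in> admissible H (?A i) \<Longrightarrow> w i b = v (b + Poly_Mapping.single p i)" by metis
  interpret FS: functional_step L G H H' p A w
  proof
    show "lin (w 0) f = 0" if "p \<notin> A" "f \<in> nonface_ideal H (A - {p})" for f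
      using w(1)[of f 0] that by simp
    show "lin (w i) f = 0" if "0 < i \<or> p \<in> A" "f \<in> nonface_ideal H (A - {p} \<union> below p)" for i f
      using w(1)[of f i] that by simp
  qed (fact A True)+
  have "FS.Psi b = v b" if b: "b \<in> admissible H' A" for b
  proof -
    let ?i = "Poly_Mapping.lookup b p" and ?b = "Poly_Mapping.update p 0 b"
    have "?b \<in> admissible H (?A ?i)"
      using FS.admissible_step(2,3)[OF b] by (auto simp: FS.Z_def FS.A0_def)
    then have "w ?i ?b = v (?b + Poly_Mapping.single p ?i)" by (rule w(2))
    moreover have "?b + Poly_Mapping.single p ?i = b"
      by (simp add: poly_mapping_eq_iff fun_eq_iff lookup_update lookup_add lookup_single when_def)
    ultimately show ?thesis
      using FS.admissible_step(1)[OF b] by (simp add: FS.Psi_def FS.psi_def rec_seq_less)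
  qed
  then show ?thesis using FS.Psi_vanishes by blast
qed

end

context building begin

text \<open>The induction ranges over all \<open>A\<close> because a step adjoins
  \<open>below p\<close>. It starts at \<open>H = At\<close>, where every set is nested and the
  ideal is zero. The freedom in \<open>v\<close> amounts to linear independence of the admissible
  monomials modulo the ideal.\<close>

theorem commutative_functional:
  assumes "pbs H" "A \<subseteq> H"
  shows "\<exists>v'. (\<forall>f\<in>nonface_ideal H A. lin v' f = 0) \<and> (\<forall>b\<in>admissible H A. v' b = v b)"
  using assms
proof (induction "card (H - At)" arbitrary: H A v)
  case 0
  then have "H - At = {}" using pbs_finite[OF 0(2)] by simp
  then have n: "nested H S" for S by (auto simp: nested_def)
  have "f = 0" if "f \<in> nonface_ideal H A" for f
    using that by (induction rule: nonface_ideal.induct) (simp_all add: n)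
  then show ?case by (intro exI[of _ v]) (metis lin_zero)
next
  case (Suc n)
  have fin: "finite (H - At)" using pbs_finite[OF Suc.prems(1)] by simp
  have HE: "H \<subseteq> E" using pbs_E[OF Suc.prems(1)] .
  have ne: "H - At \<noteq> {}"
  proof
    assume "H - At = {}"
    then have "card (H - At) = 0" by (simp only: card.empty)
    then show False using Suc.hyps(2) by linarith
  qed
  \<comment> \<open>An element with fewest atoms below it is minimal, since elements are determined
    by their atoms.\<close>
  obtain p where p: "p \<in> H - At" "\<And>h. h \<in> H - At \<Longrightarrow> card (below p) \<le> card (below h)"
    using ne ex_has_least_nat[of "\<lambda>h. h \<in> H - At" _ "\<lambda>h. card (below h)"] by blast
  have min: "h = p" if h: "h \<in> H - At" "h \<sqsubseteq> p" for h
  proof -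
    have E: "h \<in> E" "p \<in> E" using h p HE by auto
    have "below h \<subseteq> below p" using le_iff_below[OF E] h by blast
    then have "below h = below p" using p(2)[OF h(1)] below_subset(3) card_seteq by blast
    then have "J (below h) = J (below p)" by (rule arg_cong)
    then show ?thesis unfolding J_below[OF E(1)] J_below[OF E(2)] .
  qed
  interpret step: building_step L G "H - {p}" H p
  proof (intro building_step.intro building_step_axioms.intro building_axioms)
    show "pbs H" "p \<in> H - At" "H - {p} = H - {p}" using Suc.prems(1) p(1) by simp_all
    show "h = p" if "h \<in> H - At" "h \<sqsubseteq> p" for h using min[OF that] .
  qed
  have "n = card (H - {p} - At)"
  proof -
    have "H - {p} - At = H - At - {p}" by blast
    then show ?thesis using Suc.hyps(2) fin p(1) by simp
  qed
  from step.functional_step_exists[OF Suc.hyps(1)[OF this step.H] Suc.prems(2)] show ?case .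
qed

end

section \<open>Bases of quotient algebras\<close>

text \<open>A class of algebras closed under quotients, so that it covers the free algebra and both
  successive quotients.\<close>

locale rat_algebra =
  fixes A :: "(rat, 'b) module" (structure)
  assumes ring: "ring A"
    and smult_closed: "x \<in> carrier A \<Longrightarrow> c \<odot> x \<in> carrier A"
    and smult_l_distr: "x \<in> carrier A \<Longrightarrow> (a + b) \<odot> x = a \<odot> x \<oplus> b \<odot> x"
    and smult_r_distr: "x \<in> carrier A \<Longrightarrow> y \<in> carrier A \<Longrightarrow> c \<odot> (x \<oplus> y) = c \<odot> x \<oplus> c \<odot> y"
    and smult_assoc: "x \<in> carrier A \<Longrightarrow> (a * b) \<odot> x = a \<odot> (b \<odot> x)"
    and smult_one: "x \<in> carrier A \<Longrightarrow> 1 \<odot> x = x"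
    and smult_mult_left: "x \<in> carrier A \<Longrightarrow> y \<in> carrier A \<Longrightarrow> (c \<odot> x) \<otimes> y = c \<odot> (x \<otimes> y)"
    and smult_mult_right: "x \<in> carrier A \<Longrightarrow> y \<in> carrier A \<Longrightarrow> x \<otimes> (c \<odot> y) = c \<odot> (x \<otimes> y)"
begin

definition linear_functional :: "('b \<Rightarrow> rat) \<Rightarrow> bool" where
  "linear_functional \<phi> \<longleftrightarrow> (\<forall>x\<in>carrier A. \<forall>y\<in>carrier A. \<phi> (x \<oplus> y) = \<phi> x + \<phi> y) \<and>
     (\<forall>c. \<forall>x\<in>carrier A. \<phi> (c \<odot> x) = c * \<phi> x)"

definition subspace_closed :: "'b set \<Rightarrow> bool" where
  "subspace_closed W \<longleftrightarrow> \<zero> \<in> W \<and> (\<forall>x\<in>W. \<forall>y\<in>W. x \<oplus> y \<in> W) \<and> (\<forall>c. \<forall>x\<in>W. c \<odot> x \<in> W)"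

lemma functional_zero: assumes "linear_functional \<phi>" shows "\<phi> \<zero> = 0"
proof -
  interpret ring A by (rule ring)
  have "\<phi> (\<zero> \<oplus> \<zero>) = \<phi> \<zero> + \<phi> \<zero>"
    using assms zero_closed unfolding linear_functional_def by blast
  then show ?thesis by simp
qed

lemma vectorspace: "vectorspace class_ring A"
proof -
  interpret ring A by (rule ring)
  have "module class_ring A"
    by (rule moduleI)
      (use smult_closed smult_l_distr smult_r_distr smult_assoc smult_one is_abelian_group
        in \<open>auto simp: class_cring.is_cring\<close>)
  then show ?thesis by (intro vectorspace.intro class_field)
qed

text \<open>Dual functionals give injectivity and independence. Spanning is phrased through
  subspaces \<open>W\<close> so that it can be pulled back along quotient maps.\<close>

lemma rat_basisI:
  assumes v: "\<And>m. m \<in> M \<Longrightarrow> v m \<in> carrier A"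
    and span: "\<And>W. \<lbrakk>subspace_closed W; \<And>m. m \<in> M \<Longrightarrow> v m \<in> W\<rbrakk> \<Longrightarrow> carrier A \<subseteq> W"
    and dual: "\<And>m. m \<in> M \<Longrightarrow> \<exists>\<phi>. linear_functional \<phi> \<and> (\<forall>m'\<in>M. \<phi> (v m') = (if m' = m then 1 else 0))"
  shows "rat_basis A v M"
proof -
  interpret V: vectorspace class_ring A by (rule vectorspace)
  have inj: "inj_on v M"
  proof (rule inj_onI)
    fix m m' assume m: "m \<in> M" "m' \<in> M" "v m = v m'"
    obtain \<phi> where \<phi>: "\<forall>m'\<in>M. \<phi> (v m') = (if m' = m then 1 else (0 :: rat))" using dual[OF m(1)] by blast
    have "\<phi> (v m) = 1" "\<phi> (v m') = (if m' = m then 1 else 0)"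
      using \<phi>[rule_format, OF m(1)] \<phi>[rule_format, OF m(2)] by simp_all
    then show "m = m'" unfolding m(3) by (simp split: if_splits)
  qed
  have vM: "v ` M \<subseteq> carrier A" using v by blast
  have "V.lin_indpt (v ` M)"
  proof
    assume "V.lin_dep (v ` M)"
    then obtain B a w where B: "finite B" "B \<subseteq> v ` M" "V.lincomb a B = \<zero>" "w \<in> B" "a w \<noteq> 0"
      unfolding V.lin_dep_def by auto
    obtain m where m: "m \<in> M" "w = v m" using B by blast
    obtain \<phi> where \<phi>: "linear_functional \<phi>" "\<And>m'. m' \<in> M \<Longrightarrow> \<phi> (v m') = (if m' = m then 1 else 0)"
      using dual[OF m(1)] by blast
    have zero: "\<phi> \<zero> = 0" by (rule functional_zero[OF \<phi>(1)])
    have "\<phi> (V.lincomb a C) = (\<Sum>x\<in>C. a x * \<phi> x)" if "C \<subseteq> B" for C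
      using finite_subset[OF that B(1)] that
    proof (induction C)
      case empty
      then show ?case by (simp add: V.lincomb_def zero)
    next
      case (insert x C)
      have C: "C \<subseteq> carrier A" "x \<in> carrier A" using insert.prems B(2) vM by auto
      have "V.lincomb a (insert x C) = a x \<odot> x \<oplus> V.lincomb a C"
        using V.lincomb_insert[OF insert.hyps(1) C(1) _ insert.hyps(2) C(2), of a] by simp
      moreover have "V.lincomb a C \<in> carrier A" using C by (intro V.lincomb_closed) auto
      ultimately have "\<phi> (V.lincomb a (insert x C)) = a x * \<phi> x + \<phi> (V.lincomb a C)"
        using \<phi>(1) C smult_closed unfolding linear_functional_def by simp
      then show ?case using insert by simp
    qed
    from this[of B] have "(\<Sum>x\<in>B. a x * \<phi> x) = 0" using B(3) zero by simp
    moreover have "a x * \<phi> x = (if x = w then a w else 0)" if xB: "x \<in> B" for x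
    proof -
      obtain m' where "x = v m'" "m' \<in> M" using subsetD[OF B(2) xB] by (elim imageE)
      then show ?thesis using \<phi>(2) m inj by (auto simp: inj_on_def)
    qed
    ultimately show False using B by simp
  qed
  moreover have "carrier A \<subseteq> V.span (v ` M)"
  proof (rule span)
    have sub: "submodule class_ring (V.span (v ` M)) A" by (rule V.span_is_submodule[OF vM])
    show "subspace_closed (V.span (v ` M))"
      unfolding subspace_closed_def
      using submodule.zero_closed[OF sub] submodule.m_closed[OF sub] submodule.smult_closed[OF sub] by simp
    show "v m \<in> V.span (v ` M)" if "m \<in> M" for m using that V.in_own_span[OF vM] by blast
  qed
  then have "V.gen_set (v ` M)" using V.span_is_subset2[OF vM] by blast
  ultimately show ?thesis unfolding rat_basis_def V.basis_def using inj vM by blast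
qed

text \<open>The elements all of whose two-sided multiples are killed by \<open>\<phi>\<close> form
  an ideal containing \<open>S\<close>.\<close>

lemma functional_ideal:
  assumes \<phi>: "linear_functional \<phi>" and S: "S \<subseteq> carrier A"
    and vanish: "\<And>h f k. \<lbrakk>f \<in> S; h \<in> carrier A; k \<in> carrier A\<rbrakk> \<Longrightarrow> \<phi> (h \<otimes> f \<otimes> k) = 0"
    and f: "f \<in> Idl S"
  shows "\<phi> f = 0"
proof -
  interpret ring A by (rule ring)
  have zero: "\<phi> \<zero> = 0" by (rule functional_zero[OF \<phi>])
  have add: "\<phi> (x \<oplus> y) = \<phi> x + \<phi> y" if "x \<in> carrier A" "y \<in> carrier A" for x y
    using \<phi> that by (simp add: linear_functional_def)
  let ?I = "{f \<in> carrier A. \<forall>h\<in>carrier A. \<forall>k\<in>carrier A. \<phi> (h \<otimes> f \<otimes> k) = 0}"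
  have "ideal ?I A"
  proof (rule idealI[OF ring])
    show "subgroup ?I (add_monoid A)"
    proof
      fix x assume x: "x \<in> ?I"
      have "\<phi> (h \<otimes> (\<ominus> x) \<otimes> k) = 0" if hk: "h \<in> carrier A" "k \<in> carrier A" for h k
      proof -
        have "h \<otimes> x \<otimes> k \<oplus> h \<otimes> (\<ominus> x) \<otimes> k = \<zero>"
          using x hk by (simp add: r_minus l_minus r_neg)
        then have "\<phi> (h \<otimes> x \<otimes> k) + \<phi> (h \<otimes> (\<ominus> x) \<otimes> k) = 0"
          using add[of "h \<otimes> x \<otimes> k" "h \<otimes> (\<ominus> x) \<otimes> k"] x hk zero by simp
        then show ?thesis using x hk by simp
      qed
      then have "\<ominus> x \<in> ?I" using x by simp
      then show "inv\<^bsub>add_monoid A\<^esub> x \<in> ?I" by (simp add: a_inv_def)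
    qed (auto simp: l_distr r_distr add zero)
  next
    fix a x assume ax: "a \<in> ?I" "x \<in> carrier A"
    have "\<phi> (h \<otimes> (x \<otimes> a) \<otimes> k) = 0" if "h \<in> carrier A" "k \<in> carrier A" for h k
    proof -
      have "h \<otimes> (x \<otimes> a) \<otimes> k = (h \<otimes> x) \<otimes> a \<otimes> k" using ax that by (simp add: m_assoc)
      then show ?thesis using ax that by auto
    qed
    then show "x \<otimes> a \<in> ?I" using ax by simp
    have "\<phi> (h \<otimes> (a \<otimes> x) \<otimes> k) = 0" if "h \<in> carrier A" "k \<in> carrier A" for h k
    proof -
      have "h \<otimes> (a \<otimes> x) \<otimes> k = h \<otimes> a \<otimes> (x \<otimes> k)" using ax that by (simp add: m_assoc)
      then show ?thesis using ax that by auto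
    qed
    then show "a \<otimes> x \<in> ?I" using ax by simp
  qed
  moreover have "S \<subseteq> ?I" using S vanish by blast
  ultimately have "f \<in> ?I" using genideal_minimal f by blast
  then have "\<phi> (\<one> \<otimes> f \<otimes> \<one>) = 0" "f \<in> carrier A" using one_closed by blast+
  then show ?thesis by simp
qed

end

section \<open>Quotients by ideals\<close>

locale rat_algebra_ideal = rat_algebra A + ideal I A for A :: "(rat, 'b) module" (structure) and I
begin

abbreviation "Q \<equiv> quot_algebra A I"

lemma quot_carrier: "carrier Q = {I +> a | a. a \<in> carrier A}"
  by (auto simp: quot_algebra_def FactRing_def A_RCOSETS_def')

lemma quot_ops:
  "a \<in> carrier A \<Longrightarrow> b \<in> carrier A \<Longrightarrow> (I +> a) \<oplus>\<^bsub>Q\<^esub> (I +> b) = I +> (a \<oplus> b)"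
  "a \<in> carrier A \<Longrightarrow> b \<in> carrier A \<Longrightarrow> (I +> a) \<otimes>\<^bsub>Q\<^esub> (I +> b) = I +> (a \<otimes> b)"
  "\<zero>\<^bsub>Q\<^esub> = I" "\<one>\<^bsub>Q\<^esub> = I +> \<one>"
  by (simp_all add: quot_algebra_def FactRing_def a_rcos_sum rcoset_mult_add)

lemma coset_mem: "a \<in> I \<Longrightarrow> I +> a = I"
  using a_coset_join2 a_subgroup a_subset by blast

lemma smult_ideal: "x \<in> I \<Longrightarrow> c \<odot> x \<in> I"
proof -
  assume x: "x \<in> I"
  then have xA: "x \<in> carrier A" using a_subset by blast
  have "(c \<odot> \<one>) \<otimes> x \<in> I" using x smult_closed by (intro I_l_closed) auto
  then show ?thesis using xA by (simp add: smult_mult_left)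
qed

text \<open>The scalar multiple of a coset is a union over its representatives, all of which yield
  the same coset.\<close>

lemma quot_smult: "a \<in> carrier A \<Longrightarrow> c \<odot>\<^bsub>Q\<^esub> (I +> a) = I +> (c \<odot> a)"
proof -
  assume a: "a \<in> carrier A"
  have "\<forall>x\<in>I +> a. I +> (c \<odot> x) = I +> (c \<odot> a)"
  proof
    fix x assume x: "x \<in> I +> a"
    obtain i where i: "i \<in> I" "x = i \<oplus> a" using x by (auto simp: a_r_coset_def')
    then have iA: "i \<in> carrier A" using a_subset by blast
    have ci: "c \<odot> i \<in> I" "c \<odot> i \<in> carrier A" "c \<odot> a \<in> carrier A" using smult_ideal i iA a smult_closed by auto
    have "c \<odot> x = c \<odot> i \<oplus> c \<odot> a" using i iA a by (simp add: smult_r_distr)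
    then have "I +> (c \<odot> x) = (I +> (c \<odot> i)) <+> (I +> (c \<odot> a))" using ci a_rcos_sum by simp
    also have "\<dots> = (I +> \<zero>) <+> (I +> (c \<odot> a))" using coset_mem[OF ci(1)] a_coset_add_zero a_subset by simp
    also have "\<dots> = I +> (c \<odot> a)" using a_rcos_sum[of \<zero> "c \<odot> a"] ci by simp
    finally show "I +> (c \<odot> x) = I +> (c \<odot> a)" .
  qed
  then have "(\<Union>x\<in>I +> a. I +> (c \<odot> x)) = I +> (c \<odot> a)"
    by (rule UN_constant_eq[OF a_rcos_self[OF a]])
  then show ?thesis by (simp add: quot_algebra_def)
qed

lemma quot_rat_algebra: "rat_algebra Q"
proof (rule rat_algebra.intro)
  have eq: "carrier Q = carrier (A Quot I)" "mult Q = mult (A Quot I)" "one Q = one (A Quot I)"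
    "zero Q = zero (A Quot I)" "add Q = add (A Quot I)" by (simp_all add: quot_algebra_def)
  have R: "ring (A Quot I)" by (rule quotient_is_ring)
  show "ring Q"
  proof (rule ringI)
    interpret q: ring "A Quot I" by (rule R)
    have inv: "\<exists>y\<in>carrier (A Quot I). y \<oplus>\<^bsub>A Quot I\<^esub> x = \<zero>\<^bsub>A Quot I\<^esub>"
      if "x \<in> carrier (A Quot I)" for x
      using q.a_inv_closed[OF that] q.l_neg[OF that] by blast
    show "abelian_group Q"
      by (rule abelian_groupI) (simp_all add: eq q.a_assoc q.a_comm q.a_lcomm inv)
    show "Group.monoid Q" by (rule monoidI) (simp_all add: eq q.m_assoc)
  qed (use R in \<open>simp_all add: eq ring.ring_simprules\<close>)
qed (auto simp: quot_carrier quot_smult quot_ops smult_closed smult_l_distr smult_r_distr smult_assoc smult_one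
    smult_mult_left smult_mult_right)

lemma quot_functional:
  assumes \<phi>: "linear_functional \<phi>" and I: "\<And>x. x \<in> I \<Longrightarrow> \<phi> x = 0"
  obtains \<phi>' where "rat_algebra.linear_functional Q \<phi>'" "\<And>a. a \<in> carrier A \<Longrightarrow> \<phi>' (I +> a) = \<phi> a"
proof -
  define \<phi>' where "\<phi>' = (\<lambda>X. \<phi> (SOME x. x \<in> X))"
  have *: "\<phi>' (I +> a) = \<phi> a" if a: "a \<in> carrier A" for a
  proof -
    have "(SOME x. x \<in> I +> a) \<in> I +> a" using a_rcos_self[OF a] by (rule someI)
    then obtain i where i: "i \<in> I" "(SOME x. x \<in> I +> a) = i \<oplus> a" by (auto simp: a_r_coset_def')
    then have "i \<in> carrier A" using a_subset by blast
    then have "\<phi> (i \<oplus> a) = \<phi> i + \<phi> a" using \<phi> a by (simp add: linear_functional_def)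
    then show ?thesis using i I by (simp add: \<phi>'_def)
  qed
  have "rat_algebra.linear_functional Q \<phi>'"
    unfolding rat_algebra.linear_functional_def[OF quot_rat_algebra] quot_carrier
    using \<phi> by (auto simp: quot_ops quot_smult * smult_closed linear_functional_def)
  then show thesis using that * by blast
qed

lemma quot_span:
  assumes W: "rat_algebra.subspace_closed Q W"
  shows "subspace_closed {a \<in> carrier A. I +> a \<in> W}"
proof -
  interpret ring A by (rule ring)
  have smult: "c \<odot>\<^bsub>Q\<^esub> (I +> x) \<in> W" if "I +> x \<in> W" for c x
    using W that unfolding rat_algebra.subspace_closed_def[OF quot_rat_algebra] by blast
  have add: "(I +> x) \<oplus>\<^bsub>Q\<^esub> (I +> y) \<in> W" if "I +> x \<in> W" "I +> y \<in> W" for x y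
    using W that unfolding rat_algebra.subspace_closed_def[OF quot_rat_algebra] by blast
  have zero: "I +> \<zero> \<in> W"
    using W a_coset_add_zero[OF a_subset]
    unfolding rat_algebra.subspace_closed_def[OF quot_rat_algebra] quot_ops(3) by simp
  show ?thesis
    unfolding subspace_closed_def
  proof (intro conjI ballI allI)
    show "x \<oplus> y \<in> {a \<in> carrier A. I +> a \<in> W}"
      if "x \<in> {a \<in> carrier A. I +> a \<in> W}" "y \<in> {a \<in> carrier A. I +> a \<in> W}" for x y
    proof -
      have xy: "x \<in> carrier A" "y \<in> carrier A" "I +> x \<in> W" "I +> y \<in> W" using that by blast+
      have "I +> (x \<oplus> y) \<in> W" unfolding quot_ops(1)[OF xy(1,2), symmetric] by (rule add[OF xy(3,4)])
      then show ?thesis using xy by blast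
    qed
    show "c \<odot> x \<in> {a \<in> carrier A. I +> a \<in> W}" if "x \<in> {a \<in> carrier A. I +> a \<in> W}" for c x
    proof -
      have x: "x \<in> carrier A" "I +> x \<in> W" using that by blast+
      have "I +> (c \<odot> x) \<in> W" unfolding quot_smult[OF x(1), symmetric] by (rule smult[OF x(2)])
      then show ?thesis using smult_closed[OF x(1)] by blast
    qed
    show "\<zero> \<in> {a \<in> carrier A. I +> a \<in> W}" using zero zero_closed by simp
  qed
qed

end

lemma gc_rat_algebra: "rat_algebra (gc_algebra H r)"
  by (rule rat_algebra.intro)
    (auto simp: gc_algebra_ring gc_algebra_simps gc_carrier_closed gc_scale_add gc_scale_add_left gc_mult_scale)

section \<open>The monomials span\<close>

lemma gc_mult_sum_left: "gc_mult r (sum u A) h = (\<Sum>a\<in>A. gc_mult r (u a) h)"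
  by (induction A rule: infinite_finite_induct) (simp_all add: gc_mult_add_left)

lemma gc_mult_sum_right: "gc_mult r h (sum u A) = (\<Sum>a\<in>A. gc_mult r h (u a))"
  by (induction A rule: infinite_finite_induct) (simp_all add: gc_mult_add_right)

lemma gc_scale_eq_single: "gc_scale c (gc_monom S b) = Poly_Mapping.single (S, b) c"
  by (simp add: poly_mapping_eq_iff fun_eq_iff gc_monom_def lookup_single when_def)

section \<open>Polynomial multiples of an exterior monomial\<close>

lemma x_exponent_simps [simp]:
  "x_exponent {} = 0" "finite T \<Longrightarrow> g \<notin> T \<Longrightarrow> x_exponent (insert g T) = Poly_Mapping.single g 1 + x_exponent T"
  by (simp_all add: x_exponent_def)

lemma lookup_x_exponent: "finite T \<Longrightarrow> Poly_Mapping.lookup (x_exponent T) g = (if g \<in> T then 1 else 0)"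
  by (simp add: x_exponent_def lookup_sum lookup_single when_def)

lemma prod_X: "finite T \<Longrightarrow> prod X T = Poly_Mapping.single (x_exponent T) 1"
  by (induction T rule: finite_induct) (simp_all add: X_def mult_single)

lemma keys_x_exponent: "finite T \<Longrightarrow> Poly_Mapping.keys (x_exponent T) = T"
  by (auto simp: in_keys_iff lookup_x_exponent split: if_splits)

text \<open>The map sending \<open>q\<close> to \<open>e_S q\<close>, which transports computations
  from the commutative ring \<open>'a pol\<close>; for \<open>S = {}\<close> it embeds the
  polynomial ring.\<close>

definition e_times :: "'a set \<Rightarrow> 'a pol \<Rightarrow> 'a gc_elt" where
  "e_times S q = (\<Sum>b\<in>Poly_Mapping.keys q. Poly_Mapping.single (S, b) (Poly_Mapping.lookup q b))"

lemma lookup_e_times: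
  "Poly_Mapping.lookup (e_times S q) m = (if fst m = S then Poly_Mapping.lookup q (snd m) else 0)"
  by (cases m) (simp add: e_times_def lookup_sum lookup_single when_def in_keys_iff)

lemma e_times_add: "e_times S (f + g) = e_times S f + e_times S g"
  and e_times_uminus: "e_times S (- f) = gc_scale (-1) (e_times S f)"
  and e_times_zero [simp]: "e_times S 0 = 0"
  and e_times_single: "e_times S (Poly_Mapping.single b c) = gc_scale c (gc_monom S b)"
  by (auto simp: poly_mapping_eq_iff fun_eq_iff lookup_e_times lookup_add gc_monom_def lookup_single when_def)

lemma e_times_sum: "e_times S (sum f A) = (\<Sum>a\<in>A. e_times S (f a))"
  by (induction A rule: infinite_finite_induct) (simp_all add: e_times_add)

lemma e_times_one: "e_times S 1 = gc_monom S 0"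
  using e_times_single[of S 0 1] by simp

lemma gc_monom_x_mult: "gc_mult r (gc_monom {} b) (gc_monom S b') = gc_monom S (b + b')"
  by (simp add: gc_mult_monom gc_monom_mult_def inversions_def)

lemma gc_monom_mult_x: "gc_mult r (gc_monom S b) (gc_monom {} b') = gc_monom S (b + b')"
  by (simp add: gc_mult_monom gc_monom_mult_def inversions_def)

lemma e_times_mult: "gc_mult r (e_times {} f) (e_times S q) = e_times S (f * q)"
proof -
  have s: "gc_mult r (e_times {} (Poly_Mapping.single b c)) (e_times S (Poly_Mapping.single b' c')) =
      e_times S (Poly_Mapping.single b c * Poly_Mapping.single b' c')" for b c b' c'
    by (simp add: e_times_single mult_single gc_mult_scale gc_monom_x_mult mult.commute[of c' c])
  have "gc_mult r (e_times {} (\<Sum>b\<in>A. Poly_Mapping.single b (Poly_Mapping.lookup f b)))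
      (e_times S (\<Sum>b\<in>B. Poly_Mapping.single b (Poly_Mapping.lookup q b))) =
    e_times S ((\<Sum>b\<in>A. Poly_Mapping.single b (Poly_Mapping.lookup f b)) *
      (\<Sum>b\<in>B. Poly_Mapping.single b (Poly_Mapping.lookup q b)))" for A B
    by (simp add: e_times_sum gc_mult_sum_left gc_mult_sum_right s sum_distrib_left sum_distrib_right)
  from this[of "Poly_Mapping.keys f" "Poly_Mapping.keys q"] show ?thesis by (simp only: sum_singles)
qed

section \<open>The free algebra and its defining ideal\<close>

locale nested_algebra = building L G for L :: "'a gorder" (structure) and G +
  fixes H :: "'a set" and r :: "'a rel"
  assumes H: "pbs H" and r: "compatible_order L H r"
begin

abbreviation "R \<equiv> gc_algebra H r"
abbreviation "I \<equiv> Bhat_ideal L H r"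

lemma linear: "linear_order_on H r"
  using r by (simp add: compatible_order_def)

lemma r_antisym: "(x, y) \<in> r \<Longrightarrow> (y, x) \<in> r \<Longrightarrow> x = y"
  and r_trans: "(x, y) \<in> r \<Longrightarrow> (y, z) \<in> r \<Longrightarrow> (x, z) \<in> r"
  and r_total: "x \<in> H \<Longrightarrow> y \<in> H \<Longrightarrow> (x, y) \<in> r \<or> (y, x) \<in> r"
  and r_refl: "x \<in> H \<Longrightarrow> (x, x) \<in> r"
  and r_H: "(x, y) \<in> r \<Longrightarrow> x \<in> H \<and> y \<in> H"
proof -
  have l: "r \<subseteq> H \<times> H" "refl_on H r" "trans r" "antisym r" "total_on H r"
    using linear by (auto simp: order_on_defs)
  show "(x, y) \<in> r \<Longrightarrow> (y, x) \<in> r \<Longrightarrow> x = y" using l(4) by (rule antisymD)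
  show "(x, y) \<in> r \<Longrightarrow> (y, z) \<in> r \<Longrightarrow> (x, z) \<in> r" using l(3) by (rule transD)
  show "(x, y) \<in> r \<Longrightarrow> x \<in> H \<and> y \<in> H" using l(1) by blast
  show refl: "x \<in> H \<Longrightarrow> (x, x) \<in> r" for x using l(2) by (rule refl_onD)
  show "x \<in> H \<Longrightarrow> y \<in> H \<Longrightarrow> (x, y) \<in> r \<or> (y, x) \<in> r"
    using l(5) refl[of x] by (cases "x = y") (simp_all add: total_on_def)
qed

lemma nested_sets_iff: "S \<in> nested_sets L H \<longleftrightarrow> S \<subseteq> H \<and> nested H S"
  using nested_sets_eq[OF H] by blast

lemma sub_H: "S \<subseteq> H \<Longrightarrow> finite S" "S \<subseteq> H \<Longrightarrow> S \<subseteq> E"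
  using pbs_finite[OF H] pbs_E[OF H] finite_subset by blast+

lemma relations_carrier: "Bhat_relations L H r \<subseteq> carrier R"
proof -
  have sum: "sum u A \<in> carrier R" if "\<And>a. a \<in> A \<Longrightarrow> u a \<in> carrier R" for u :: "'x \<Rightarrow> 'a gc_elt" and A
    using that by (induction A rule: infinite_finite_induct) (auto simp: gc_carrier_closed)
  have mono: "gc_monom S (x_exponent T) \<in> carrier R" if "S \<subseteq> H" "T \<subseteq> H" for S T
    using that sub_H(1) keys_x_exponent[OF sub_H(1)[OF that(2)]] by (intro gc_carrier_closed(4)) auto
  have bd: "e_boundary r S \<in> carrier R" if "nested_circuit L H r S" for S
  proof -
    have "S \<subseteq> H" using that nested_circuit_iff[OF H r] nested_sets_iff by blast
    then show ?thesis unfolding e_boundary_def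
      using sub_H by (intro sum gc_carrier_closed(2,4)) auto
  qed
  have xs: "x_sum_above L H g \<in> carrier R" for g
    unfolding x_sum_above_def by (intro sum mono) auto
  show ?thesis unfolding Bhat_relations_def using mono bd xs by blast
qed

lemma ideal_I: "ideal I R"
  unfolding Bhat_ideal_def by (rule ring.genideal_ideal[OF gc_algebra_ring relations_carrier])

lemma relations_I: "f \<in> Bhat_relations L H r \<Longrightarrow> f \<in> I"
  unfolding Bhat_ideal_def using ring.genideal_self[OF gc_algebra_ring relations_carrier] by blast

sublocale RI: rat_algebra_ideal R I
  by (rule rat_algebra_ideal.intro[OF gc_rat_algebra ideal_I])

lemma I_carrier: "f \<in> I \<Longrightarrow> f \<in> carrier R"
  using RI.a_subset by blast

lemma I_zero: "0 \<in> I" and I_add: "f \<in> I \<Longrightarrow> g \<in> I \<Longrightarrow> f + g \<in> I"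
  and I_scale: "f \<in> I \<Longrightarrow> gc_scale c f \<in> I"
  and I_mult_left: "f \<in> I \<Longrightarrow> h \<in> carrier R \<Longrightarrow> gc_mult r h f \<in> I"
  and I_mult_right: "f \<in> I \<Longrightarrow> h \<in> carrier R \<Longrightarrow> gc_mult r f h \<in> I"
  using RI.zero_closed RI.a_closed RI.smult_ideal RI.I_l_closed RI.I_r_closed
    additive_subgroup.zero_closed[OF RI.additive_subgroup_axioms]
    additive_subgroup.a_closed[OF RI.additive_subgroup_axioms]
  by (simp_all add: gc_algebra_simps)

lemma monom_carrier: "S \<subseteq> H \<Longrightarrow> Poly_Mapping.keys b \<subseteq> H \<Longrightarrow> gc_monom S b \<in> carrier R"
  using sub_H by (intro gc_carrier_closed(4)) auto

text \<open>The type \<open>'a pol\<close> has a variable for every element of \<open>'a\<close>,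
  the free algebra only for those of \<open>H\<close>.\<close>

definition H_pol :: "'a pol set" where
  "H_pol = {q. \<forall>b\<in>Poly_Mapping.keys q. Poly_Mapping.keys b \<subseteq> H}"

lemma e_times_carrier: "S \<subseteq> H \<Longrightarrow> q \<in> H_pol \<Longrightarrow> e_times S q \<in> carrier R"
  using sub_H(1)[of S]
  by (auto simp: gc_algebra_def H_pol_def in_keys_iff lookup_e_times split: if_splits)

lemma relation_ideal_e_times:
  assumes S: "S \<subseteq> H" shows "relation_ideal L G H S X H_pol {q. e_times S q \<in> I}"
proof (intro relation_ideal.intro relation_ideal_axioms.intro building_axioms)
  show "pbs H" "S \<subseteq> H" by (fact H, fact S)
  show "f + g \<in> H_pol" if "f \<in> H_pol" "g \<in> H_pol" for f g
    using that keys_add[of f g] by (auto simp: H_pol_def)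
  show fg: "f * g \<in> H_pol" if "f \<in> H_pol" "g \<in> H_pol" for f g
  proof -
    have "Poly_Mapping.keys b \<subseteq> H" if b: "b \<in> Poly_Mapping.keys (f * g)" for b
    proof -
      obtain b1 b2 where "b = b1 + b2" "b1 \<in> Poly_Mapping.keys f" "b2 \<in> Poly_Mapping.keys g"
        using keys_mult[of f g] b by blast
      then show ?thesis using keys_add[of b1 b2] \<open>f \<in> H_pol\<close> \<open>g \<in> H_pol\<close> by (auto simp: H_pol_def)
    qed
    then show ?thesis by (auto simp: H_pol_def)
  qed
  show "1 \<in> H_pol" by (auto simp: H_pol_def simp flip: single_one split: if_splits)
  show "- f \<in> H_pol" if "f \<in> H_pol" for f using that by (auto simp: H_pol_def in_keys_iff)
  show "X h \<in> H_pol" if "h \<in> H" for h using that by (auto simp: H_pol_def X_def)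
  show "0 \<in> {q. e_times S q \<in> I}" using I_zero by simp
  show "f + g \<in> {q. e_times S q \<in> I}" if "f \<in> {q. e_times S q \<in> I}" "g \<in> {q. e_times S q \<in> I}" for f g
    using that I_add by (simp add: e_times_add)
  show mult: "f * g \<in> {q. e_times S q \<in> I}" if "f \<in> H_pol" "g \<in> {q. e_times S q \<in> I}" for f g
    using that I_mult_left[OF _ e_times_carrier[of "{}" f], of "e_times S g"] by (simp add: e_times_mult)
  show "(\<Sum>h\<in>{h \<in> H. a \<sqsubseteq> h}. X h) \<in> {q. e_times S q \<in> I}" if a: "a \<in> At" for a
  proof -
    have "e_times {} (\<Sum>h\<in>{h \<in> H. a \<sqsubseteq> h}. X h) = x_sum_above L H a"
      by (simp add: e_times_sum x_sum_above_def X_def e_times_single)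
    then have "e_times {} (\<Sum>h\<in>{h \<in> H. a \<sqsubseteq> h}. X h) \<in> I"
      using relations_I a by (auto simp: Bhat_relations_def)
    moreover have "e_times S 1 \<in> carrier R" using S by (simp add: e_times_one monom_carrier)
    ultimately have "gc_mult r (e_times {} (\<Sum>h\<in>{h \<in> H. a \<sqsubseteq> h}. X h)) (e_times S 1) \<in> I"
      by (rule I_mult_right)
    then show ?thesis by (simp only: e_times_mult mult_1_right mem_Collect_eq)
  qed
  show "prod X T \<in> {q. e_times S q \<in> I}" if T: "T \<subseteq> H" "\<not> nested H (S \<union> T)" for T
  proof -
    have "gc_monom S (x_exponent T) \<in> Bhat_relations L H r"
      using S T nested_sets_iff by (auto simp: Bhat_relations_def)
    then have "gc_monom S (x_exponent T) \<in> I" by (rule relations_I)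
    then show ?thesis using sub_H T by (simp add: prod_X e_times_single)
  qed
qed

subsection \<open>Termination of the rewriting\<close>

definition depth :: "'a \<Rightarrow> nat" where "depth h = card At - card (below h)"

text \<open>Replacing a variable by one higher up lowers the cost. A circuit relation leaves it
  unchanged and lowers the sum of positions in \<open>S\<close>. So cost plus positions drops in
  every rewriting step.\<close>

definition cost :: "('a \<Rightarrow>\<^sub>0 nat) \<Rightarrow> nat" where
  "cost b = (\<Sum>h\<in>H. Poly_Mapping.lookup b h * depth h)"

definition position :: "'a \<Rightarrow> nat" where "position s = card {h \<in> H. (h, s) \<in> r}"

lemma depth_less: "g \<in> E \<Longrightarrow> h \<in> E \<Longrightarrow> g \<sqsubset> h \<Longrightarrow> depth h < depth g"
proof -
  assume gh: "g \<in> E" "h \<in> E" "g \<sqsubset> h"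
  then have "below g \<subset> below h"
    using le_iff_below[OF gh(1,2)] le_iff_below[OF gh(2,1)] le_antisym[of g h] by (auto simp: less_iff)
  then have "card (below g) < card (below h)" using below_subset(3) by (rule psubset_card_mono[rotated])
  moreover have "card (below h) \<le> card At" using below_subset finite_At by (intro card_mono) auto
  ultimately show ?thesis by (simp add: depth_def)
qed

lemma cost_add: "cost (b + b') = cost b + cost b'"
  by (simp add: cost_def lookup_add distrib_right sum.distrib)

lemma cost_single: "h \<in> H \<Longrightarrow> cost (Poly_Mapping.single h n) = n * depth h"
proof -
  assume h: "h \<in> H"
  have "cost (Poly_Mapping.single h n) = (\<Sum>k\<in>H. if k = h then n * depth h else 0)"
    unfolding cost_def by (intro sum.cong) (auto simp: lookup_single when_def)
  then show ?thesis using h pbs_finite[OF H] by simp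
qed

lemma position_less:
  assumes "(g, c) \<in> r" "g \<noteq> c" shows "position g < position c"
  unfolding position_def
proof (rule psubset_card_mono)
  show "finite {h \<in> H. (h, c) \<in> r}" using pbs_finite[OF H] by simp
  have "c \<in> {h \<in> H. (h, c) \<in> r}" "c \<notin> {h \<in> H. (h, g) \<in> r}"
    using assms r_refl r_H r_antisym by blast+
  moreover have "{h \<in> H. (h, g) \<in> r} \<subseteq> {h \<in> H. (h, c) \<in> r}" using assms r_trans by blast
  ultimately show "{h \<in> H. (h, g) \<in> r} \<subset> {h \<in> H. (h, c) \<in> r}" by blast
qed

text \<open>Every monomial of the power other than that of \<open>X g ^ n\<close> has a factor
  \<open>X h\<close> with \<open>h\<close> strictly above \<open>g\<close>, hence of smaller
  depth.\<close>

lemma above_power_leading: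
  assumes g: "g \<in> H"
  defines "a \<equiv> (\<Sum>h\<in>{h \<in> H. g \<sqsubseteq> h}. X h)"
  shows "\<forall>m\<in>Poly_Mapping.keys (a ^ n - X g ^ n). Poly_Mapping.keys m \<subseteq> H \<and> cost m < n * depth g"
proof (induction n)
  case (Suc n)
  have gE: "g \<in> E" using g pbs_E[OF H] by blast
  have split: "{h \<in> H. g \<sqsubseteq> h} = insert g {h \<in> H. g \<sqsubset> h}" using g le_refl[OF gE] by (auto simp: less_iff)
  have fin: "finite {h \<in> H. g \<sqsubset> h}" "g \<notin> {h \<in> H. g \<sqsubset> h}" using pbs_finite[OF H] by (auto simp: less_iff)
  have aX: "a = X g + (\<Sum>h\<in>{h \<in> H. g \<sqsubset> h}. X h)" unfolding a_def split using fin by simp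
  have keysum: "Poly_Mapping.keys (\<Sum>h\<in>M. X h) \<subseteq> (\<lambda>h. Poly_Mapping.single h 1) ` M" if "finite M" for M
    using that
  proof (induction M)
    case (insert x M)
    then show ?case using keys_add[of "X x" "sum X M"] by (auto simp: X_def split: if_splits)
  qed simp
  have rest: "Poly_Mapping.keys m \<subseteq> H \<and> cost m < depth g" if m: "m \<in> Poly_Mapping.keys (\<Sum>h\<in>{h \<in> H. g \<sqsubset> h}. X h)" for m
  proof -
    obtain h where h: "h \<in> H" "g \<sqsubset> h" "m = Poly_Mapping.single h 1" using m keysum[OF fin(1)] by blast
    then show ?thesis using cost_single[of h 1] depth_less[OF gE _ h(2)] pbs_E[OF H] by auto
  qed
  have all: "Poly_Mapping.keys m \<subseteq> H \<and> cost m \<le> depth g" if m: "m \<in> Poly_Mapping.keys a" for m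
  proof -
    have "m \<in> Poly_Mapping.keys (X g) \<or> m \<in> Poly_Mapping.keys (\<Sum>h\<in>{h \<in> H. g \<sqsubset> h}. X h)"
      using m keys_add[of "X g"] unfolding aX by blast
    then show ?thesis using rest cost_single[OF g, of 1] g by (auto simp: X_def less_imp_le)
  qed
  have "a ^ Suc n - X g ^ Suc n = a * (a ^ n - X g ^ n) + (\<Sum>h\<in>{h \<in> H. g \<sqsubset> h}. X h) * X g ^ n"
    using aX by (simp add: algebra_simps)
  then have sub: "Poly_Mapping.keys (a ^ Suc n - X g ^ Suc n) \<subseteq>
      {m1 + m2 | m1 m2. m1 \<in> Poly_Mapping.keys a \<and> m2 \<in> Poly_Mapping.keys (a ^ n - X g ^ n)} \<union>
      {m1 + m2 | m1 m2. m1 \<in> Poly_Mapping.keys (\<Sum>h\<in>{h \<in> H. g \<sqsubset> h}. X h) \<and> m2 \<in> Poly_Mapping.keys (X g ^ n)}"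
    using keys_add[of "a * (a ^ n - X g ^ n)" "(\<Sum>h\<in>{h \<in> H. g \<sqsubset> h}. X h) * X g ^ n"]
      keys_mult[of a "a ^ n - X g ^ n"] keys_mult[of "\<Sum>h\<in>{h \<in> H. g \<sqsubset> h}. X h" "X g ^ n"] by auto
  show ?case
  proof
    fix m assume m: "m \<in> Poly_Mapping.keys (a ^ Suc n - X g ^ Suc n)"
    consider m1 m2 where "m = m1 + m2" "m1 \<in> Poly_Mapping.keys a" "m2 \<in> Poly_Mapping.keys (a ^ n - X g ^ n)"
      | m1 m2 where "m = m1 + m2" "m1 \<in> Poly_Mapping.keys (\<Sum>h\<in>{h \<in> H. g \<sqsubset> h}. X h)" "m2 \<in> Poly_Mapping.keys (X g ^ n)"
      using subsetD[OF sub m] by blast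
    then show "Poly_Mapping.keys m \<subseteq> H \<and> cost m < Suc n * depth g"
    proof cases
      case 1
      then show ?thesis using all[OF 1(2)] Suc.IH keys_add[of m1 m2] by (fastforce simp: cost_add)
    next
      case 2
      have "m2 = Poly_Mapping.single g n" using 2(3) by (simp add: X_power)
      then have "cost m2 = n * depth g" "Poly_Mapping.keys m2 \<subseteq> H" using cost_single[OF g] g by auto
      then show ?thesis using 2 rest[OF 2(2)] keys_add[of m1 m2] by (auto simp: cost_add)
    qed
  qed
qed simp

text \<open>All elements involved are atoms, and adding \<open>g\<close> does not change their join,
  which is all that nestedness sees.\<close>

lemma circuit_insert_nested:
  assumes D: "D \<subseteq> H" "nested H D" and c: "circuit (insert g D)" "g \<notin> D"
  shows "nested_circuit L H r (insert g D)"
proof -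
  have sub: "insert g D \<subseteq> At" using c by (simp add: circuit_def)
  then have gD: "insert g D \<subseteq> H" "D \<subseteq> At" "insert g D \<subseteq> E" using pbs_At[OF H] At_E by auto
  have "J D = J (insert g D)" using circuit_J[OF c(1), of g] c(2) by simp
  then have "nested H (insert g D)"
    using nested_cong[OF H, of D "insert g D"] gD sub D by (simp add: Int_absorb2 Diff_eq_empty_iff[THEN iffD2])
  then show ?thesis using nested_circuit_iff[OF H r] nested_sets_iff gD c by blast
qed

text \<open>A monomial outside the basis is non-nested and lies in \<open>I\<close>, or contains a
  broken circuit, or has too large an exponent; in the last two cases a relation expresses it
  through smaller monomials. Letting \<open>W\<close> be any subspace over \<open>I\<close> allows
  reuse for quotients.\<close>

theorem monomials_span:
  assumes W_zero: "0 \<in> W" and W_add: "\<And>f g. f \<in> W \<Longrightarrow> g \<in> W \<Longrightarrow> f + g \<in> W"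
    and W_scale: "\<And>c f. f \<in> W \<Longrightarrow> gc_scale c f \<in> W" and W_I: "I \<subseteq> W"
    and W_basis: "\<And>S b. (S, b) \<in> basis_monomials L H r \<Longrightarrow> gc_monom S b \<in> W"
  shows "carrier R \<subseteq> W"
proof -
  have W_sum: "sum u A \<in> W" if "\<And>a. a \<in> A \<Longrightarrow> u a \<in> W" for u :: "'x \<Rightarrow> 'a gc_elt" and A
    using that by (induction A rule: infinite_finite_induct) (auto simp: W_zero W_add)
  have W_cancel: "f \<in> W" if "f + g \<in> W" "g \<in> W" for f g
  proof -
    have "f + g + gc_scale (-1) g \<in> W" using that W_add W_scale by blast
    moreover have "f + g + gc_scale (-1) g = f" by (simp add: poly_mapping_eq_iff fun_eq_iff lookup_add)
    ultimately show ?thesis by simp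
  qed
  have W_unscale: "f \<in> W" if "gc_scale c f \<in> W" "c \<noteq> 0" for f c
    using W_scale[OF that(1), of "inverse c"] that(2) by simp
  have monom: "gc_monom S b \<in> W" if "S \<subseteq> H" "Poly_Mapping.keys b \<subseteq> H" for S b
    using that
  proof (induction "cost b + sum position S" arbitrary: S b rule: less_induct)
    case less
    let ?T = "Poly_Mapping.keys b"
    have fin: "finite S" "finite ?T" using sub_H less.prems by auto
    consider "\<not> nested H (S \<union> ?T)" | "nested H (S \<union> ?T)" "S \<notin> nbc_sets L H r"
      | g where "nested H (S \<union> ?T)" "g \<in> ?T"
          "interval_rank L (J {f \<in> S \<union> ?T. f \<sqsubset> g}) g \<le> Poly_Mapping.lookup b g"
      | "(S, b) \<in> basis_monomials L H r"
    proof (cases "nested H (S \<union> ?T) \<and> S \<in> nbc_sets L H r \<and>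
        (\<forall>g\<in>?T. Poly_Mapping.lookup b g < interval_rank L (J {f \<in> S \<union> ?T. f \<sqsubset> g}) g)")
      case True
      moreover have "\<forall>g\<in>?T. 0 < Poly_Mapping.lookup b g" by (simp add: in_keys_iff)
      ultimately have "(S, b) \<in> basis_monomials L H r"
        using less.prems nested_sets_iff by (simp add: basis_monomials_def Let_def)
      then show thesis by (rule that(4))
    next
      case False
      then show thesis using that(1-3) not_less by blast
    qed
    then show ?case
    proof cases
      case 1
      let ?b = "b - x_exponent ?T"
      have b: "b = x_exponent ?T + ?b"
        using fin(2) by (simp add: poly_mapping_eq_iff fun_eq_iff lookup_add lookup_minus lookup_x_exponent in_keys_iff)
      have "gc_monom S (x_exponent ?T) \<in> I"
        using 1 less.prems nested_sets_iff by (intro relations_I) (auto simp: Bhat_relations_def)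
      moreover have "Poly_Mapping.keys ?b \<subseteq> H"
        using less.prems(2) by (auto simp: in_keys_iff lookup_minus)
      ultimately have "gc_mult r (gc_monom S (x_exponent ?T)) (gc_monom {} ?b) \<in> I"
        by (intro I_mult_right monom_carrier) auto
      then show ?thesis using b W_I by (simp only: gc_monom_mult_x) (metis subsetD)
    next
      case 2
      have "S \<in> nested_sets L H" using 2(1) less.prems nested_sets_iff nested_mono[of H "S \<union> ?T" S] by blast
      then obtain D where D: "D \<subseteq> S" "broken_circuit L H r D" using 2(2) by (auto simp: nbc_sets_def)
      have "D \<in> nested_sets L H \<and> D \<noteq> {} \<and> (\<exists>g\<in>H. (\<forall>s\<in>D. (g, s) \<in> r \<and> g \<noteq> s) \<and> circuit (insert g D))"
        using D(2) unfolding broken_circuit_iff[OF H r] .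
      then obtain g where g': "D \<in> nested_sets L H" "g \<in> H" "\<forall>s\<in>D. (g, s) \<in> r \<and> g \<noteq> s" "circuit (insert g D)"
        by (elim conjE bexE)
      note g = g'(1,2) g'(3)[rule_format] g'(4)
      have gD: "g \<notin> D" using g(3) by blast
      have DH: "D \<subseteq> H" "nested H D" using g(1) nested_sets_iff by auto
      have "nested_circuit L H r (insert g D)" by (rule circuit_insert_nested[OF DH g(4) gD])
      then have "e_boundary r (insert g D) \<in> I" by (intro relations_I) (auto simp: Bhat_relations_def)
      \<comment> \<open>In the product of the circuit relation with the rest of the monomial,
        omitting \<open>g\<close> yields \<open>e_S\<close> up to sign, and omitting
        \<open>c\<close> yields the set in which \<open>c\<close> is replaced by the earlier
        \<open>g\<close>.\<close>
      then have "gc_mult r (gc_monom (S - D) b) (e_boundary r (insert g D)) \<in> I"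
        using less.prems by (intro I_mult_left monom_carrier) auto
      moreover define t where "t = (\<lambda>c. gc_scale ((-1) ^ card {h \<in> insert g D. h \<noteq> c \<and> (h, c) \<in> r})
        (gc_monom_mult r (S - D, b) (insert g D - {c}, 0)))"
      have "gc_mult r (gc_monom (S - D) b) (e_boundary r (insert g D)) = (\<Sum>c\<in>insert g D. t c)"
        unfolding e_boundary_def t_def by (simp only: gc_mult_sum_right gc_mult_scale gc_mult_monom)
      moreover have "finite D" using D fin finite_subset by blast
      ultimately have "t g + (\<Sum>c\<in>D. t c) \<in> W" using gD W_I by auto
      moreover have "(\<Sum>c\<in>D. t c) \<in> W"
      proof (rule W_sum)
        fix c assume c: "c \<in> D"
        show "t c \<in> W"
        proof (cases "(S - D) \<inter> (insert g D - {c}) = {}")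
          case True
          let ?S = "(S - D) \<union> (insert g D - {c})"
          have eq: "?S = insert g (S - {c})" "g \<notin> S" using True c D gD g(3)[OF c] by auto
          have "sum position ?S = position g + sum position (S - {c})" using eq fin by simp
          moreover have "sum position S = position c + sum position (S - {c})"
            using c D fin by (intro sum.remove) auto
          moreover have "position g < position c" using g(3)[OF c] by (intro position_less) auto
          ultimately have "gc_monom ?S b \<in> W" using less.prems g(2) DH by (intro less.hyps) auto
          then show ?thesis using True by (simp add: t_def gc_monom_mult_def W_scale)
        next
          \<comment> \<open>Here \<open>g\<close> already occurs in \<open>S\<close>, so the product
            vanishes.\<close>
          case False
          then show ?thesis by (simp add: t_def gc_monom_mult_def W_zero)
        qed
      qed
      ultimately have "t g \<in> W" by (rule W_cancel)
      moreover have "(S - D) \<inter> (insert g D - {g}) = {}" "(S - D) \<union> (insert g D - {g}) = S" using gD D by auto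
      then have "t g = gc_scale ((-1) ^ card {h \<in> insert g D. h \<noteq> g \<and> (h, g) \<in> r} *
          (-1) ^ inversions r (S - D) (insert g D - {g})) (gc_monom S b)"
        by (simp add: t_def gc_monom_mult_def)
      ultimately have "gc_scale ((-1) ^ card {h \<in> insert g D. h \<noteq> g \<and> (h, g) \<in> r} *
          (-1) ^ inversions r (S - D) (insert g D - {g})) (gc_monom S b) \<in> W" by (simp only:)
      then show ?thesis by (rule W_unscale) simp
    next
      case (3 g)
      let ?S1 = "{s \<in> S. s \<sqsubset> g}" and ?T1 = "{t \<in> ?T. t \<sqsubset> g}"
      have gH: "g \<in> H" "g \<in> E" using 3(2) less.prems pbs_E[OF H] by auto
      have un: "{f \<in> S \<union> ?T. f \<sqsubset> g} = ?S1 \<union> ?T1" by blast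
      have STE: "?S1 \<union> ?T1 \<subseteq> E" using less.prems pbs_E[OF H] by auto
      have yE: "J (?S1 \<union> ?T1) \<in> E" "J (?S1 \<union> ?T1) \<sqsubseteq> g"
        using STE gH J_closed J_le_iff[OF STE gH(2)] by (auto simp: less_iff)
      obtain B where B: "B \<subseteq> below g" "card B \<le> interval_rank L (J (?S1 \<union> ?T1)) g"
          "J (insert (J (?S1 \<union> ?T1)) B) = g"
        using spanning_atoms[OF yE(1) gH(2) yE(2)] by blast
      let ?n = "card B"
      have n: "?n \<le> Poly_Mapping.lookup b g" using B(2) 3(3) unfolding un by linarith
      have BE: "B \<subseteq> At" "B \<subseteq> E" using B(1) below_subset[of g] by auto
      have "J (?S1 \<union> ?T1 \<union> B) = J ({J (?S1 \<union> ?T1)} \<union> B)"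
        using STE yE BE J_singleton by (intro J_Un_cong) auto
      then have JB: "J (?S1 \<union> ?T1 \<union> B) = g" using B(3) by simp
      interpret rel: relation_ideal L G H S X H_pol "{q. e_times S q \<in> I}"
        by (rule relation_ideal_e_times[OF less.prems(1)])
      have PT: "prod X ?T1 * rel.above g ^ ?n \<in> {q. e_times S q \<in> I}"
        using gH less.prems BE JB finite_sub_E[OF BE(2)]
        by (intro rel.prod_above_power[of B ?S1]) (auto simp: less_iff)
      \<comment> \<open>The relation uses one copy of each variable strictly below \<open>g\<close>
        and the power \<open>?n\<close> of \<open>X g\<close>; \<open>c\<close> is the exponent of
        the remaining factor. Both subtractions are exact.\<close>
      define c where "c = b - x_exponent ?T1 - Poly_Mapping.single g ?n"
      have fT1: "finite ?T1" using fin by simp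
      have b: "b = c + x_exponent ?T1 + Poly_Mapping.single g ?n"
      proof (rule poly_mapping_eqI)
        fix k
        have "?T1 \<subseteq> ?T" "g \<notin> ?T1" by (auto simp: less_iff)
        then show "Poly_Mapping.lookup b k = Poly_Mapping.lookup (c + x_exponent ?T1 + Poly_Mapping.single g ?n) k"
          using n fT1 by (auto simp: c_def lookup_add lookup_minus lookup_x_exponent lookup_single when_def in_keys_iff)
      qed
      have cH: "Poly_Mapping.keys c \<subseteq> H"
        using less.prems(2) by (auto simp: c_def in_keys_iff lookup_minus)
      then have cR: "Poly_Mapping.single c 1 \<in> H_pol" by (auto simp: H_pol_def)
      let ?q = "Poly_Mapping.single c 1 * (prod X ?T1 * rel.above g ^ ?n)"
      let ?e = "Poly_Mapping.single (c + x_exponent ?T1) 1 * (rel.above g ^ ?n - X g ^ ?n)"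
      have "?q \<in> {q. e_times S q \<in> I}" by (rule rel.I_mult[OF cR PT])
      then have qW: "e_times S ?q \<in> W" using W_I by blast
      have "Poly_Mapping.single b (1 :: rat) = Poly_Mapping.single (c + x_exponent ?T1) 1 * X g ^ ?n"
        by (subst b) (simp add: X_power mult_single)
      moreover have "?q = Poly_Mapping.single (c + x_exponent ?T1) 1 * rel.above g ^ ?n"
        using fT1 by (simp add: prod_X mult_single flip: mult.assoc)
      ultimately have q: "?q = Poly_Mapping.single b 1 + ?e" by (simp add: algebra_simps)
      have "e_times S ?e \<in> W"
        unfolding e_times_def gc_scale_eq_single[symmetric]
      proof (intro W_sum W_scale)
        fix m assume "m \<in> Poly_Mapping.keys ?e"
        then obtain m1 m2 where m: "m = m1 + m2" "m1 \<in> Poly_Mapping.keys (Poly_Mapping.single (c + x_exponent ?T1) (1::rat))"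
            "m2 \<in> Poly_Mapping.keys (rel.above g ^ ?n - X g ^ ?n)"
          using keys_mult[of "Poly_Mapping.single (c + x_exponent ?T1) (1::rat)" "rel.above g ^ ?n - X g ^ ?n"] by blast
        have m1: "m1 = c + x_exponent ?T1" using m(2) by simp
        have m2: "Poly_Mapping.keys m2 \<subseteq> H \<and> cost m2 < ?n * depth g"
          using above_power_leading[OF gH(1), of ?n] m(3) unfolding rel.above_def by blast
        have "cost b = cost m1 + ?n * depth g"
          unfolding m1 by (subst b) (simp add: cost_add cost_single[OF gH(1)])
        then have "cost m < cost b" using m(1) m2 by (simp add: cost_add)
        moreover have "Poly_Mapping.keys m1 \<subseteq> H"
          unfolding m1 using keys_add[of c "x_exponent ?T1"] cH keys_x_exponent[OF fT1] less.prems(2) by blast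
        then have "Poly_Mapping.keys m \<subseteq> H" using m(1) m2 keys_add[of m1 m2] by blast
        ultimately show "gc_monom S m \<in> W" using less.prems(1) by (intro less.hyps) auto
      qed
      then have "e_times S (Poly_Mapping.single b 1) \<in> W"
        using W_cancel[OF qW[unfolded q e_times_add]] by blast
      then show ?thesis by (simp add: e_times_single)
    next
      case 4
      then show ?thesis by (rule W_basis)
    qed
  qed
  show ?thesis
  proof
    fix f assume "f \<in> carrier R"
    then show "f \<in> W"
      by (induction rule: gc_elt_induct) (auto intro: W_zero W_add W_scale monom)
  qed
qed

end

section \<open>Linear independence\<close>

lemma lin_gc_scale: "lin v (gc_scale c f) = c * lin v f"
proof -
  have "lin v (gc_scale c f) = (\<Sum>b\<in>Poly_Mapping.keys f. Poly_Mapping.lookup (gc_scale c f) b * v b)"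
    by (rule lin_superset) (auto simp: in_keys_iff)
  then show ?thesis by (simp add: lin_def sum_distrib_left mult.assoc)
qed

lemma lin_gc_monom: "lin v (gc_monom S b) = v (S, b)"
  by (simp add: gc_monom_def lin_single)

context nested_algebra begin

section \<open>The boundary as a graded derivation\<close>

abbreviation preceding :: "'a set \<Rightarrow> 'a \<Rightarrow> nat" where
  "preceding S g \<equiv> card {h \<in> S. h \<noteq> g \<and> (h, g) \<in> r}"

text \<open>The graded derivation that sends each \<open>e_g\<close> to \<open>1\<close> and each
  \<open>x_g\<close> to \<open>0\<close>.\<close>

definition bd :: "'a gc_elt \<Rightarrow> 'a gc_elt" where
  "bd f = (\<Sum>m\<in>Poly_Mapping.keys f. gc_scale (Poly_Mapping.lookup f m)
     (\<Sum>g\<in>fst m. gc_scale ((-1) ^ preceding (fst m) g) (gc_monom (fst m - {g}) (snd m))))"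

lemma bd_superset:
  assumes "finite A" "Poly_Mapping.keys f \<subseteq> A"
  shows "bd f = (\<Sum>m\<in>A. gc_scale (Poly_Mapping.lookup f m)
     (\<Sum>g\<in>fst m. gc_scale ((-1) ^ preceding (fst m) g) (gc_monom (fst m - {g}) (snd m))))"
  unfolding bd_def using assms by (intro sum.mono_neutral_left) (auto simp: in_keys_iff)

lemma bd_add: "bd (f + g) = bd f + bd g"
proof -
  let ?A = "Poly_Mapping.keys f \<union> Poly_Mapping.keys g"
  have "Poly_Mapping.keys (f + g) \<subseteq> ?A" by (rule keys_add)
  then show ?thesis
    by (simp add: bd_superset[of ?A] lookup_add gc_scale_add_left sum.distrib)
qed

lemma bd_zero [simp]: "bd 0 = 0" by (simp add: bd_def)

lemma bd_monom: "bd (gc_monom S b) = (\<Sum>g\<in>S. gc_scale ((-1) ^ preceding S g) (gc_monom (S - {g}) b))"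
  by (simp add: bd_def gc_monom_def)

lemma bd_scale: "bd (gc_scale c f) = gc_scale c (bd f)"
proof -
  have "Poly_Mapping.keys (gc_scale c f) \<subseteq> Poly_Mapping.keys f" by (auto simp: in_keys_iff)
  then show ?thesis
    by (subst bd_superset[of "Poly_Mapping.keys f"]) (simp_all add: bd_def gc_scale_sum mult.assoc)
qed

lemma e_boundary_eq: "e_boundary r S = bd (gc_monom S 0)"
  by (simp add: bd_monom e_boundary_def)

lemma gc_minus: "gc_scale (-1) f = - f"
  by (simp add: poly_mapping_eq_iff fun_eq_iff)

lemma gc_sum_closed: "(\<And>a. a \<in> A \<Longrightarrow> u a \<in> carrier R) \<Longrightarrow> sum u A \<in> carrier R"
  by (induction A rule: infinite_finite_induct) (auto simp: gc_carrier_closed)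

lemma gc_minus_closed: "f \<in> carrier R \<Longrightarrow> - f \<in> carrier R"
  using gc_carrier_closed(2)[of f H r "-1"] by (simp add: gc_minus)

lemma bd_carrier: "f \<in> carrier R \<Longrightarrow> bd f \<in> carrier R"
proof (induction rule: gc_elt_induct)
  case (add c S b g)
  have "bd (gc_monom S b) \<in> carrier R"
    unfolding bd_monom using add by (intro gc_sum_closed gc_carrier_closed(2) monom_carrier) auto
  then show ?case using add by (auto simp: bd_add bd_scale intro!: gc_carrier_closed)
qed (simp add: gc_carrier_closed)

lemma inversions_singleton: "inversions r {g} S = preceding S g"
proof -
  have "{(s, t) \<in> {g} \<times> S. s \<noteq> t \<and> (t, s) \<in> r} = Pair g ` {h \<in> S. h \<noteq> g \<and> (h, g) \<in> r}" by auto
  then show ?thesis unfolding inversions_def by (simp only:) (intro card_image inj_onI, simp)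
qed

lemma e_mult_monom:
  "gc_mult r (gc_monom {g} 0) (gc_monom S b) =
    (if g \<in> S then 0 else gc_scale ((-1) ^ preceding S g) (gc_monom (insert g S) b))"
  by (simp add: gc_mult_monom gc_monom_mult_def inversions_singleton)

lemma monom_insert:
  "g \<notin> S \<Longrightarrow> gc_monom (insert g S) b = gc_scale ((-1) ^ preceding S g) (gc_mult r (gc_monom {g} 0) (gc_monom S b))"
  by (simp add: e_mult_monom flip: power_add mult_2)

lemma bd_e_monom:
  assumes g: "g \<in> H" and S: "S \<subseteq> H"
  shows "bd (gc_mult r (gc_monom {g} 0) (gc_monom S b)) =
    gc_monom S b - gc_mult r (gc_monom {g} 0) (bd (gc_monom S b))"
proof -
  have fin: "finite S" using S sub_H by blast
  have eS: "gc_mult r (gc_monom {g} 0) (bd (gc_monom S b)) =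
      (\<Sum>s\<in>S. gc_scale ((-1) ^ preceding S s) (gc_mult r (gc_monom {g} 0) (gc_monom (S - {s}) b)))"
    by (simp add: bd_monom gc_mult_sum_right gc_mult_scale)
  show ?thesis
  proof (cases "g \<in> S")
    case True
    have "gc_scale ((-1) ^ preceding S s) (gc_mult r (gc_monom {g} 0) (gc_monom (S - {s}) b)) =
        (if s = g then gc_monom S b else 0)" if "s \<in> S" for s
    proof (cases "s = g")
      case True
      have "{h \<in> S - {g}. h \<noteq> g \<and> (h, g) \<in> r} = {h \<in> S. h \<noteq> g \<and> (h, g) \<in> r}" by auto
      then show ?thesis using True \<open>g \<in> S\<close> by (simp add: e_mult_monom insert_absorb flip: power_add mult_2)
    next
      case False
      then show ?thesis using \<open>g \<in> S\<close> by (simp add: e_mult_monom)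
    qed
    then have "gc_mult r (gc_monom {g} 0) (bd (gc_monom S b)) = (\<Sum>s\<in>S. if s = g then gc_monom S b else 0)"
      unfolding eS by (rule sum.cong[OF refl])
    then show ?thesis using True fin by (simp add: e_mult_monom)
  next
    case False
    let ?n = "preceding S g"
    \<comment> \<open>Exactly one of \<open>g\<close> and \<open>s\<close> precedes the other, which
      accounts for the single extra sign.\<close>
    have sgn: "(-1 :: rat) ^ ?n * (-1) ^ preceding (insert g S) s = - ((-1) ^ preceding S s * (-1) ^ preceding (S - {s}) g)"
      if s: "s \<in> S" for s
    proof -
      have sg: "s \<noteq> g" "s \<in> H" using s False S by auto
      have 1: "?n = preceding (S - {s}) g + (if (s, g) \<in> r then 1 else 0)"
      proof -
        have "{h \<in> S. h \<noteq> g \<and> (h, g) \<in> r} = {h \<in> S - {s}. h \<noteq> g \<and> (h, g) \<in> r} \<union> (if (s, g) \<in> r then {s} else {})"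
          using s sg by auto
        then show ?thesis using fin by (simp only:) (subst card_Un_disjoint, auto)
      qed
      have 2: "preceding (insert g S) s = preceding S s + (if (g, s) \<in> r then 1 else 0)"
      proof -
        have "{h \<in> insert g S. h \<noteq> s \<and> (h, s) \<in> r} = {h \<in> S. h \<noteq> s \<and> (h, s) \<in> r} \<union> (if (g, s) \<in> r then {g} else {})"
          using sg by auto
        then show ?thesis using fin False by (simp only:) (subst card_Un_disjoint, auto)
      qed
      have "(g, s) \<in> r \<longleftrightarrow> (s, g) \<notin> r" using r_total[OF g sg(2)] r_antisym[of g s] sg(1) by blast
      then show ?thesis unfolding 1 2 by (simp add: power_add)
    qed
    have "bd (gc_mult r (gc_monom {g} 0) (gc_monom S b)) =
        gc_scale ((-1) ^ ?n) (\<Sum>s\<in>insert g S. gc_scale ((-1) ^ preceding (insert g S) s) (gc_monom (insert g S - {s}) b))"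
      using False by (simp add: e_mult_monom bd_scale bd_monom)
    also have "\<dots> = gc_scale ((-1) ^ ?n * (-1) ^ preceding (insert g S) g) (gc_monom (insert g S - {g}) b) +
        (\<Sum>s\<in>S. gc_scale ((-1) ^ ?n * (-1) ^ preceding (insert g S) s) (gc_monom (insert g S - {s}) b))"
      using fin False by (simp add: gc_scale_add gc_scale_sum)
    also have "gc_scale ((-1) ^ ?n * (-1) ^ preceding (insert g S) g) (gc_monom (insert g S - {g}) b) = gc_monom S b"
    proof -
      have "{h \<in> insert g S. h \<noteq> g \<and> (h, g) \<in> r} = {h \<in> S. h \<noteq> g \<and> (h, g) \<in> r}" by auto
      then show ?thesis using False by (simp flip: power_add mult_2)
    qed
    also have "(\<Sum>s\<in>S. gc_scale ((-1) ^ ?n * (-1) ^ preceding (insert g S) s) (gc_monom (insert g S - {s}) b)) =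
        (\<Sum>s\<in>S. - gc_scale ((-1) ^ preceding S s) (gc_mult r (gc_monom {g} 0) (gc_monom (S - {s}) b)))"
    proof (rule sum.cong[OF refl])
      fix s assume s: "s \<in> S"
      have "insert g S - {s} = insert g (S - {s})" using s False by auto
      then show "gc_scale ((-1) ^ ?n * (-1) ^ preceding (insert g S) s) (gc_monom (insert g S - {s}) b) =
          - gc_scale ((-1) ^ preceding S s) (gc_mult r (gc_monom {g} 0) (gc_monom (S - {s}) b))"
        unfolding sgn[OF s] using False by (simp add: e_mult_monom flip: gc_minus)
    qed
    finally show ?thesis unfolding eS by (simp add: sum_negf)
  qed
qed

lemma gc_mult_minus_right: "gc_mult r h (f - g) = gc_mult r h f - gc_mult r h g"
  and gc_mult_minus_left: "gc_mult r (f - g) h = gc_mult r f h - gc_mult r g h"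
  using gc_mult_add_right[of r h f "- g"] gc_mult_add_left[of r f "- g" h]
    gc_mult_scale(1)[of r "-1" g h] gc_mult_scale(2)[of r h "-1" g] by (simp_all add: gc_minus)

lemma bd_minus: "bd (f - g) = bd f - bd g"
  using bd_add[of f "- g"] bd_scale[of "-1" g] by (simp add: gc_minus)

lemma bd_e_mult:
  assumes g: "g \<in> H" and f: "f \<in> carrier R"
  shows "bd (gc_mult r (gc_monom {g} 0) f) = f - gc_mult r (gc_monom {g} 0) (bd f)"
  using f
proof (induction rule: gc_elt_induct)
  case (add c S b f)
  have "bd (gc_mult r (gc_monom {g} 0) (gc_scale c (gc_monom S b))) =
      gc_scale c (gc_monom S b - gc_mult r (gc_monom {g} 0) (bd (gc_monom S b)))"
    using bd_e_monom[OF g add.hyps(2), of b] by (simp add: gc_mult_scale bd_scale)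
  then show ?case using add.IH
    by (simp add: gc_mult_add_right bd_add bd_scale gc_mult_scale gc_scale_add
        gc_scale_add[of c "gc_monom S b" "- _", simplified] flip: gc_minus)
qed simp

lemma bd_x_mult: "f \<in> carrier R \<Longrightarrow> bd (gc_mult r (gc_monom {} b) f) = gc_mult r (gc_monom {} b) (bd f)"
proof (induction rule: gc_elt_induct)
  case (add c S b' f)
  then show ?case
    by (simp add: gc_mult_add_right bd_add bd_scale gc_mult_scale gc_monom_x_mult bd_monom gc_mult_sum_right)
qed simp

lemma e_carrier: "g \<in> H \<Longrightarrow> gc_monom {g} 0 \<in> carrier R"
  by (rule monom_carrier) auto

lemma bd_bd: "f \<in> carrier R \<Longrightarrow> bd (bd f) = 0"
proof (induction rule: gc_elt_induct)
  case (add c S b f)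
  have "bd (bd (gc_monom S b)) = 0"
    using add.hyps(1,2)
  proof (induction S)
    case (insert g F)
    let ?e = "gc_monom {g} 0" and ?f = "gc_monom F b"
    have C: "?e \<in> carrier R" "?f \<in> carrier R" "bd ?f \<in> carrier R"
      using insert.prems add.hyps e_carrier bd_carrier monom_carrier by auto
    have "bd (gc_mult r ?e ?f) = ?f - gc_mult r ?e (bd ?f)"
      using insert.prems by (intro bd_e_mult C) auto
    then have "bd (bd (gc_mult r ?e ?f)) = bd ?f - (bd ?f - gc_mult r ?e (bd (bd ?f)))"
      using insert.prems bd_e_mult[OF _ C(3), of g] by (simp add: bd_minus)
    then have "bd (bd (gc_mult r ?e ?f)) = 0" using insert by simp
    then show ?case unfolding monom_insert[OF insert.hyps(2)] by (simp add: bd_scale)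
  qed (simp add: bd_monom)
  then show ?case using add.IH by (simp add: bd_add bd_scale)
qed simp

text \<open>By the Leibniz rule the boundary of a multiple of a cycle is again a multiple of it;
  only the existence of the cofactor matters later.\<close>

lemma bd_mult_cycle:
  assumes E: "w \<in> carrier R" "bd w = 0" and h: "h \<in> carrier R"
  shows "\<exists>h'\<in>carrier R. bd (gc_mult r h w) = gc_mult r h' w"
  using h
proof (induction rule: gc_elt_induct)
  case zero
  then show ?case by (intro bexI[of _ 0]) (simp_all add: gc_carrier_closed)
next
  case (add c S b f)
  have "\<exists>h'\<in>carrier R. bd (gc_mult r (gc_monom S b) w) = gc_mult r h' w"
    using add.hyps(1,2)
  proof (induction S)
    case empty
    then show ?case using bd_x_mult[OF E(1), of b] E(2)
      by (intro bexI[of _ 0]) (simp_all add: gc_carrier_closed)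
  next
    case (insert g F)
    let ?e = "gc_monom {g} 0" and ?f = "gc_monom F b"
    have C: "?e \<in> carrier R" "?f \<in> carrier R"
      using insert.prems add.hyps e_carrier monom_carrier by auto
    obtain h' where h': "h' \<in> carrier R" "bd (gc_mult r ?f w) = gc_mult r h' w" using insert by auto
    have "bd (gc_mult r ?e (gc_mult r ?f w)) = gc_mult r ?f w - gc_mult r ?e (gc_mult r h' w)"
      using insert.prems bd_e_mult[of g "gc_mult r ?f w"] gc_mult_closed[OF C(2) E(1)] h'(2) by simp
    also have "\<dots> = gc_mult r (?f - gc_mult r ?e h') w"
      using gc_mult_assoc[OF C(1) h'(1) E(1)] by (simp add: gc_mult_minus_left)
    finally have "bd (gc_mult r (gc_mult r ?e ?f) w) = gc_mult r (?f - gc_mult r ?e h') w"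
      using gc_mult_assoc[OF C E(1)] by simp
    then have "bd (gc_mult r (gc_monom (insert g F) b) w) =
        gc_mult r (gc_scale ((-1) ^ preceding F g) (?f - gc_mult r ?e h')) w"
      unfolding monom_insert[OF insert.hyps(2)] by (simp add: gc_mult_scale bd_scale)
    moreover have "gc_scale ((-1) ^ preceding F g) (?f - gc_mult r ?e h') \<in> carrier R"
      using gc_carrier_closed(3)[OF C(2) gc_minus_closed[OF gc_mult_closed[OF C(1) h'(1)]]]
      by (intro gc_carrier_closed(2)) simp
    ultimately show ?case by blast
  qed
  then obtain h1 where h1: "h1 \<in> carrier R" "bd (gc_mult r (gc_monom S b) w) = gc_mult r h1 w" by blast
  obtain h2 where h2: "h2 \<in> carrier R" "bd (gc_mult r f w) = gc_mult r h2 w" using add.IH by blast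
  show ?case
    using h1 h2 by (intro bexI[of _ "gc_scale c h1 + h2"])
      (simp_all add: gc_mult_add_left gc_mult_scale bd_add bd_scale gc_carrier_closed)
qed

subsection \<open>Flag functionals on the exterior part\<close>

text \<open>By \<open>nested_cong\<close>, this is all that nestedness of
  \<open>S \<union> T\<close> sees of \<open>S\<close>.\<close>

definition span_class :: "'a set \<Rightarrow> 'a set \<times> 'a" where
  "span_class S = (S - At, J (S \<inter> At))"

text \<open>
  For independent \<open>S\<close>, the value of \<open>flag_value [s\<^sub>1, \<dots>, s\<^sub>k]\<close> is the sign of the ordering of \<open>S\<close> that
  spans the same flag as \<open>s\<^sub>k, \<dots>, s\<^sub>1\<close>; there is at most one such ordering.
\<close>

fun flag_value :: "'a list \<Rightarrow> 'a set \<Rightarrow> rat" where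
  "flag_value [] S = (if S = {} then 1 else 0)"
| "flag_value (s # ss) S = (if span_class S = span_class (set (s # ss))
     then \<Sum>t\<in>S. (-1) ^ preceding S t * flag_value ss (S - {t}) else 0)"

text \<open>The image of the monomial \<open>b\<close> once the atom variables are eliminated
  through \<open>gen\<close>.\<close>

definition weight :: "('a \<Rightarrow>\<^sub>0 nat) \<Rightarrow> 'a pol" where
  "weight b = (\<Prod>h\<in>H. gen H h ^ Poly_Mapping.lookup b h)"

definition functional :: "'a list \<Rightarrow> (('a \<Rightarrow>\<^sub>0 nat) \<Rightarrow> rat) \<Rightarrow> 'a gc_elt \<Rightarrow> rat" where
  "functional l v = lin (\<lambda>(S, b). flag_value l S * lin v (weight b))"

lemma functional_monom: "functional l v (gc_monom S b) = flag_value l S * lin v (weight b)"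
  by (simp add: functional_def lin_gc_monom)

lemma functional_simps:
  "functional l v (f + g) = functional l v f + functional l v g"
  "functional l v (gc_scale c f) = c * functional l v f"
  "functional l v (sum u A) = (\<Sum>a\<in>A. functional l v (u a))"
  "functional l v 0 = 0"
  by (simp_all add: functional_def lin_add lin_gc_scale lin_sum)

lemma weight_add: "weight (b + b') = weight b * weight b'"
  by (simp add: weight_def lookup_add power_add prod.distrib)

lemma weight_x_exponent: "T \<subseteq> H \<Longrightarrow> weight (x_exponent T) = prod (gen H) T"
proof -
  assume T: "T \<subseteq> H"
  then have "finite T" by (rule sub_H)
  then have "weight (x_exponent T) = (\<Prod>h\<in>H. if h \<in> T then gen H h else 1)"
    unfolding weight_def by (intro prod.cong) (auto simp: lookup_x_exponent)
  also have "\<dots> = prod (gen H) (H \<inter> T)" using pbs_finite[OF H] by (simp add: prod.If_cases)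
  finally show ?thesis using T by (simp add: Int_absorb1)
qed

lemma weight_nonatoms: "Poly_Mapping.keys b \<subseteq> H - At \<Longrightarrow> weight b = Poly_Mapping.single b 1"
proof -
  assume b: "Poly_Mapping.keys b \<subseteq> H - At"
  have "gen H h ^ Poly_Mapping.lookup b h = Poly_Mapping.single (Poly_Mapping.single h (Poly_Mapping.lookup b h)) 1" for h
  proof (cases "h \<in> At")
    case True
    then have "h \<notin> Poly_Mapping.keys b" using b by blast
    then show ?thesis by (simp add: in_keys_iff)
  qed (simp add: gen_def X_power)
  then have "weight b = (\<Prod>h\<in>H. Poly_Mapping.single (Poly_Mapping.single h (Poly_Mapping.lookup b h)) 1)"
    by (simp add: weight_def)
  also have "\<dots> = Poly_Mapping.single (\<Sum>h\<in>H. Poly_Mapping.single h (Poly_Mapping.lookup b h)) 1"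
  proof -
    have "(\<Prod>h\<in>M. Poly_Mapping.single (u h) 1) = Poly_Mapping.single (sum u M) (1 :: rat)"
      for u :: "'a \<Rightarrow> 'a \<Rightarrow>\<^sub>0 nat" and M
      by (induction M rule: infinite_finite_induct) (simp_all add: mult_single)
    then show ?thesis .
  qed
  also have "(\<Sum>h\<in>H. Poly_Mapping.single h (Poly_Mapping.lookup b h)) = b"
  proof (rule poly_mapping_eqI)
    fix k
    show "Poly_Mapping.lookup (\<Sum>h\<in>H. Poly_Mapping.single h (Poly_Mapping.lookup b h)) k = Poly_Mapping.lookup b k"
      using b pbs_finite[OF H] by (auto simp: lookup_sum lookup_single when_def in_keys_iff)
  qed
  finally show ?thesis .
qed

lemma flag_value_class: "flag_value l S \<noteq> 0 \<Longrightarrow> span_class S = span_class (set l)"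
  by (cases l) (auto split: if_splits)

text \<open>The recursion of \<open>flag_value\<close> is \<open>bd\<close> followed by the shorter
  flag, restricted to one span class. On elements supported in a single class this restriction is
  all or nothing.\<close>

lemma functional_step_bd:
  assumes "\<And>m. m \<in> Poly_Mapping.keys f \<Longrightarrow> span_class (fst m) = \<kappa>"
  shows "functional (s # ss) v f = (if \<kappa> = span_class (set (s # ss)) then functional ss v (bd f) else 0)"
proof -
  have "functional (s # ss) v f = (\<Sum>m\<in>Poly_Mapping.keys f. Poly_Mapping.lookup f m *
      (flag_value (s # ss) (fst m) * lin v (weight (snd m))))"
    by (simp add: functional_def lin_def case_prod_unfold)
  also have "\<dots> = (\<Sum>m\<in>Poly_Mapping.keys f. if \<kappa> = span_class (set (s # ss)) then
      Poly_Mapping.lookup f m * functional ss v (bd (gc_monom (fst m) (snd m))) else 0)"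
    by (rule sum.cong[OF refl])
      (simp add: assms bd_monom functional_simps functional_monom sum_distrib_right mult.assoc)
  also have "\<dots> = (if \<kappa> = span_class (set (s # ss)) then functional ss v (bd f) else 0)"
    unfolding bd_def[of f] by (simp add: functional_simps bd_monom)
  finally show ?thesis .
qed

text \<open>Omitting any element of a circuit leaves the same join, so all terms of a monomial
  multiple of the relation have one span class. The functional then is zero or becomes the shorter
  one applied to the boundary, which is again a multiple of the relation.\<close>

lemma functional_circuit:
  assumes C: "circuit C" and f: "f \<in> carrier R"
  shows "functional l v (gc_mult r f (e_boundary r C)) = 0"
  using f
proof (induction l arbitrary: f)
  case Nil
  \<comment> \<open>An atom is no loop, so every term of the relation has a nonempty exterior part,
    and the empty flag kills it.\<close>
  have ne: "C - {c} \<noteq> {}" if "c \<in> C" for c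
  proof
    assume e: "C - {c} = {}"
    have "c \<sqsubseteq> \<bottom>" using circuit_closure[OF C that] unfolding e J_empty .
    then show False using C that le_bot atom_in atom_not_bot by (auto simp: circuit_def)
  qed
  show ?case
    using Nil
  proof (induction rule: gc_elt_induct)
    case (add c S b f)
    have "functional [] v (gc_monom_mult r (S, b) (C - {g}, 0)) = 0" if "g \<in> C" for g
      using ne[OF that] by (auto simp: gc_monom_mult_def functional_simps functional_monom)
    then have "functional [] v (gc_mult r (gc_monom S b) (e_boundary r C)) = 0"
      by (simp add: e_boundary_def gc_mult_sum_right gc_mult_scale gc_mult_monom functional_simps)
    then show ?case using add.IH by (simp add: gc_mult_add_left gc_mult_scale functional_simps)
  qed (simp add: functional_simps)
next
  case (Cons s ss)
  have CA: "C \<subseteq> At" "C \<subseteq> H" "C \<subseteq> E" using C pbs_At[OF H] At_E by (auto simp: circuit_def)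
  have mC: "gc_monom C 0 \<in> carrier R" using CA by (intro monom_carrier) auto
  have E: "e_boundary r C \<in> carrier R" "bd (e_boundary r C) = 0"
    unfolding e_boundary_eq using bd_carrier[OF mC] bd_bd[OF mC] by auto
  show ?case
    using Cons.prems
  proof (induction rule: gc_elt_induct)
    case (add c S b f)
    let ?f = "gc_mult r (gc_monom S b) (e_boundary r C)"
    let ?\<kappa> = "(S - At, J (C \<union> (S \<inter> At)))"
    have SE: "S \<inter> At \<subseteq> E" using At_E by blast
    have cls: "span_class (S \<union> (C - {g})) = ?\<kappa>" if g: "g \<in> C" for g
    proof -
      have "(S \<union> (C - {g})) \<inter> At = (C - {g}) \<union> (S \<inter> At)" "(S \<union> (C - {g})) - At = S - At" using CA by auto
      moreover have "J ((C - {g}) \<union> (S \<inter> At)) = J (C \<union> (S \<inter> At))"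
        using circuit_J[OF C g] CA SE by (intro J_Un_cong) auto
      ultimately show ?thesis by (simp add: span_class_def)
    qed
    have "span_class (fst m) = ?\<kappa>" if m: "m \<in> Poly_Mapping.keys ?f" for m
    proof (rule ccontr)
      assume ncls: "span_class (fst m) \<noteq> ?\<kappa>"
      have "Poly_Mapping.lookup (gc_monom_mult r (S, b) (C - {g}, 0)) m = 0" if g: "g \<in> C" for g
        using cls[OF g] ncls by (auto simp: gc_monom_mult_def gc_monom_def lookup_single when_def)
      then have "Poly_Mapping.lookup ?f m = 0"
        by (simp add: e_boundary_def gc_mult_sum_right gc_mult_scale gc_mult_monom lookup_sum)
      then show False using m by (simp add: in_keys_iff)
    qed
    then have "functional (s # ss) v ?f =
        (if ?\<kappa> = span_class (set (s # ss)) then functional ss v (bd ?f) else 0)"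
      by (rule functional_step_bd)
    moreover obtain h' where "h' \<in> carrier R" "bd ?f = gc_mult r h' (e_boundary r C)"
      using bd_mult_cycle[OF E monom_carrier[OF add.hyps(2,3)]] by blast
    ultimately have "functional (s # ss) v ?f = 0" using Cons.IH by simp
    then show ?case using add.IH by (simp add: gc_mult_add_left gc_mult_scale functional_simps)
  qed (simp add: functional_simps)
qed

section \<open>The functionals respect all defining relations\<close>

lemma inversions_swap:
  assumes "A \<subseteq> H" "B \<subseteq> H" "A \<inter> B = {}"
  shows "inversions r A B + inversions r B A = card A * card B"
proof -
  let ?X = "{(s, t) \<in> A \<times> B. s \<noteq> t \<and> (t, s) \<in> r}" and ?Y = "{(s, t) \<in> A \<times> B. s \<noteq> t \<and> (s, t) \<in> r}"
  have fin: "finite (A \<times> B)" using assms sub_H by auto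
  have "{(s, t) \<in> B \<times> A. s \<noteq> t \<and> (t, s) \<in> r} = prod.swap ` ?Y" by (auto simp: image_iff)
  then have swap: "inversions r B A = card ?Y"
    unfolding inversions_def by (simp only:) (rule card_image, auto intro: inj_onI)
  have un: "?X \<union> ?Y = A \<times> B" and dis: "?X \<inter> ?Y = {}"
    using assms r_total r_antisym by blast+
  have "finite ?X" by (rule finite_subset[OF _ fin]) blast
  moreover have "finite ?Y" by (rule finite_subset[OF _ fin]) blast
  ultimately have "card (?X \<union> ?Y) = card ?X + card ?Y" using dis by (rule card_Un_disjoint)
  then show ?thesis
    unfolding un card_cartesian_product swap inversions_def[of r A B] by (rule sym)
qed

lemma monom_commute:
  assumes "A \<subseteq> H" "B \<subseteq> H"
  shows "gc_mult r (gc_monom A b) (gc_monom B b') =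
    gc_scale ((-1) ^ (card A * card B)) (gc_mult r (gc_monom B b') (gc_monom A b))"
proof (cases "A \<inter> B = {}")
  case True
  have "(-1 :: rat) ^ inversions r A B = (-1) ^ (card A * card B) * (-1) ^ inversions r B A"
    unfolding inversions_swap[OF assms True, symmetric]
    by (simp add: power_add mult.assoc flip: power_mult_distrib)
  then show ?thesis using True
    by (simp add: gc_mult_monom gc_monom_mult_def Int_commute Un_commute add.commute)
next
  case False
  then show ?thesis by (simp add: gc_mult_monom gc_monom_mult_def Int_commute)
qed

lemma functional_two_sided:
  assumes f: "f \<in> carrier R" and hk: "h \<in> carrier R" "k \<in> carrier R"
    and monom: "\<And>S b S' b'. \<lbrakk>S \<subseteq> H; Poly_Mapping.keys b \<subseteq> H; S' \<subseteq> H; Poly_Mapping.keys b' \<subseteq> H\<rbrakk> \<Longrightarrow>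
      functional l v (gc_mult r (gc_mult r (gc_monom S b) f) (gc_monom S' b')) = 0"
  shows "functional l v (gc_mult r (gc_mult r h f) k) = 0"
  using hk(1)
proof (induction rule: gc_elt_induct)
  case (add c S b h)
  have "functional l v (gc_mult r (gc_mult r (gc_monom S b) f) k) = 0"
    using hk(2)
  proof (induction rule: gc_elt_induct)
    case k: (add c' S' b' k)
    then show ?case using monom[OF add.hyps(2,3) k.hyps(2,3)]
      by (simp add: gc_mult_add_right gc_mult_scale functional_simps)
  qed (simp add: functional_simps)
  then show ?case using add.IH by (simp add: gc_mult_add_left gc_mult_scale functional_simps)
qed (simp add: functional_simps)

text \<open>The coefficient depends on the exterior parts alone, so it factors out of a linear
  relation among the \<open>x\<close> variables.\<close>

lemma monom_mult_triple:
  obtains c where "\<And>b1 x b2. gc_mult r (gc_mult r (gc_monom S1 b1) (gc_monom S x)) (gc_monom S2 b2) =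
    gc_scale c (gc_monom (S1 \<union> S \<union> S2) (b1 + x + b2))"
proof
  show "gc_mult r (gc_mult r (gc_monom S1 b1) (gc_monom S x)) (gc_monom S2 b2) =
    gc_scale (if S1 \<inter> S = {} \<and> (S1 \<union> S) \<inter> S2 = {} then (-1) ^ inversions r S1 S * (-1) ^ inversions r (S1 \<union> S) S2 else 0)
      (gc_monom (S1 \<union> S \<union> S2) (b1 + x + b2))" for b1 x b2
    by (simp add: gc_mult_monom gc_monom_mult_def gc_mult_scale)
qed

lemma functional_relations:
  assumes l: "set l \<subseteq> H" and v: "\<And>f. f \<in> nonface_ideal H (set l) \<Longrightarrow> lin v f = 0"
    and f: "f \<in> Bhat_relations L H r" and hk: "h \<in> carrier R" "k \<in> carrier R"
  shows "functional l v (gc_mult r (gc_mult r h f) k) = 0"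
proof (rule functional_two_sided[OF _ hk])
  show fR: "f \<in> carrier R" using f relations_carrier by blast
  fix S1 S2 :: "'a set" and b1 b2 :: "'a \<Rightarrow>\<^sub>0 nat"
  assume S: "S1 \<subseteq> H" "Poly_Mapping.keys b1 \<subseteq> H" "S2 \<subseteq> H" "Poly_Mapping.keys b2 \<subseteq> H"
  note mR = monom_carrier[OF S(1,2)] monom_carrier[OF S(3,4)]
  from f consider (nonface) S T where "f = gc_monom S (x_exponent T)" "S \<subseteq> H" "T \<subseteq> H" "S \<union> T \<notin> nested_sets L H"
    | (circuit) C where "f = e_boundary r C" "nested_circuit L H r C"
    | (linear) a where "f = x_sum_above L H a" "a \<in> At"
    unfolding Bhat_relations_def by blast
  then show "functional l v (gc_mult r (gc_mult r (gc_monom S1 b1) f) (gc_monom S2 b2)) = 0"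
  proof cases
    case nonface
    let ?S = "S1 \<union> S \<union> S2"
    obtain c where c: "gc_mult r (gc_mult r (gc_monom S1 b1) f) (gc_monom S2 b2) = gc_scale c (gc_monom ?S (b1 + x_exponent T + b2))"
      using monom_mult_triple[of S1 S S2] nonface(1) by metis
    have "flag_value l ?S * lin v (weight (b1 + x_exponent T + b2)) = 0"
    \<comment> \<open>Where the flag value is nonzero, \<open>?S\<close> and \<open>set l\<close>
      have the same span class, so \<open>T\<close> is a nonface for \<open>set l\<close> as
      well.\<close>
    proof (cases "flag_value l ?S = 0")
      case False
      then have cls: "span_class ?S = span_class (set l)" by (rule flag_value_class)
      have SH: "?S \<subseteq> H" using S nonface by blast
      have sub: "?S \<union> T \<subseteq> E" "set l \<union> T \<subseteq> E" "?S \<inter> At \<subseteq> E" "set l \<inter> At \<subseteq> E" "T \<inter> At \<subseteq> E"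
        using SH nonface l pbs_E[OF H] by auto
      have "J ((?S \<inter> At) \<union> (T \<inter> At)) = J ((set l \<inter> At) \<union> (T \<inter> At))"
        using cls sub by (intro J_Un_cong) (auto simp: span_class_def)
      moreover have "(?S \<union> T) \<inter> At = (?S \<inter> At) \<union> (T \<inter> At)" "(set l \<union> T) \<inter> At = (set l \<inter> At) \<union> (T \<inter> At)" by auto
      ultimately have J: "J ((?S \<union> T) \<inter> At) = J ((set l \<union> T) \<inter> At)" by simp
      have "?S - At = set l - At" using cls by (simp add: span_class_def)
      then have "(?S \<union> T) - At = (set l \<union> T) - At" by blast
      then have "nested H (?S \<union> T) \<longleftrightarrow> nested H (set l \<union> T)"
        using J by (intro nested_cong[OF H sub(1,2)])
      moreover have "\<not> nested H (?S \<union> T)"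
        using nonface nested_sets_iff nested_mono[of H "?S \<union> T" "S \<union> T"] by blast
      ultimately have "prod (gen H) T \<in> nonface_ideal H (set l)" using nonface by (intro nonface_gen) auto
      then have "weight b1 * weight b2 * prod (gen H) T \<in> nonface_ideal H (set l)" by (rule nonface_mult)
      then have "lin v (weight b1 * weight b2 * prod (gen H) T) = 0" by (rule v)
      then show ?thesis using nonface(3) by (simp add: weight_add weight_x_exponent mult_ac)
    qed simp
    then show ?thesis unfolding c by (simp add: functional_simps functional_monom)
  next
    case circuit
    then have C: "circuit C" "C \<subseteq> H" using nested_circuit_iff[OF H r] nested_sets_iff by auto
    \<comment> \<open>The relation has exterior degree \<open>card C - 1\<close>. Moving it past the
      monomial of \<open>S2\<close> costs one overall sign and reduces the case to left
      multiples.\<close>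
    let ?n = "(card C - 1) * card S2"
    have "gc_mult r f (gc_monom S2 b2) = gc_scale ((-1) ^ ?n) (gc_mult r (gc_monom S2 b2) f)"
    proof -
      have "gc_mult r (gc_monom (C - {g}) 0) (gc_monom S2 b2) =
          gc_scale ((-1) ^ ?n) (gc_mult r (gc_monom S2 b2) (gc_monom (C - {g}) 0))" if "g \<in> C" for g
        using monom_commute[of "C - {g}" S2 0 b2] C S that by auto
      then show ?thesis unfolding circuit(1) e_boundary_def
        by (simp add: gc_mult_sum_left gc_mult_sum_right gc_mult_scale gc_scale_sum mult.commute)
    qed
    then have "gc_mult r (gc_mult r (gc_monom S1 b1) f) (gc_monom S2 b2) =
        gc_scale ((-1) ^ ?n) (gc_mult r (gc_mult r (gc_monom S1 b1) (gc_monom S2 b2)) f)"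
      by (simp add: gc_mult_assoc[OF mR(1) fR mR(2)] gc_mult_assoc[OF mR fR] gc_mult_scale)
    then show ?thesis
      using functional_circuit[OF C(1) gc_mult_closed[OF mR]] circuit(1) by (simp add: functional_simps)
  next
    case linear
    let ?M = "{h \<in> H. a \<sqsubseteq> h}" and ?S = "S1 \<union> {} \<union> S2"
    obtain c where c: "\<And>x. gc_mult r (gc_mult r (gc_monom S1 b1) (gc_monom {} x)) (gc_monom S2 b2) =
        gc_scale c (gc_monom ?S (b1 + x + b2))"
      using monom_mult_triple[of S1 "{}" S2] by metis
    have w: "weight (b1 + x_exponent {h} + b2) = weight b1 * weight b2 * gen H h" if "h \<in> ?M" for h
      using that weight_x_exponent[of "{h}"] by (simp only: weight_add) (simp add: mult_ac)
    have "functional l v (gc_mult r (gc_mult r (gc_monom S1 b1) f) (gc_monom S2 b2)) =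
        (\<Sum>h\<in>?M. c * (flag_value l ?S * lin v (weight (b1 + x_exponent {h} + b2))))"
      unfolding linear(1) x_sum_above_def gc_mult_sum_right gc_mult_sum_left c
      by (simp only: functional_simps functional_monom)
    also have "\<dots> = (\<Sum>h\<in>?M. c * (flag_value l ?S * lin v (weight b1 * weight b2 * gen H h)))"
      using w by (intro sum.cong) auto
    also have "\<dots> = c * (flag_value l ?S * lin v (weight b1 * weight b2 * (\<Sum>h\<in>?M. gen H h)))"
      by (simp only: sum_distrib_left lin_sum)
    also have "\<dots> = 0" using gen_sum[OF H linear(2)] by simp
    finally show ?thesis .
  qed
qed

subsection \<open>No-broken-circuit sets\<close>

definition nbc :: "'a set \<Rightarrow> bool" where
  "nbc S \<longleftrightarrow> (\<forall>g\<in>At. \<forall>D\<subseteq>S \<inter> At. (\<forall>d\<in>D. (g, d) \<in> r \<and> g \<noteq> d) \<longrightarrow> \<not> g \<sqsubseteq> J D)"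

text \<open>An atom below the join of later atoms completes some of them to a circuit, and these
  form a broken circuit. In the form with joins the condition can be compared with flags.\<close>

lemma nbc_sets_nbc:
  assumes S: "S \<in> nbc_sets L H r" shows "nbc S"
  unfolding nbc_def
proof (intro ballI allI impI notI)
  fix g D assume g: "g \<in> At" and D: "D \<subseteq> S \<inter> At" "\<forall>d\<in>D. (g, d) \<in> r \<and> g \<noteq> d" and le: "g \<sqsubseteq> J D"
  obtain D' where D': "D' \<subseteq> D" "circuit (insert g D')" using ex_circuit[OF g _ _ le] D by blast
  have SN: "S \<subseteq> H" "nested H S" using S nested_sets_iff by (auto simp: nbc_sets_def)
  have "D' \<noteq> {}"
  proof
    assume "D' = {}"
    then have "g \<sqsubseteq> \<bottom>" using circuit_closure[OF D'(2), of g] J_empty by simp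
    then show False using g le_bot atom_in atom_not_bot by blast
  qed
  moreover have "D' \<subseteq> S" using D' D by blast
  moreover from this have "D' \<in> nested_sets L H" using SN nested_sets_iff nested_mono by blast
  moreover have "\<forall>s\<in>D'. (g, s) \<in> r \<and> g \<noteq> s" using D' D by blast
  moreover have "g \<in> H" using g pbs_At[OF H] by blast
  ultimately have "broken_circuit L H r D'" unfolding broken_circuit_iff[OF H r] using D'(2) by blast
  then show False using S \<open>D' \<subseteq> S\<close> by (auto simp: nbc_sets_def)
qed

lemma nbcD: "\<lbrakk>nbc S; g \<in> At; D \<subseteq> S \<inter> At; \<forall>d\<in>D. (g, d) \<in> r \<and> g \<noteq> d\<rbrakk> \<Longrightarrow> \<not> g \<sqsubseteq> J D"
  unfolding nbc_def by (drule bspec, assumption) (drule spec[of _ D], simp)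

lemma nbc_mono: "nbc S \<Longrightarrow> T \<subseteq> S \<Longrightarrow> nbc T"
  unfolding nbc_def[of T] by (intro ballI allI impI, rule nbcD[of S]) auto

lemma r_min: "finite S \<Longrightarrow> S \<noteq> {} \<Longrightarrow> S \<subseteq> H \<Longrightarrow> \<exists>m\<in>S. \<forall>s\<in>S. (m, s) \<in> r"
proof (induction S rule: finite_ne_induct)
  case (insert x F)
  then obtain m where m: "m \<in> F" "\<forall>s\<in>F. (m, s) \<in> r" by auto
  have "(m, x) \<in> r \<or> (x, m) \<in> r" using r_total insert.prems m(1) by blast
  then show ?case
  proof
    assume "(x, m) \<in> r"
    then have "\<forall>s\<in>F. (x, s) \<in> r" using m r_trans by blast
    then show ?thesis using r_refl insert.prems by blast
  qed (use m in blast)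
qed (simp add: r_refl)

text \<open>
  The smallest atom below the span of a no-broken-circuit set belongs to the set, so that such a set
  can be recovered from its flag.
\<close>

lemma flag_value_nbc:
  assumes "sorted_wrt (\<lambda>p q. (p, q) \<in> r) l" "distinct l" "set l \<subseteq> H" "nbc (set l)" "S \<subseteq> H" "nbc S"
  shows "flag_value l S = (if S = set l then 1 else 0)"
  using assms
proof (induction l arbitrary: S)
  case (Cons s ss)
  let ?l = "set (s # ss)"
  show ?case
  proof (cases "span_class S = span_class ?l")
    case False
    then show ?thesis by auto
  next
    case True
    then have cls: "S - At = ?l - At" "J (S \<inter> At) = J (?l \<inter> At)" by (simp_all add: span_class_def)
    have fin: "finite S" using Cons.prems sub_H by blast
    have smin: "\<forall>q\<in>?l. (s, q) \<in> r" using Cons.prems r_refl by auto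
    obtain m where m: "m \<in> S \<union> ?l" "\<forall>q\<in>S \<union> ?l. (m, q) \<in> r"
      using r_min[of "S \<union> ?l"] fin Cons.prems by auto
    have AtE: "A \<inter> At \<subseteq> E" for A using At_E by blast
    \<comment> \<open>If the least element \<open>m\<close> were missing from \<open>B\<close>, it
      would be an atom below the join of later atoms of \<open>B\<close>.\<close>
    have mem: "m \<in> B" if AB: "m \<in> A" "A - At = B - At" "J (A \<inter> At) = J (B \<inter> At)" "nbc B" "\<forall>q\<in>B. (m, q) \<in> r" for A B
    proof (rule ccontr)
      assume nB: "m \<notin> B"
      then have mA: "m \<in> At" using AB by blast
      have "m \<sqsubseteq> J (B \<inter> At)" using J_upper[OF AtE, of m A] mA AB(1,3) by simp
      moreover have "\<forall>d\<in>B \<inter> At. (m, d) \<in> r \<and> m \<noteq> d" using AB(5) nB by blast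
      ultimately show False using nbcD[OF AB(4) mA subset_refl] by blast
    qed
    have "m \<in> S \<and> m \<in> ?l"
      using m mem[of S ?l] mem[of ?l S] cls Cons.prems by auto
    moreover have "m = s" using calculation m smin r_antisym[of m s] by auto
    ultimately have sS: "s \<in> S" "\<forall>q\<in>S. (s, q) \<in> r" using m by auto
    \<comment> \<open>Only removal of the first element contributes: if another removal did,
      \<open>s\<close> would lie below the join of the atoms of \<open>ss\<close>, all of which come
      after \<open>s\<close>.\<close>
    have zero: "flag_value ss (S - {t}) = 0" if t: "t \<in> S" "t \<noteq> s" for t
    proof (rule ccontr)
      assume "flag_value ss (S - {t}) \<noteq> 0"
      then have c: "(S - {t}) - At = set ss - At" "J ((S - {t}) \<inter> At) = J (set ss \<inter> At)"
        using flag_value_class[of ss "S - {t}"] by (auto simp: span_class_def)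
      have s: "s \<in> S - {t}" "s \<notin> set ss" using sS t Cons.prems by auto
      then have sA: "s \<in> At" using c(1) by blast
      have "s \<sqsubseteq> J (set ss \<inter> At)" using J_upper[OF AtE, of s "S - {t}"] s sA c(2) by simp
      moreover have "\<forall>d\<in>set ss \<inter> At. (s, d) \<in> r \<and> s \<noteq> d" using smin s by auto
      moreover have "set ss \<inter> At \<subseteq> ?l \<inter> At" by auto
      ultimately show False using nbcD[OF Cons.prems(4) sA] by blast
    qed
    have "{h \<in> S. h \<noteq> s \<and> (h, s) \<in> r} = {}" using sS r_antisym by blast
    then have p: "preceding S s = 0" by (simp only: card.empty)
    have "flag_value (s # ss) S = (\<Sum>t\<in>S. (-1) ^ preceding S t * flag_value ss (S - {t}))"
      using True by simp
    also have "\<dots> = (\<Sum>t\<in>S. if t = s then flag_value ss (S - {s}) else 0)"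
      using zero p by (intro sum.cong) auto
    also have "\<dots> = flag_value ss (S - {s})" using fin sS by simp
    also have "\<dots> = (if S - {s} = set ss then 1 else 0)"
      using Cons.prems nbc_mono[of ?l "set ss"] nbc_mono[of S "S - {s}"] by (intro Cons.IH) auto
    also have "S - {s} = set ss \<longleftrightarrow> S = ?l" using sS Cons.prems(2) by auto
    finally show ?thesis .
  qed
qed simp

lemma basis_monomials_iff:
  "(S, b) \<in> basis_monomials L H r \<longleftrightarrow> S \<in> nbc_sets L H r \<and> S \<subseteq> H \<and> b \<in> admissible H S"
  unfolding basis_monomials_def Let_def admissible_def
  by (auto simp: nested_sets_iff in_keys_iff)

text \<open>The flag of \<open>S0\<close> in increasing order separates \<open>S0\<close> from all
  other no-broken-circuit sets. For \<open>S = S0\<close> the polynomial factor decides, and there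
  \<open>weight b\<close> is a plain monomial because admissible exponents avoid atoms.\<close>

lemma dual_functional:
  assumes m: "(S0, b0) \<in> basis_monomials L H r"
  obtains l v where "set l = S0" "\<And>f. f \<in> nonface_ideal H (set l) \<Longrightarrow> lin v f = 0"
    "\<And>S b. (S, b) \<in> basis_monomials L H r \<Longrightarrow> functional l v (gc_monom S b) = (if (S, b) = (S0, b0) then 1 else 0)"
proof -
  have S0: "S0 \<subseteq> H" "nbc S0" using m nbc_sets_nbc by (auto simp: basis_monomials_iff)
  obtain l where l: "set l = S0" "distinct l" "sorted_wrt (\<lambda>p q. (p, q) \<in> r) l"
    using linear_order_sorted_list[OF linear sub_H(1)[OF S0(1)] S0(1)] by blast
  obtain v where v: "\<forall>f\<in>nonface_ideal H S0. lin v f = 0"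
    "\<forall>b\<in>admissible H S0. v b = (if b = b0 then 1 else 0)"
    using commutative_functional[OF H S0(1), of "\<lambda>b. if b = b0 then 1 else 0"] by blast
  have "functional l v (gc_monom S b) = (if (S, b) = (S0, b0) then 1 else 0)"
    if Sb: "(S, b) \<in> basis_monomials L H r" for S b
  proof (cases "S = S0")
    case True
    then have b: "b \<in> admissible H S0" using Sb basis_monomials_iff by blast
    then have "weight b = Poly_Mapping.single b 1"
      using admissible_keys[OF H S0(1)] by (intro weight_nonatoms)
    then show ?thesis
      using True b v(2) flag_value_nbc[of l S0] l S0 by (simp add: functional_monom lin_single)
  next
    case False
    then show ?thesis
      using flag_value_nbc[of l S] l S0 Sb nbc_sets_nbc by (auto simp: functional_monom basis_monomials_iff)
  qed
  then show thesis using that[OF l(1)] v(1) l(1) by blast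
qed

lemma functional_linear: "RI.linear_functional (functional l v)"
  by (simp add: RI.linear_functional_def gc_algebra_simps functional_simps)

lemma functional_I:
  assumes "set l \<subseteq> H" "\<And>f. f \<in> nonface_ideal H (set l) \<Longrightarrow> lin v f = 0" "f \<in> I"
  shows "functional l v f = 0"
  using assms(3) unfolding Bhat_ideal_def
  by (rule RI.functional_ideal[OF functional_linear relations_carrier, rotated])
    (use functional_relations[OF assms(1,2)] in \<open>simp add: gc_algebra_simps\<close>)

lemma Bhat_algebra_eq: "Bhat_algebra L H r = RI.Q"
  by (simp add: Bhat_algebra_def)

lemma basis_carrier: "(S, b) \<in> basis_monomials L H r \<Longrightarrow> gc_monom S b \<in> carrier R"
  by (auto simp: basis_monomials_iff admissible_def intro: monom_carrier)

lemma Bhat_monom_eq: "Bhat_monom L H r (S, b) = I +>\<^bsub>R\<^esub> gc_monom S b"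
  by (simp add: Bhat_monom_def)

lemma Bhat_span:
  assumes W: "rat_algebra.subspace_closed RI.Q W"
    and basis: "\<And>m. m \<in> basis_monomials L H r \<Longrightarrow> Bhat_monom L H r m \<in> W"
  shows "carrier RI.Q \<subseteq> W"
proof -
  let ?W = "{a \<in> carrier R. I +>\<^bsub>R\<^esub> a \<in> W}"
  have cl: "RI.subspace_closed ?W" by (rule RI.quot_span[OF W])
  have IW: "I \<in> W"
    using W unfolding rat_algebra.subspace_closed_def[OF RI.quot_rat_algebra] RI.quot_ops(3) by blast
  have "carrier R \<subseteq> ?W"
  proof (rule monomials_span)
    show "0 \<in> ?W" "\<And>f g. f \<in> ?W \<Longrightarrow> g \<in> ?W \<Longrightarrow> f + g \<in> ?W" "\<And>c f. f \<in> ?W \<Longrightarrow> gc_scale c f \<in> ?W"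
      using cl unfolding RI.subspace_closed_def gc_algebra_simps by blast+
    show "I \<subseteq> ?W" using RI.coset_mem IW I_carrier by auto
    show "gc_monom S b \<in> ?W" if "(S, b) \<in> basis_monomials L H r" for S b
      using basis[OF that] basis_carrier[OF that] by (simp add: Bhat_monom_eq)
  qed
  then show ?thesis unfolding RI.quot_carrier by blast
qed

theorem Bhat_basis: "rat_basis (Bhat_algebra L H r) (Bhat_monom L H r) (basis_monomials L H r)"
  unfolding Bhat_algebra_eq
proof (rule rat_algebra.rat_basisI[OF RI.quot_rat_algebra])
  show "Bhat_monom L H r m \<in> carrier RI.Q" if "m \<in> basis_monomials L H r" for m
    using that basis_carrier by (cases m) (auto simp: Bhat_monom_eq RI.quot_carrier)
  show "carrier RI.Q \<subseteq> W" if "rat_algebra.subspace_closed RI.Q W"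
    "\<And>m. m \<in> basis_monomials L H r \<Longrightarrow> Bhat_monom L H r m \<in> W" for W
    using Bhat_span[OF that] .
  fix m assume m: "m \<in> basis_monomials L H r"
  obtain S0 b0 where Sb: "m = (S0, b0)" by (cases m)
  obtain l v where lv: "set l = S0" "\<And>f. f \<in> nonface_ideal H (set l) \<Longrightarrow> lin v f = 0"
    "\<And>S b. (S, b) \<in> basis_monomials L H r \<Longrightarrow> functional l v (gc_monom S b) = (if (S, b) = (S0, b0) then 1 else 0)"
    by (rule dual_functional[OF m[unfolded Sb]]) blast
  have "set l \<subseteq> H" using lv(1) m Sb basis_monomials_iff by auto
  then obtain \<phi> where \<phi>: "rat_algebra.linear_functional RI.Q \<phi>"
    "\<And>a. a \<in> carrier R \<Longrightarrow> \<phi> (I +>\<^bsub>R\<^esub> a) = functional l v a"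
    using RI.quot_functional[OF functional_linear functional_I[OF _ lv(2)]] by metis
  then show "\<exists>\<phi>. rat_algebra.linear_functional RI.Q \<phi> \<and>
      (\<forall>m'\<in>basis_monomials L H r. \<phi> (Bhat_monom L H r m') = (if m' = m then 1 else 0))"
  proof (intro exI[of _ \<phi>] conjI ballI \<phi>(1))
    fix m' assume m': "m' \<in> basis_monomials L H r"
    obtain S b where S: "m' = (S, b)" by (cases m')
    have "\<phi> (Bhat_monom L H r m') = functional l v (gc_monom S b)"
      unfolding S Bhat_monom_eq using m' S by (intro \<phi>(2) basis_carrier) simp
    then show "\<phi> (Bhat_monom L H r m') = (if m' = m then 1 else 0)"
      using lv(3) m' S Sb by simp
  qed
qed

subsection \<open>The quotient by the generator of the top element\<close>

text \<open>If the top element is no atom, the non-atomic parts differ. If it is an atom,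
  \<open>set l\<close> is empty and the joins differ.\<close>

lemma flag_value_top:
  assumes l: "set l \<subseteq> H" "\<top> \<notin> set l" and S: "\<top> \<in> S"
  shows "flag_value l S = 0"
proof (rule ccontr)
  assume "flag_value l S \<noteq> 0"
  then have cls: "S - At = set l - At" "J (S \<inter> At) = J (set l \<inter> At)"
    using flag_value_class[of l S] by (auto simp: span_class_def)
  then have top: "\<top> \<in> At" using S l by blast
  have top_only: "s = \<top>" if "s \<in> set l" for s
    using le_atom[OF top, of s] le_top that l pbs_E[OF H] pbs_bot[OF H] by blast
  have "set l = {}"
  proof (rule ccontr)
    assume "set l \<noteq> {}"
    then obtain s where s: "s \<in> set l" by (meson ex_in_conv)
    then show False using top_only[OF s] l(2) by simp
  qed
  then have "J (S \<inter> At) = \<bottom>" using cls J_empty by simp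
  moreover have "\<top> \<sqsubseteq> J (S \<inter> At)" using S top At_E by (intro J_upper) auto
  ultimately show False using le_bot[OF top_in] atom_not_bot[OF top] by simp
qed

context
  assumes top: "\<top> \<in> H"
begin

lemma top_gen: "gc_monom {\<top>} 0 \<in> carrier R"
  using top by (rule e_carrier)

lemma B_ideal_ideal: "ideal (B_ideal L H r) RI.Q"
  unfolding B_ideal_def Bhat_algebra_eq
  using top_gen by (intro ring.genideal_ideal rat_algebra.ring[OF RI.quot_rat_algebra])
    (auto simp: Bhat_monom_eq RI.quot_carrier)

interpretation BI: rat_algebra_ideal RI.Q "B_ideal L H r"
  by (rule rat_algebra_ideal.intro[OF RI.quot_rat_algebra B_ideal_ideal])

lemma top_monom_ideal:
  assumes Sb: "(S, b) \<in> basis_monomials L H r" and S: "\<top> \<in> S"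
  shows "Bhat_monom L H r (S, b) \<in> B_ideal L H r"
proof -
  let ?S = "S - {\<top>}"
  have SH: "S \<subseteq> H" "Poly_Mapping.keys b \<subseteq> H"
    using Sb by (auto simp: basis_monomials_iff admissible_def)
  have m: "gc_monom ?S b \<in> carrier R" using SH by (intro monom_carrier) auto
  let ?c = "gc_scale ((-1) ^ preceding ?S \<top>) (gc_monom ?S b)"
  have c: "?c \<in> carrier R" using m by (rule gc_carrier_closed)
  have "insert \<top> ?S = S" using S by blast
  then have "gc_monom S b = gc_mult r (gc_monom {\<top>} 0) ?c"
    using monom_insert[of \<top> ?S b] by (simp add: gc_mult_scale)
  then have "Bhat_monom L H r (S, b) = Bhat_monom L H r ({\<top>}, 0) \<otimes>\<^bsub>RI.Q\<^esub> (I +>\<^bsub>R\<^esub> ?c)"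
    using RI.quot_ops(2)[OF top_gen c] by (simp add: Bhat_monom_eq gc_algebra_simps)
  moreover have "Bhat_monom L H r ({\<top>}, 0) \<in> B_ideal L H r"
    unfolding B_ideal_def Bhat_algebra_eq
    using ring.genideal_self'[OF rat_algebra.ring[OF RI.quot_rat_algebra]] top_gen
    by (auto simp: Bhat_monom_eq RI.quot_carrier)
  moreover have "I +>\<^bsub>R\<^esub> ?c \<in> carrier RI.Q" using c RI.quot_carrier by blast
  ultimately show ?thesis using BI.I_r_closed by simp
qed

text \<open>Dual functionals of basis monomials without the top generator vanish on its multiples by
  \<open>flag_value_top\<close> and so descend. The other basis monomials are multiples of that
  generator and become zero.\<close>

lemma B_basis_top:
  "rat_basis (B_algebra L H r) (B_monom L H r) {(S, b) \<in> basis_monomials L H r. \<top> \<notin> S}"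
proof -
  let ?M = "{(S, b) \<in> basis_monomials L H r. \<top> \<notin> S}"
  have B: "B_algebra L H r = BI.Q" by (simp add: B_algebra_def Bhat_algebra_eq)
  have Bm: "B_monom L H r m = B_ideal L H r +>\<^bsub>RI.Q\<^esub> Bhat_monom L H r m" for m
    by (simp add: B_monom_def Bhat_algebra_eq)
  have mQ: "Bhat_monom L H r m \<in> carrier RI.Q" if "m \<in> basis_monomials L H r" for m
    using that basis_carrier by (cases m) (auto simp: Bhat_monom_eq RI.quot_carrier)
  show ?thesis
    unfolding B
  proof (rule rat_algebra.rat_basisI[OF BI.quot_rat_algebra])
    show "B_monom L H r m \<in> carrier BI.Q" if "m \<in> ?M" for m
      using mQ[of m] that unfolding Bm BI.quot_carrier by blast
  next
    fix W assume W: "rat_algebra.subspace_closed BI.Q W" and basis: "\<And>m. m \<in> ?M \<Longrightarrow> B_monom L H r m \<in> W"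
    let ?W = "{a \<in> carrier RI.Q. B_ideal L H r +>\<^bsub>RI.Q\<^esub> a \<in> W}"
    have zero: "B_ideal L H r \<in> W"
      using W unfolding rat_algebra.subspace_closed_def[OF BI.quot_rat_algebra] BI.quot_ops(3) by blast
    have "carrier RI.Q \<subseteq> ?W"
    proof (rule Bhat_span)
      show "rat_algebra.subspace_closed RI.Q ?W" by (rule BI.quot_span[OF W])
      show "Bhat_monom L H r m \<in> ?W" if m: "m \<in> basis_monomials L H r" for m
      proof (cases "m \<in> ?M")
        case True
        then show ?thesis using basis[OF True] mQ[OF m] by (simp add: Bm)
      next
        case False
        then have "Bhat_monom L H r m \<in> B_ideal L H r" using m top_monom_ideal by (cases m) auto
        then show ?thesis using BI.coset_mem zero mQ[OF m] by simp
      qed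
    qed
    then show "carrier BI.Q \<subseteq> W" unfolding BI.quot_carrier by blast
  next
    fix m assume m: "m \<in> ?M"
    obtain S0 b0 where Sb: "m = (S0, b0)" "(S0, b0) \<in> basis_monomials L H r" "\<top> \<notin> S0" using m by auto
    obtain l v where lv: "set l = S0" "\<And>f. f \<in> nonface_ideal H (set l) \<Longrightarrow> lin v f = 0"
      "\<And>S b. (S, b) \<in> basis_monomials L H r \<Longrightarrow> functional l v (gc_monom S b) = (if (S, b) = (S0, b0) then 1 else 0)"
      by (rule dual_functional[OF Sb(2)]) blast
    have l: "set l \<subseteq> H" "\<top> \<notin> set l" using lv(1) Sb basis_monomials_iff by auto
    obtain \<phi> where \<phi>: "rat_algebra.linear_functional RI.Q \<phi>"
      "\<And>a. a \<in> carrier R \<Longrightarrow> \<phi> (I +>\<^bsub>R\<^esub> a) = functional l v a"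
      using RI.quot_functional[OF functional_linear functional_I[OF l(1) lv(2)]] by metis
    have vanish: "functional l v (gc_mult r (gc_mult r h (gc_monom {\<top>} 0)) k) = 0"
      if hk: "h \<in> carrier R" "k \<in> carrier R" for h k
    proof (rule functional_two_sided[OF top_gen hk])
      fix S1 S2 :: "'a set" and b1 b2 :: "'a \<Rightarrow>\<^sub>0 nat"
      obtain c where "gc_mult r (gc_mult r (gc_monom S1 b1) (gc_monom {\<top>} 0)) (gc_monom S2 b2) =
          gc_scale c (gc_monom (S1 \<union> {\<top>} \<union> S2) (b1 + 0 + b2))"
        using monom_mult_triple[of S1 "{\<top>}" S2] by metis
      then show "functional l v (gc_mult r (gc_mult r (gc_monom S1 b1) (gc_monom {\<top>} 0)) (gc_monom S2 b2)) = 0"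
        using flag_value_top[OF l] by (simp add: functional_simps functional_monom)
    qed
    have "\<phi> x = 0" if "x \<in> B_ideal L H r" for x
    proof (rule rat_algebra.functional_ideal[OF RI.quot_rat_algebra \<phi>(1)])
      show "x \<in> Idl\<^bsub>RI.Q\<^esub> {Bhat_monom L H r ({\<top>}, 0)}"
        using that by (simp add: B_ideal_def Bhat_algebra_eq)
      show "{Bhat_monom L H r ({\<top>}, 0)} \<subseteq> carrier RI.Q"
        using top_gen by (auto simp: Bhat_monom_eq RI.quot_carrier)
      fix h f k assume f: "f \<in> {Bhat_monom L H r ({\<top>}, 0)}" and hk: "h \<in> carrier RI.Q" "k \<in> carrier RI.Q"
      obtain h0 k0 where h0: "h = I +>\<^bsub>R\<^esub> h0" "h0 \<in> carrier R" and k0: "k = I +>\<^bsub>R\<^esub> k0" "k0 \<in> carrier R"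
        using hk unfolding RI.quot_carrier by blast
      have "h \<otimes>\<^bsub>RI.Q\<^esub> f = I +>\<^bsub>R\<^esub> gc_mult r h0 (gc_monom {\<top>} 0)"
        using f h0 RI.quot_ops(2)[OF h0(2) top_gen] by (simp add: Bhat_monom_eq gc_algebra_simps)
      then have "h \<otimes>\<^bsub>RI.Q\<^esub> f \<otimes>\<^bsub>RI.Q\<^esub> k = I +>\<^bsub>R\<^esub> gc_mult r (gc_mult r h0 (gc_monom {\<top>} 0)) k0"
        using RI.quot_ops(2)[OF gc_mult_closed[OF h0(2) top_gen] k0(2)] k0(1) by (simp add: gc_algebra_simps)
      then show "\<phi> (h \<otimes>\<^bsub>RI.Q\<^esub> f \<otimes>\<^bsub>RI.Q\<^esub> k) = 0"
        using \<phi>(2) vanish[OF h0(2) k0(2)] gc_mult_closed[OF gc_mult_closed[OF h0(2) top_gen] k0(2)] by simp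
    qed
    then obtain \<phi>' where \<phi>': "rat_algebra.linear_functional BI.Q \<phi>'"
      "\<And>a. a \<in> carrier RI.Q \<Longrightarrow> \<phi>' (B_ideal L H r +>\<^bsub>RI.Q\<^esub> a) = \<phi> a"
      using BI.quot_functional[OF \<phi>(1)] by metis
    have "\<phi>' (B_monom L H r m') = (if m' = m then 1 else 0)" if m': "m' \<in> ?M" for m'
    proof -
      obtain S b where S: "m' = (S, b)" "(S, b) \<in> basis_monomials L H r" using m' by auto
      have "\<phi>' (B_monom L H r m') = \<phi> (Bhat_monom L H r m')"
        unfolding Bm S(1) by (rule \<phi>'(2)[OF mQ[OF S(2)]])
      also have "\<dots> = functional l v (gc_monom S b)"
        unfolding S(1) Bhat_monom_eq by (rule \<phi>(2)[OF basis_carrier[OF S(2)]])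
      finally show ?thesis using lv(3)[OF S(2)] S(1) Sb(1) by simp
    qed
    then show "\<exists>\<phi>. rat_algebra.linear_functional BI.Q \<phi> \<and>
        (\<forall>m'\<in>?M. \<phi> (B_monom L H r m') = (if m' = m then 1 else 0))"
      using \<phi>'(1) by blast
  qed
qed

end

end

theorem corollary5p3p2:
  fixes L :: "'a gorder" and H :: "'a set" and r :: "'a rel"
  assumes "geometric_lattice L"
    and "partial_building_set L H"
    and "compatible_order L H r"
  shows "rat_basis (Bhat_algebra L H r) (Bhat_monom L H r) (basis_monomials L H r) \<and>
    (\<top>\<^bsub>L\<^esub> \<in> H \<longrightarrow>
       rat_basis (B_algebra L H r) (B_monom L H r) {(S, b) \<in> basis_monomials L H r. \<top>\<^bsub>L\<^esub> \<notin> S})"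
proof -
  obtain G where G: "building_set L G" "H \<subseteq> G" "atoms L \<subseteq> H"
    "\<forall>p \<in> H - atoms L. \<forall>q \<in> G. p \<sqsubseteq>\<^bsub>L\<^esub> q \<longrightarrow> q \<in> H - atoms L"
    using assms(2) unfolding partial_building_set_def by blast
  interpret B: building L G
    by (rule building.intro[OF geom_lattice.intro[OF assms(1)] building_axioms.intro[OF G(1)]])
  interpret nested_algebra L G H r
    by (rule nested_algebra.intro[OF B.building_axioms nested_algebra_axioms.intro])
      (use G assms(3) B.pbs_def in blast)+
  show ?thesis using Bhat_basis B_basis_top by blast
qed

end
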